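(* Let $T$ be a bounded linear operator on a complex Hilbert space $\mathcal{H}$. Then $$\mathrm{SRG}(T)=g\big(\mathrm{W}(f(T))\big).$$ In addition: (i) $\mathrm{SRG}(T)=\mathrm{co}_{\mathrm{BK}}(\mathrm{SRG}(T))$; (ii) if $TT^*=T^*T$, then $\mathrm{cl}\,\mathrm{SRG}(T)=\mathrm{co}_{\mathrm{BK}}(\sigma_{\mathrm{ap}}(T))$; (iii) $\mathrm{cl}\,\mathrm{SRG}(T)\supseteq\sigma_{\mathrm{ap}}(T)$; (iv) $\bigcap\{\mathrm{cl}\,\mathrm{SRG}(STS^{-1}) : S,S^{-1}\text{ are bounded linear operators on }\mathcal{H}\}=\mathrm{co}_{\mathrm{BK}}(\sigma_{\mathrm{ap}}(T))$. Furthermore, the following are equivalent: (v) $\mathrm{cl}\,\mathrm{SRG}(T)\supseteq\sigma(T)$; (vi) $\bigcap\{\mathrm{cl}\,\mathrm{SRG}(STS^{-1}) : S,S^{-1}\text{ are bounded linear operators on }\mathcal{H}\}=\mathrm{co}_{\mathrm{BK}}(\sigma(T))$; (vii) $\mathrm{cl}\,\mathrm{SRG}(T)\supseteq\mathrm{cl}\,\mathrm{SRG}(T^* )$; (viii) $\sigma_{\mathrm{ap}}(T)\supseteq\sigma(T)\cap\mathbb{R}$.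
   Context: Let $\mathcal{H}$ be a complex Hilbert space with inner product $\langle\cdot,\cdot\rangle$ (linear in the first argument) and norm $\|\cdot\|$. $I$ is the identity operator, $T^*$ is the adjoint of $T$, and $\mathrm{cl}$ denotes closure in $\mathbb{C}$. For a bounded linear operator $T:\mathcal{H}\to\mathcal{H}$: - Scaled relative graph: $$\mathrm{SRG}(T)=\left\{\frac{\|y\|}{\|x\|}\exp\left(\pm i\arccos\left(\frac{\mathrm{Re}\langle y,x\rangle}{\|y\|\,\|x\|}\right)\right): x\in\mathcal{H},\ \|x\|=1,\ y=Tx\right\}\subseteq\mathbb{C},$$ where both signs are included, and the element contributed by $x$ is understood to be $0$ when $Tx=0$. - Numerical range: $\mathrm{W}(T)=\{\langle Tx,x\rangle : x\in\mathcal{H},\ \|x\|=1\}$. - Spectrum: $\sigma(T)=\{z\in\mathbb{C}: T-zI\text{ has no bounded linear inverse}\}$. Approximate point spectrum: $\sigma_{\mathrm{ap}}(T)$ is the set of $\lambda\in\sigma(T)$ for which there is a sequence of unit vectors $x_n\in\mathcal{H}$ with $\lim_{n\to\infty}\|(T-\lambda I)x_n\|=0$. - Beltrami-Klein mapping: for $z\in\mathbb{C}$, $$f(z)=\frac{(\bar z-i)(z-i)}{1+\bar z z},$$ which maps $\mathbb{C}$ into the closed unit disk, and for bounded linear operators $$f(T)=(I+T^*T)^{-1/2}(T^*-iI)(T-iI)(I+T^*T)^{-1/2}.$$ - For $z$ in the closed unit disk with $z\neq 1$, $g(z)$ is the set $$g(z)=\left\{\frac{\mathrm{Im}(z)\pm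 i\sqrt{1-|z|^2}}{\mathrm{Re}(z)-1}\right\}$$ (both signs), so that $g(f(z))=\{z,\bar z\}$ for every $z\in\mathbb{C}$. - For sets $s$, $f(s)=\{f(z):z\in s\}$ and $g(s)=\bigcup_{z\in s}g(z)$. With $\mathrm{co}(\cdot)$ denoting the usual convex hull in $\mathbb{C}$, for $s\subseteq\mathbb{C}$ define $\mathrm{co}_{\mathrm{BK}}(s)=g(\mathrm{co}(f(s)))$. *)

theory Defs
  imports "HOL-Analysis.Analysis"
begin

section \<open>Complex Hilbert spaces and bounded operators\<close>

text \<open>
  The norm is tied to \<open>cinner\<close> through the real inner product: \<open>x \<bullet> y = Re (cinner x y)\<close>.
  Dimension is unrestricted; the zero space is included.
\<close>

class complex_hilbert_space = real_inner + complete_space +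
  fixes scaleC :: "complex \<Rightarrow> 'a \<Rightarrow> 'a" (infixr "*\<^sub>C" 75)
    and cinner :: "'a \<Rightarrow> 'a \<Rightarrow> complex"
  assumes scaleC_add_right: "a *\<^sub>C (x + y) = a *\<^sub>C x + a *\<^sub>C y"
    and scaleC_add_left: "(a + b) *\<^sub>C x = a *\<^sub>C x + b *\<^sub>C x"
    and scaleC_scaleC: "a *\<^sub>C b *\<^sub>C x = (a * b) *\<^sub>C x"
    and scaleC_of_real: "complex_of_real r *\<^sub>C x = r *\<^sub>R x"
    and cinner_commute: "cinner x y = cnj (cinner y x)"
    and cinner_add_left: "cinner (x + y) z = cinner x z + cinner y z"
    and cinner_scaleC_left: "cinner (a *\<^sub>C x) y = a * cinner x y"
    and Re_cinner: "Re (cinner x y) = x \<bullet> y"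

lemma scaleC_one: "1 *\<^sub>C x = (x :: 'a::complex_hilbert_space)"
  using scaleC_of_real[of 1 x] by simp

lemma cinner_self: "cinner x x = complex_of_real ((norm (x :: 'a::complex_hilbert_space))\<^sup>2)"
  using cinner_commute[of x x] Re_cinner[of x x]
  by (simp add: complex_eq_iff power2_norm_eq_inner)

instantiation complex :: complex_hilbert_space
begin

definition scaleC_complex :: "complex \<Rightarrow> complex \<Rightarrow> complex"
  where "scaleC_complex a x = a * x"

definition cinner_complex :: "complex \<Rightarrow> complex \<Rightarrow> complex"
  where "cinner_complex x y = x * cnj y"

instance
  by standard
    (simp_all add: scaleC_complex_def cinner_complex_def inner_complex_def algebra_simps scaleR_conv_of_real)

end

definition bounded_clinear :: "('a::complex_hilbert_space \<Rightarrow> 'a) \<Rightarrow> bool"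
  where "bounded_clinear T \<longleftrightarrow> bounded_linear T \<and> (\<forall>c x. T (c *\<^sub>C x) = c *\<^sub>C T x)"

definition cadjoint :: "('a::complex_hilbert_space \<Rightarrow> 'a) \<Rightarrow> 'a \<Rightarrow> 'a"
  where "cadjoint T = (THE S. \<forall>x y. cinner (T x) y = cinner x (S y))"

lemma cadjoint_eqI:
  assumes "\<And>x y. cinner (T x) y = cinner x (S y)"
  shows "cadjoint T = S"
  unfolding cadjoint_def
proof (rule the_equality)
  fix S' assume "\<forall>x y. cinner (T x) y = cinner x (S' y)"
  then have "x \<bullet> S' y = x \<bullet> S y" for x y
    using assms by (metis Re_cinner)
  then show "S' = S"
    by (metis ext vector_eq_ldot)
qed (use assms in simp)

definition positive_op :: "('a::complex_hilbert_space \<Rightarrow> 'a) \<Rightarrow> bool"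
  where "positive_op A \<longleftrightarrow> bounded_clinear A \<and> (\<forall>x. cinner (A x) x \<in> \<real>\<^sub>\<ge>\<^sub>0)"

definition sqrt_op :: "('a::complex_hilbert_space \<Rightarrow> 'a) \<Rightarrow> 'a \<Rightarrow> 'a"
  where "sqrt_op A = (THE B. positive_op B \<and> B \<circ> B = A)"


section \<open>Scaled relative graph, numerical range and spectra\<close>

text \<open>
  If \<open>T x = 0\<close>, the modulus of the contributed element is \<open>0\<close>, hence so is the element,
  whatever the value of \<open>arccos\<close> at the quotient \<open>0 / 0\<close>.
\<close>

definition SRG :: "('a::complex_hilbert_space \<Rightarrow> 'a) \<Rightarrow> complex set"
  where "SRG T =
    {complex_of_real (norm y / norm x)
       * exp (s * \<i> * complex_of_real (arccos (Re (cinner y x) / (norm y * norm x))))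
     | s x y. s \<in> {1, -1} \<and> norm x = 1 \<and> y = T x}"

definition numerical_range :: "('a::complex_hilbert_space \<Rightarrow> 'a) \<Rightarrow> complex set"
  where "numerical_range T = {cinner (T x) x | x. norm x = 1}"

definition spectrum :: "('a::complex_hilbert_space \<Rightarrow> 'a) \<Rightarrow> complex set"
  where "spectrum T =
    {z. \<not> (\<exists>R. bounded_clinear R \<and> R \<circ> (\<lambda>x. T x - z *\<^sub>C x) = id \<and> (\<lambda>x. T x - z *\<^sub>C x) \<circ> R = id)}"

definition approx_point_spectrum :: "('a::complex_hilbert_space \<Rightarrow> 'a) \<Rightarrow> complex set"
  where "approx_point_spectrum T =
    {z \<in> spectrum T. \<exists>x :: nat \<Rightarrow> 'a. (\<forall>n. norm (x n) = 1)
       \<and> (\<lambda>n. norm (T (x n) - z *\<^sub>C x n)) \<longlonglongrightarrow> 0}"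


section \<open>The Beltrami--Klein mapping\<close>

definition bk :: "complex \<Rightarrow> complex"
  where "bk z = (cnj z - \<i>) * (z - \<i>) / (1 + cnj z * z)"

definition bk_op :: "('a::complex_hilbert_space \<Rightarrow> 'a) \<Rightarrow> 'a \<Rightarrow> 'a"
  where "bk_op T =
    (let R = inv (sqrt_op (\<lambda>x. x + cadjoint T (T x)))
     in R \<circ> (\<lambda>x. cadjoint T x - \<i> *\<^sub>C x) \<circ> (\<lambda>x. T x - \<i> *\<^sub>C x) \<circ> R)"

text \<open>
  The set-valued map below is meant on the closed unit disk without the point \<open>1\<close>; outside it, its
  value is an artefact of totality. Sets of the form \<open>convex hull (bk ` s)\<close> stay inside this
  domain: they lie in the disk, and \<open>1\<close> is an extreme point of the disk omitted by \<open>bk\<close>.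
  Likewise \<open>1\<close> is not in the numerical range of \<open>bk_op T\<close>, which lies in the disk.
\<close>

definition bk_inv :: "complex \<Rightarrow> complex set"
  where "bk_inv z =
    {(complex_of_real (Im z) + s * \<i> * complex_of_real (sqrt (1 - (cmod z)\<^sup>2)))
       / complex_of_real (Re z - 1) | s. s \<in> {1, -1}}"

definition bk_inv_image :: "complex set \<Rightarrow> complex set"
  where "bk_inv_image s = (\<Union>z\<in>s. bk_inv z)"

definition co_BK :: "complex set \<Rightarrow> complex set"
  where "co_BK s = bk_inv_image (convex hull (bk ` s))"

lemma bk_eq:
  "bk z = Complex (((cmod z)\<^sup>2 - 1) / (1 + (cmod z)\<^sup>2)) (- 2 * Re z / (1 + (cmod z)\<^sup>2))"
proof -
  have den: "1 + cnj z * z = complex_of_real (1 + (cmod z)\<^sup>2)"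
    by (simp add: complex_eq_iff cmod_power2) (simp add: power2_eq_square)
  have num: "(cnj z - \<i>) * (z - \<i>) = Complex ((cmod z)\<^sup>2 - 1) (- 2 * Re z)"
    by (simp add: complex_eq_iff cmod_power2) (simp add: power2_eq_square algebra_simps)
  show ?thesis
    unfolding bk_def den num
    by (simp only: complex_eq_iff Re_divide_of_real Im_divide_of_real complex.sel simp_thms)
qed

lemma one_minus_cmod_bk:
  "1 - (cmod (bk z))\<^sup>2 = (2 * Im z / (1 + (cmod z)\<^sup>2))\<^sup>2"
proof -
  define d where "d = 1 + (cmod z)\<^sup>2"
  have d: "d \<noteq> 0"
    unfolding d_def by (metis add_pos_nonneg less_irrefl zero_le_power2 zero_less_one)
  have "d\<^sup>2 - ((cmod z)\<^sup>2 - 1)\<^sup>2 - (- 2 * Re z)\<^sup>2 = (2 * Im z)\<^sup>2"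
    unfolding d_def by (simp add: cmod_power2) (simp add: power2_eq_square algebra_simps)
  moreover have "1 - (cmod (bk z))\<^sup>2 = (d\<^sup>2 - ((cmod z)\<^sup>2 - 1)\<^sup>2 - (- 2 * Re z)\<^sup>2) / d\<^sup>2"
    unfolding bk_eq cmod_power2[of "Complex _ _"] complex.sel d_def[symmetric] power_divide
    using d by (simp add: field_simps)
  ultimately show ?thesis
    by (simp add: power_divide d_def)
qed

lemma cmod_bk_le_1: "cmod (bk z) \<le> 1"
  using one_minus_cmod_bk[of z]
  by (metis abs_norm_cancel abs_square_le_1 diff_ge_0_iff_ge zero_le_power2)

lemma bk_inv_bk: "bk_inv (bk z) = {z, cnj z}"
proof -
  define d where "d = 1 + (cmod z)\<^sup>2"
  have d: "d > 0"
    unfolding d_def by (simp add: add_pos_nonneg)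
  have re: "Re (bk z) - 1 = - 2 / d" and im: "Im (bk z) = - 2 * Re z / d"
    using d by (simp_all add: bk_eq d_def field_simps)
  have sq: "sqrt (1 - (cmod (bk z))\<^sup>2) = 2 * \<bar>Im z\<bar> / d"
    unfolding one_minus_cmod_bk d_def[symmetric] using d by (simp add: abs_mult)
  have "(complex_of_real (Im (bk z)) + s * \<i> * complex_of_real (sqrt (1 - (cmod (bk z))\<^sup>2)))
       / complex_of_real (Re (bk z) - 1) = complex_of_real (Re z) - s * \<i> * complex_of_real \<bar>Im z\<bar>" for s
    unfolding re im sq using d by (simp add: field_simps)
  then have "bk_inv (bk z) = {complex_of_real (Re z) - s * \<i> * complex_of_real \<bar>Im z\<bar> | s. s \<in> {1, -1}}"
    unfolding bk_inv_def by simp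
  also have "\<dots> = {complex_of_real (Re z) - \<i> * complex_of_real \<bar>Im z\<bar>, complex_of_real (Re z) + \<i> * complex_of_real \<bar>Im z\<bar>}"
    by (auto intro: exI[of _ "1 :: complex"] exI[of _ "-1 :: complex"])
  also have "\<dots> = {z, cnj z}"
    by (cases "Im z \<ge> 0") (auto simp: complex_eq_iff)
  finally show ?thesis .
qed

end

(*
  The map bk sends z to a point that depends only on |z| and Re z, and after renormalising
  the test vectors by (I + T*T)^(1/2) the image of SRG(T) becomes the numerical range of
  f(T), which is convex by Toeplitz-Hausdorff. Chords of the disk correspond to circles centred
  on the real axis, so a point p outside co_BK(ap), ap the approximate point spectrum, is
  separated from ap by a circle |z - t| = rho with t real. For N = T - t the position of ap
  forces |N^n x| >= rho^n |x| for some n (or the reverse inequality): averaging geometric sums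
  over circles that miss ap shows that orbits cannot have flat stretches. The norm
  (sum_{k<n} rho^(-2k) |N^k x|^2)^(1/2) is Hilbertian and equivalent to the given one, and in
  it N itself satisfies the bound; this yields a similarity S with p outside
  cl SRG(S T S^(-1)). If T is normal, then S commutes with T. The equivalences follow from the same separating circles: a disk that misses ap
  and whose real centre is not in the spectrum misses the spectrum.
*)
theory Submission
  imports Defs
begin

\<comment> \<open>A circle with real centre \<open>t\<close> is the right test because, for a unit
  vector \<open>x\<close>, the norm of \<open>T x - t x\<close> depends only on
  \<open>norm (T x)\<close> and \<open>T x \<bullet> x\<close>, the same data that
  \<open>SRG\<close> records: it is the distance from \<open>t\<close> to the points contributed by
  \<open>x\<close>. Lying outside or inside such a circle is thus a lower or upper norm bound for
  \<open>T - t\<close>, and this passes to closures. The obstacle is that only the approximate point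
  spectrum is controlled. \<open>T - t\<close> may be bounded below without being surjective, so
  lower bounds on its powers cannot come from a spectral radius formula for an inverse. They come
  from orbits: every circle that misses the approximate point spectrum gives an energy inequality,
  with one constant for a whole range of radii, and this constant fixes a ratio by which a known
  growth rate can be moved. Finitely many moves lead from a trivial rate to the wanted one. The
  constants lost on the way are absorbed by aiming at a slightly better radius and taking a high
  power.\<close>
subclass (in complex_hilbert_space) banach ..

section \<open>Operators on complex Hilbert spaces\<close>

lemma cinner_add_right: "cinner x (y + z) = cinner x y + cinner (x :: 'a::complex_hilbert_space) z"
  by (metis cinner_add_left cinner_commute complex_cnj_add)

lemma cinner_scaleC_right: "cinner x (a *\<^sub>C y) = cnj a * cinner (x :: 'a::complex_hilbert_space) y"
  by (metis cinner_scaleC_left cinner_commute complex_cnj_mult)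

lemma scaleC_minus_one: "(-1) *\<^sub>C x = - (x :: 'a::complex_hilbert_space)"
  using scaleC_of_real[of "-1" x] by simp

lemma scaleC_zero_left: "0 *\<^sub>C x = (0 :: 'a::complex_hilbert_space)"
  using scaleC_of_real[of 0 x] by simp

lemma scaleC_zero_right: "a *\<^sub>C (0 :: 'a::complex_hilbert_space) = 0"
  using scaleC_add_right[of a 0 0] by simp

lemma scaleC_minus_right: "a *\<^sub>C (- x) = - (a *\<^sub>C (x :: 'a::complex_hilbert_space))"
  by (metis add.right_inverse minus_unique scaleC_add_right scaleC_zero_right)

lemma scaleC_minus_left: "(- a) *\<^sub>C x = - (a *\<^sub>C (x :: 'a::complex_hilbert_space))"
  by (metis add.right_inverse minus_unique scaleC_add_left scaleC_zero_left)

lemma scaleC_diff_right: "a *\<^sub>C (x - y) = a *\<^sub>C x - a *\<^sub>C (y :: 'a::complex_hilbert_space)"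
  using scaleC_add_right[of a x "- y"] by (simp add: scaleC_minus_right)

lemma scaleC_diff_left: "(a - b) *\<^sub>C x = a *\<^sub>C x - b *\<^sub>C (x :: 'a::complex_hilbert_space)"
  using scaleC_add_left[of a "- b" x] by (simp add: scaleC_minus_left)

lemma cinner_minus_left: "cinner (- x) y = - cinner (x :: 'a::complex_hilbert_space) y"
  using cinner_scaleC_left[of "-1" x y] by (simp add: scaleC_minus_one)

lemma cinner_minus_right: "cinner x (- y) = - cinner (x :: 'a::complex_hilbert_space) y"
  using cinner_scaleC_right[of x "-1" y] by (simp add: scaleC_minus_one)

lemma cinner_diff_left: "cinner (x - y) z = cinner x z - cinner (y :: 'a::complex_hilbert_space) z"
  using cinner_add_left[of x "- y" z] by (simp add: cinner_minus_left)

lemma cinner_diff_right: "cinner x (y - z) = cinner x y - cinner (x :: 'a::complex_hilbert_space) z"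
  using cinner_add_right[of x y "- z"] by (simp add: cinner_minus_right)

lemma scaleC_scaleR_commute: "a *\<^sub>C (r *\<^sub>R x) = r *\<^sub>R (a *\<^sub>C (x :: 'a::complex_hilbert_space))"
  by (metis mult.commute scaleC_of_real scaleC_scaleC)

lemma Im_cinner: "Im (cinner x y) = - ((\<i> *\<^sub>C x) \<bullet> (y :: 'a::complex_hilbert_space))"
  by (simp add: Re_cinner[symmetric] cinner_scaleC_left)

lemma norm_scaleC: "norm (a *\<^sub>C x) = cmod a * norm (x :: 'a::complex_hilbert_space)"
proof -
  have "(a *\<^sub>C x) \<bullet> (a *\<^sub>C x) = Re (a * cnj a * cinner x x)"
    by (simp only: Re_cinner[symmetric] cinner_scaleC_left cinner_scaleC_right mult.assoc mult.left_commute)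
  also have "a * cnj a * cinner x x = complex_of_real ((cmod a)\<^sup>2 * (norm x)\<^sup>2)"
    unfolding cinner_self complex_norm_square[symmetric] by simp
  finally have "(norm (a *\<^sub>C x))\<^sup>2 = (cmod a * norm x)\<^sup>2"
    by (simp add: power2_norm_eq_inner power_mult_distrib)
  then show ?thesis
    by (metis mult_nonneg_nonneg norm_ge_zero power2_eq_imp_eq)
qed

lemma bounded_linear_scaleC: "bounded_linear (\<lambda>x :: 'a::complex_hilbert_space. a *\<^sub>C x)"
proof (rule bounded_linear_intro)
  show "norm (a *\<^sub>C x) \<le> norm x * cmod a" for x :: 'a
    by (simp add: norm_scaleC mult.commute)
qed (simp_all add: scaleC_add_right scaleC_scaleR_commute)

lemma bounded_clinearI:
  assumes "bounded_linear T" "\<And>c x. T (c *\<^sub>C x) = c *\<^sub>C T x"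
  shows "bounded_clinear T"
  using assms by (simp add: bounded_clinear_def)

lemma bounded_clinear_linear: "bounded_clinear T \<Longrightarrow> bounded_linear T"
  by (simp add: bounded_clinear_def)

lemma bounded_clinear_scale: "bounded_clinear T \<Longrightarrow> T (c *\<^sub>C x) = c *\<^sub>C T x"
  by (simp add: bounded_clinear_def)

lemmas bounded_clinear_simps =
  bounded_clinear_scale
  bounded_linear.linear[OF bounded_clinear_linear, THEN linear_add]
  bounded_linear.linear[OF bounded_clinear_linear, THEN linear_diff]
  bounded_linear.linear[OF bounded_clinear_linear, THEN linear_0]
  bounded_linear.linear[OF bounded_clinear_linear, THEN linear_scale]

lemma bounded_clinear_id: "bounded_clinear (\<lambda>x. x)"
  by (simp add: bounded_clinear_def)

lemma bounded_clinear_comp: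
  "bounded_clinear S \<Longrightarrow> bounded_clinear T \<Longrightarrow> bounded_clinear (\<lambda>x. S (T x))"
  by (simp add: bounded_clinear_def bounded_linear_compose)

lemma bounded_clinear_add:
  "bounded_clinear S \<Longrightarrow> bounded_clinear T \<Longrightarrow> bounded_clinear (\<lambda>x. S x + T x)"
  by (simp add: bounded_clinear_def bounded_linear_add scaleC_add_right)

lemma bounded_clinear_diff:
  "bounded_clinear S \<Longrightarrow> bounded_clinear T \<Longrightarrow> bounded_clinear (\<lambda>x. S x - T x)"
  by (simp add: bounded_clinear_def bounded_linear_sub scaleC_diff_right)

lemma bounded_clinear_scaleC: "bounded_clinear T \<Longrightarrow> bounded_clinear (\<lambda>x. a *\<^sub>C T x)"
  by (simp add: bounded_clinear_def bounded_linear_compose[OF bounded_linear_scaleC] scaleC_scaleC mult.commute)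

lemma bounded_clinear_scaleR: "bounded_clinear T \<Longrightarrow> bounded_clinear (\<lambda>x. r *\<^sub>R T x)"
  by (simp add: scaleC_of_real[symmetric] bounded_clinear_scaleC)

lemma bounded_clinear_shift: "bounded_clinear T \<Longrightarrow> bounded_clinear (\<lambda>x. T x - z *\<^sub>C x)"
  by (intro bounded_clinear_diff bounded_clinear_scaleC bounded_clinear_id)

lemma bounded_clinear_funpow: "bounded_clinear T \<Longrightarrow> bounded_clinear (T ^^ k)"
  by (induction k) (auto simp: bounded_clinear_id id_def comp_def intro: bounded_clinear_comp)

lemma bounded_clinear_zero: "bounded_clinear (\<lambda>x. 0)"
  by (simp add: bounded_clinear_def scaleC_zero_right)

lemma bounded_clinear_sum:
  "(\<And>i. i \<in> I \<Longrightarrow> bounded_clinear (T i)) \<Longrightarrow> bounded_clinear (\<lambda>x. \<Sum>i\<in>I. T i x)"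
  by (induction I rule: infinite_finite_induct) (auto simp: bounded_clinear_zero bounded_clinear_add)

lemma bounded_clinear_bound:
  assumes "bounded_clinear T"
  obtains M where "M > 0" "\<And>x. norm (T x) \<le> M * norm x"
  using bounded_linear.pos_bounded[OF bounded_clinear_linear[OF assms]] by (metis mult.commute)

section \<open>Operators bounded below, coercivity and surjectivity\<close>

definition bounded_below :: "('a::real_normed_vector \<Rightarrow> 'b::real_normed_vector) \<Rightarrow> bool"
  where "bounded_below A \<longleftrightarrow> (\<exists>c>0. \<forall>x. c * norm x \<le> norm (A x))"

lemma bounded_below_inverse:
  assumes A: "bounded_clinear A" and c: "c > 0" and below: "\<And>x. c * norm x \<le> norm (A x)" and "surj A"
  shows "bij A" "bounded_clinear (inv A)" "norm (inv A y) \<le> norm y / c"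
proof -
  have "inj A"
  proof (rule injI)
    fix x y assume "A x = A y"
    then have "c * norm (x - y) \<le> 0"
      using below[of "x - y"] by (simp add: bounded_clinear_simps[OF A])
    then show "x = y"
      using c by (simp add: mult_le_0_iff)
  qed
  then show bij: "bij A"
    using \<open>surj A\<close> by (simp add: bij_def)
  have A_inv: "A (inv A y) = y" for y
    using \<open>surj A\<close> by (simp add: surj_f_inv_f)
  have inv_eq: "inv A y = x" if "A x = y" for x y
    using \<open>inj A\<close> that by (auto simp: inv_f_f)
  show bound: "norm (inv A y) \<le> norm y / c" for y
    using below[of "inv A y"] c by (simp add: A_inv field_simps)
  show "bounded_clinear (inv A)"
  proof (intro bounded_clinearI bounded_linear_intro[where K = "1 / c"])
    show "inv A (x + y) = inv A x + inv A y" for x y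
      by (rule inv_eq) (simp add: bounded_clinear_simps[OF A] A_inv)
    show "inv A (r *\<^sub>R x) = r *\<^sub>R inv A x" for r x
      by (rule inv_eq) (simp add: bounded_clinear_simps[OF A] A_inv)
    show "inv A (r *\<^sub>C x) = r *\<^sub>C inv A x" for r x
      by (rule inv_eq) (simp add: bounded_clinear_simps[OF A] A_inv)
  qed (use bound in simp)
qed

text \<open>For small \<open>e\<close> the linear gain \<open>2 * e * (A x \<bullet> x)\<close>
  outweighs the quadratic loss \<open>e\<^sup>2 * (norm (A x))\<^sup>2\<close>. Both
  \<open>coercive_surj\<close> and the square root rest on this contraction.\<close>

lemma coercive_contraction:
  fixes A :: "'a::real_inner \<Rightarrow> 'a"
  assumes A: "bounded_linear A" and c: "c > 0" and coercive: "\<And>x. c * (norm x)\<^sup>2 \<le> A x \<bullet> x"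
  obtains e q where "e > 0" "0 \<le> q" "q < 1" "\<And>x. norm (x - e *\<^sub>R A x) \<le> q * norm x"
proof -
  obtain M where M: "M > 0" "\<And>x. norm (A x) \<le> norm x * M"
    using bounded_linear.pos_bounded[OF A] by blast
  \<comment> \<open>\<open>e = c / L\<close> minimises \<open>1 - 2 * e * c + e\<^sup>2 * L\<close>.
    The summand \<open>c\<^sup>2\<close> keeps \<open>c\<^sup>2 / L \<le> 1\<close> also in the zero
    space, where nothing bounds \<open>c\<close> by \<open>M\<close>.\<close>
  define L where "L = M\<^sup>2 + c\<^sup>2"
  define e where "e = c / L"
  define q where "q = sqrt (1 - c\<^sup>2 / L)"
  have L: "L > 0"
    using M(1) by (simp add: L_def add_pos_nonneg)
  have frac: "c\<^sup>2 / L \<le> 1" "c\<^sup>2 / L > 0"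
    using L c by (auto simp: L_def)
  have "norm (x - e *\<^sub>R A x) \<le> q * norm x" for x
  proof -
    have "(norm (A x))\<^sup>2 \<le> (norm x * M)\<^sup>2"
      by (intro power_mono M(2)) auto
    also have "\<dots> \<le> L * (norm x)\<^sup>2"
      by (simp add: L_def power_mult_distrib algebra_simps)
    finally have 1: "e\<^sup>2 * (norm (A x))\<^sup>2 \<le> e\<^sup>2 * (L * (norm x)\<^sup>2)"
      by (intro mult_left_mono) auto
    have 2: "2 * e * (A x \<bullet> x) \<ge> 2 * e * (c * (norm x)\<^sup>2)"
      using coercive[of x] c L by (intro mult_left_mono) (auto simp: e_def)
    have "(norm (x - e *\<^sub>R A x))\<^sup>2 = (norm x)\<^sup>2 - 2 * e * (A x \<bullet> x) + e\<^sup>2 * (norm (A x))\<^sup>2"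
      unfolding power2_norm_eq_inner
      by (simp add: inner_diff_left inner_diff_right inner_commute power2_eq_square algebra_simps)
    also have "\<dots> \<le> (norm x)\<^sup>2 - 2 * e * (c * (norm x)\<^sup>2) + e\<^sup>2 * (L * (norm x)\<^sup>2)"
      using 1 2 by linarith
    also have "\<dots> = (1 - c\<^sup>2 / L) * (norm x)\<^sup>2"
      using L by (simp add: e_def field_simps power2_eq_square)
    also have "\<dots> = (q * norm x)\<^sup>2"
      using frac by (simp add: q_def power_mult_distrib)
    finally show ?thesis
      using frac by (elim power2_le_imp_le) (simp add: q_def)
  qed
  moreover have "e > 0" "0 \<le> q" "q < 1"
    using c L frac by (auto simp: e_def q_def)
  ultimately show ?thesis
    using that by blast
qed

text \<open>The Lax-Milgram argument: solutions of \<open>A x = y\<close> are the fixed points of a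
  damped iteration. It supplies surjectivity for far and nearby shifts, for square roots and for
  \<open>cadjoint A\<close> after \<open>A\<close>.\<close>

lemma coercive_surj:
  fixes A :: "'a::complex_hilbert_space \<Rightarrow> 'a"
  assumes A: "bounded_linear A" and c: "c > 0" and coercive: "\<And>x. c * (norm x)\<^sup>2 \<le> A x \<bullet> x"
  shows "surj A"
proof -
  obtain e q where e: "e > 0" and q: "0 \<le> q" "q < 1" and bound: "\<And>x. norm (x - e *\<^sub>R A x) \<le> q * norm x"
    using coercive_contraction[OF assms] by blast
  interpret A: bounded_linear A by fact
  have "\<exists>x. A x = y" for y
  proof -
    have "\<exists>!x. x - e *\<^sub>R (A x - y) = x"
    proof (rule banach_fix_type[OF q], intro allI)
      fix x z
      have "x - e *\<^sub>R (A x - y) - (z - e *\<^sub>R (A z - y)) = (x - z) - e *\<^sub>R A (x - z)"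
        by (simp add: A.diff algebra_simps)
      then show "dist (x - e *\<^sub>R (A x - y)) (z - e *\<^sub>R (A z - y)) \<le> q * dist x z"
        using bound[of "x - z"] by (simp only: dist_norm)
    qed
    then obtain x where "x - e *\<^sub>R (A x - y) = x"
      by blast
    then have "A x = y"
      using e by simp
    then show ?thesis ..
  qed
  then show ?thesis
    by (metis surjI)
qed

text \<open>The representing vector minimises \<open>\<parallel>x\<parallel>\<^sup>2 - 2 f x\<close>.\<close>

lemma Riesz_representation:
  fixes f :: "'a::complex_hilbert_space \<Rightarrow> real"
  assumes "bounded_linear f"
  obtains v where "\<And>x. f x = x \<bullet> v"
proof -
  interpret f: bounded_linear f by fact
  obtain M where M: "M > 0" "\<And>x. norm (f x) \<le> norm x * M"
    using f.pos_bounded by blast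
  define \<phi> where "\<phi> x = (norm x)\<^sup>2 - 2 * f x" for x
  have "\<phi> x \<ge> - M\<^sup>2" for x
  proof -
    have "2 * f x \<le> 2 * (norm x * M)"
      using M(2)[of x] by simp
    moreover have "0 \<le> (norm x - M)\<^sup>2"
      by simp
    ultimately show ?thesis
      by (simp add: \<phi>_def power2_diff)
  qed
  then have bdd: "bdd_below (range \<phi>)"
    by (auto intro!: bdd_belowI)
  define d where "d = (INF x. \<phi> x)"
  have d_le: "d \<le> \<phi> x" for x
    unfolding d_def using bdd by (simp add: cINF_lower)
  have "\<exists>x. \<phi> x < d + 1 / Suc n" for n :: nat
    using cINF_less_iff[OF _ bdd, of "d + 1 / Suc n"] by (auto simp: d_def)
  then obtain X where X: "\<And>n. \<phi> (X n) < d + 1 / Suc n"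
    by metis
  \<comment> \<open>Parallelogram law: \<open>f\<close> cancels against the midpoint, where
    \<open>\<phi>\<close> is at least \<open>d\<close>, so near-minimisers are close to each
    other.\<close>
  have par: "(norm (x - y))\<^sup>2 \<le> 2 * (\<phi> x - d) + 2 * (\<phi> y - d)" for x y
  proof -
    have "2 * \<phi> x + 2 * \<phi> y - 4 * \<phi> ((1 / 2) *\<^sub>R (x + y)) = (norm (x - y))\<^sup>2"
      unfolding \<phi>_def power2_norm_eq_inner f.scaleR f.add
      by (simp add: inner_add_left inner_add_right inner_diff_left inner_diff_right inner_commute algebra_simps)
    then show ?thesis
      using d_le[of "(1 / 2) *\<^sub>R (x + y)"] by argo
  qed
  have "Cauchy X"
  proof (rule metric_CauchyI)
    fix e :: real assume e: "0 < e"
    obtain n :: nat where n: "4 / e\<^sup>2 < n"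
      using reals_Archimedean2 by blast
    have small: "\<phi> (X k) - d < e\<^sup>2 / 4" if "k \<ge> n" for k
    proof -
      have "1 / Suc k < e\<^sup>2 / 4"
        using n e that by (simp add: field_simps) (smt (verit) mult_right_mono of_nat_mono zero_le_power2)
      then show ?thesis
        using X[of k] by linarith
    qed
    have "dist (X k) (X l) < e" if "k \<ge> n" "l \<ge> n" for k l
    proof (rule power2_less_imp_less)
      show "(dist (X k) (X l))\<^sup>2 < e\<^sup>2"
        using par[of "X k" "X l"] small[OF that(1)] small[OF that(2)] by (simp add: dist_norm)
    qed (use e in simp)
    then show "\<exists>M. \<forall>m\<ge>M. \<forall>n\<ge>M. dist (X m) (X n) < e"
      by blast
  qed
  then obtain v where v: "X \<longlonglongrightarrow> v"
    using Cauchy_convergent convergent_def by blast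
  have "(\<lambda>n. \<phi> (X n)) \<longlonglongrightarrow> \<phi> v"
    unfolding \<phi>_def by (intro tendsto_intros v f.tendsto)
  moreover have "(\<lambda>n. d + 1 / Suc n) \<longlonglongrightarrow> d + 0"
    by (intro tendsto_intros LIMSEQ_Suc[OF lim_1_over_n])
  ultimately have "\<phi> v \<le> d"
    using X by (intro LIMSEQ_le[of "\<lambda>n. \<phi> (X n)" _ "\<lambda>n. d + 1 / Suc n"]) (auto intro: less_imp_le)
  then have min: "\<phi> v \<le> \<phi> x" for x
    using d_le order_trans by blast
  have "f x = x \<bullet> v" for x
  proof (cases "x = 0")
    case False
    \<comment> \<open>This \<open>t\<close> minimises \<open>\<phi>\<close> on the line through
      \<open>v\<close> in direction \<open>x\<close>.\<close>
    define t where "t = (f x - x \<bullet> v) / (x \<bullet> x)"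
    have xx: "x \<bullet> x > 0"
      using False by simp
    have "\<phi> (v + t *\<^sub>R x) = \<phi> v + t\<^sup>2 * (x \<bullet> x) - 2 * t * (f x - x \<bullet> v)"
      unfolding \<phi>_def power2_norm_eq_inner
      by (simp add: f.add f.scaleR inner_add_left inner_add_right inner_commute power2_eq_square algebra_simps)
    also have "\<dots> = \<phi> v - (f x - x \<bullet> v)\<^sup>2 / (x \<bullet> x)"
      using xx by (simp add: t_def field_simps power2_eq_square)
    finally have "(f x - x \<bullet> v)\<^sup>2 / (x \<bullet> x) \<le> 0"
      using min[of "v + t *\<^sub>R x"] by linarith
    then show ?thesis
      using xx by (simp add: divide_le_0_iff)
  qed (simp add: f.zero)
  then show ?thesis
    using that by blast
qed

text \<open>Riesz representation is applied to the real inner product; complex linearity of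
  \<open>T\<close> then recovers the imaginary parts through \<open>Im_cinner\<close>.\<close>

lemma
  fixes T :: "'a::complex_hilbert_space \<Rightarrow> 'a"
  assumes T: "bounded_clinear T"
  shows cinner_cadjoint: "cinner (T x) y = cinner x (cadjoint T y)"
    and bounded_clinear_cadjoint: "bounded_clinear (cadjoint T)"
proof -
  have "\<exists>v. \<forall>x. T x \<bullet> y = x \<bullet> v" for y
    using Riesz_representation[OF bounded_linear_compose[OF bounded_linear_inner_left bounded_clinear_linear[OF T]]]
    by metis
  then obtain S where S: "\<And>x y. T x \<bullet> y = x \<bullet> S y"
    by metis
  have cS: "cinner (T x) y = cinner x (S y)" for x y
    by (simp add: complex_eq_iff Re_cinner Im_cinner bounded_clinear_scale[OF T, symmetric] S)
  then have adj: "cadjoint T = S"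
    by (rule cadjoint_eqI)
  then show "cinner (T x) y = cinner x (cadjoint T y)"
    by (simp add: cS)
  have eqI: "a = b" if "\<And>x. x \<bullet> a = x \<bullet> b" for a b :: 'a
    using that vector_eq_ldot by blast
  obtain M where M: "M > 0" "\<And>x. norm (T x) \<le> M * norm x"
    using bounded_clinear_bound[OF T] by blast
  show "bounded_clinear (cadjoint T)"
    unfolding adj
  proof (intro bounded_clinearI bounded_linear_intro[where K = M])
    show "S (x + y) = S x + S y" for x y
      by (rule eqI) (simp add: S[symmetric] inner_add_right)
    show "S (r *\<^sub>R x) = r *\<^sub>R S x" for r x
      by (rule eqI) (simp add: S[symmetric])
    show "S (c *\<^sub>C x) = c *\<^sub>C S x" for c x
      by (rule eqI) (simp add: Re_cinner[symmetric] cinner_scaleC_right cS[symmetric])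
    show "norm (S y) \<le> norm y * M" for y
    proof (cases "S y = 0")
      case False
      have "(norm (S y))\<^sup>2 = T (S y) \<bullet> y"
        by (simp add: S power2_norm_eq_inner)
      also have "\<dots> \<le> (M * norm (S y)) * norm y"
        using norm_cauchy_schwarz[of "T (S y)" y] M(2)[of "S y"]
        by (meson mult_right_mono norm_ge_zero order_trans)
      finally have "norm (S y) * norm (S y) \<le> norm (S y) * (norm y * M)"
        by (simp add: power2_eq_square mult_ac)
      then show ?thesis
        using False by (simp add: mult_le_cancel_left)
    qed (use M in simp)
  qed
qed

lemma inner_cadjoint: "bounded_clinear T \<Longrightarrow> T x \<bullet> y = x \<bullet> cadjoint T y"
  by (metis Re_cinner cinner_cadjoint)

lemma inner_cadjoint_left: "bounded_clinear T \<Longrightarrow> cadjoint T x \<bullet> y = x \<bullet> T y"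
  by (metis inner_cadjoint inner_commute)

lemma cinner_cadjoint_left: "bounded_clinear T \<Longrightarrow> cinner (cadjoint T x) y = cinner x (T y)"
  by (metis cinner_cadjoint cinner_commute)

lemma cadjoint_shift:
  "bounded_clinear T \<Longrightarrow> cadjoint (\<lambda>x. T x - z *\<^sub>C x) = (\<lambda>x. cadjoint T x - cnj z *\<^sub>C x)"
  by (rule cadjoint_eqI)
    (simp add: cinner_cadjoint cinner_diff_left cinner_diff_right cinner_scaleC_left cinner_scaleC_right)

lemma inner_eqI: "(\<And>x. x \<bullet> a = x \<bullet> b) \<Longrightarrow> a = (b :: 'a::real_inner)"
  using vector_eq_ldot by blast

section \<open>Square roots of positive definite operators\<close>

text \<open>
  After scaling, \<open>A = I - E\<close> with \<open>\<parallel>E\<parallel> < 1\<close>, and \<open>I - Y\<close> is a square root of \<open>A\<close> for the fixed point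
  \<open>Y\<close> of the contraction \<open>Y \<mapsto> (E + Y\<^sup>2) / 2\<close>. Symmetry of \<open>Y\<close> and commutation with the commutant of
  \<open>E\<close> hold because they define a closed invariant set.
\<close>

lemma sqrt_fixed_point:
  fixes E :: "'a::banach \<Rightarrow>\<^sub>L 'a"
  assumes q: "norm E \<le> q" "q < 1" "closed S" "E \<in> S"
    and S: "\<And>Y. Y \<in> S \<Longrightarrow> (1 / 2) *\<^sub>R (E + (Y o\<^sub>L Y)) \<in> S"
  obtains Y where "norm Y \<le> q" "Y \<in> S" "(1 / 2) *\<^sub>R (E + (Y o\<^sub>L Y)) = Y"
proof -
  define f where "f Y = (1 / 2) *\<^sub>R (E + (Y o\<^sub>L Y))" for Y
  define D where "D = cball 0 q \<inter> S"
  have q0: "0 \<le> q"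
    using q(1) norm_ge_zero order_trans by blast
  have "\<exists>!Y\<in>D. f Y = Y"
  proof (rule Banach_fix[OF _ _ q0 q(2)])
    show "complete D"
      unfolding D_def complete_eq_closed using q(3) by auto
    show "D \<noteq> {}"
      using q by (auto simp: D_def)
    show "f ` D \<subseteq> D"
    proof
      fix Z assume "Z \<in> f ` D"
      then obtain Y where Y: "Z = f Y" "norm Y \<le> q" "Y \<in> S"
        by (auto simp: D_def)
      have "norm (Y o\<^sub>L Y) \<le> norm Y * norm Y"
        by (rule norm_blinfun_compose)
      also have "\<dots> \<le> q * 1"
        using Y q q0 by (intro mult_mono) auto
      finally have "norm (E + (Y o\<^sub>L Y)) \<le> q + q"
        using q(1) norm_triangle_ineq[of E "Y o\<^sub>L Y"] by linarith
      then show "Z \<in> D"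
        using S[OF Y(3)] by (simp add: D_def Y(1) f_def)
    qed
    show "dist (f X) (f Y) \<le> q * dist X Y" if "X \<in> D" "Y \<in> D" for X Y
    proof -
      \<comment> \<open>This splitting of the difference of squares holds for noncommuting
        \<open>X\<close> and \<open>Y\<close>; each half contributes \<open>q / 2\<close> to the
        Lipschitz constant.\<close>
      have "f X - f Y = (1 / 2) *\<^sub>R ((X o\<^sub>L (X - Y)) + ((X - Y) o\<^sub>L Y))"
        unfolding f_def by (rule blinfun_eqI) (simp add: blinfun.bilinear_simps algebra_simps)
      moreover have "norm (X o\<^sub>L (X - Y)) \<le> q * norm (X - Y)"
        using norm_blinfun_compose[of X "X - Y"] that
        by (auto simp: D_def elim!: order_trans intro!: mult_right_mono)
      moreover have "norm ((X - Y) o\<^sub>L Y) \<le> norm (X - Y) * q"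
        using norm_blinfun_compose[of "X - Y" Y] that
        by (auto simp: D_def elim!: order_trans intro!: mult_left_mono)
      ultimately show ?thesis
        using norm_triangle_ineq[of "X o\<^sub>L (X - Y)" "(X - Y) o\<^sub>L Y"]
        by (simp add: dist_norm mult.commute)
    qed
  qed
  then show ?thesis
    using that by (auto simp: D_def f_def)
qed

lemma blinfun_apply_Blinfun: "bounded_clinear T \<Longrightarrow> blinfun_apply (Blinfun T) = T"
  by (simp add: bounded_linear_Blinfun_apply bounded_clinear_linear)

lemma cinner_symmetric:
  assumes "bounded_clinear A" "\<And>x y. A x \<bullet> y = x \<bullet> A y"
  shows "cinner (A x) y = cinner x (A y)"
  using assms by (simp add: complex_eq_iff Re_cinner Im_cinner bounded_clinear_scale[symmetric])

text \<open>The commutation clause is used three times: with complex scalings for \<open>Z\<close>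
  it makes \<open>B\<close> complex linear, it yields uniqueness of the root, and for normal
  operators it makes the similarity commute with \<open>T\<close>.\<close>

lemma sqrt_exists:
  fixes A :: "'a::complex_hilbert_space \<Rightarrow> 'a"
  assumes A: "bounded_clinear A" and c: "c > 0" and coercive: "\<And>x. c * (norm x)\<^sup>2 \<le> A x \<bullet> x"
    and sym: "\<And>x y. A x \<bullet> y = x \<bullet> A y"
  obtains B d where "bounded_clinear B" "\<And>x. B (B x) = A x" "\<And>x y. B x \<bullet> y = x \<bullet> B y"
    "d > 0" "\<And>x. d * (norm x)\<^sup>2 \<le> B x \<bullet> x"
    "\<And>Z x. bounded_linear Z \<Longrightarrow> (\<And>y. Z (A y) = A (Z y)) \<Longrightarrow> Z (B x) = B (Z x)"
proof -
  obtain e q where e: "e > 0" and q: "0 \<le> q" "q < 1"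
    and bound: "\<And>x. norm (x - e *\<^sub>R A x) \<le> q * norm x"
    using coercive_contraction[OF bounded_clinear_linear[OF A] c coercive] by blast
  define E where "E = Blinfun (\<lambda>x. x - e *\<^sub>R A x)"
  have E: "blinfun_apply E = (\<lambda>x. x - e *\<^sub>R A x)"
    unfolding E_def
    by (intro blinfun_apply_Blinfun bounded_clinear_diff bounded_clinear_id bounded_clinear_scaleR A)
  have "norm E \<le> q"
    using bound q by (intro norm_blinfun_bound) (auto simp: E)
  define S where "S = {Y. \<forall>x y. blinfun_apply Y x \<bullet> y = x \<bullet> blinfun_apply Y y} \<inter>
    {Y. \<forall>Z x. (\<forall>y. blinfun_apply Z (E y) = E (blinfun_apply Z y)) \<longrightarrow>
      blinfun_apply Z (blinfun_apply Y x) = blinfun_apply Y (blinfun_apply Z x)}"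
  have "closed S"
    unfolding S_def
    by (intro closed_Int closed_Collect_all closed_Collect_imp closed_Collect_eq open_Collect_const
        continuous_intros)
  moreover have "E x \<bullet> y = x \<bullet> E y" for x y
    by (simp add: E inner_diff_left inner_diff_right sym)
  then have "E \<in> S"
    unfolding S_def by blast
  moreover have "(1 / 2) *\<^sub>R (E + (Y o\<^sub>L Y)) \<in> S" if "Y \<in> S" for Y
  proof -
    have E': "E x \<bullet> y = x \<bullet> E y" for x y
      using \<open>E \<in> S\<close> by (simp add: S_def)
    have Y': "Y x \<bullet> y = x \<bullet> Y y" for x y
      using that by (simp add: S_def)
    have Z_comm: "blinfun_apply Z (((1 / 2) *\<^sub>R (E + (Y o\<^sub>L Y))) x) = ((1 / 2) *\<^sub>R (E + (Y o\<^sub>L Y))) (blinfun_apply Z x)"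
      if Z: "\<forall>y. blinfun_apply Z (E y) = E (blinfun_apply Z y)" for Z x
    proof -
      have "\<forall>x. blinfun_apply Z (Y x) = Y (blinfun_apply Z x)"
        using \<open>Y \<in> S\<close> Z unfolding S_def by blast
      then show ?thesis
        by (simp add: blinfun.bilinear_simps Z)
    qed
    have "((1 / 2) *\<^sub>R (E + (Y o\<^sub>L Y))) x \<bullet> y = x \<bullet> ((1 / 2) *\<^sub>R (E + (Y o\<^sub>L Y))) y" for x y
      by (simp add: blinfun.bilinear_simps inner_add_left inner_add_right E' Y')
    then show ?thesis
      unfolding S_def using Z_comm by blast
  qed
  ultimately obtain Y where Y: "norm Y \<le> q" "Y \<in> S" "(1 / 2) *\<^sub>R (E + (Y o\<^sub>L Y)) = Y"
    using sqrt_fixed_point[OF \<open>norm E \<le> q\<close> q(2)] by blast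
  have Y_sym: "Y x \<bullet> y = x \<bullet> Y y" for x y
    using Y(2) by (simp add: S_def)
  have Y_comm: "Z (Y x) = Y (Z x)" if "bounded_linear Z" "\<And>y. Z (A y) = A (Z y)" for Z x
  proof -
    have Z: "blinfun_apply (Blinfun Z) = Z"
      using that(1) by (simp add: bounded_linear_Blinfun_apply)
    have "Z (E y) = E (Z y)" for y
      using that by (simp add: E linear_diff linear_scale bounded_linear.linear)
    moreover have "\<forall>Z x. (\<forall>y. blinfun_apply Z (E y) = E (blinfun_apply Z y)) \<longrightarrow>
        blinfun_apply Z (blinfun_apply Y x) = blinfun_apply Y (blinfun_apply Z x)"
      using Y(2) by (simp add: S_def)
    ultimately show ?thesis
      by (metis Z)
  qed
  \<comment> \<open>The square of \<open>I - Y\<close> is \<open>I - E\<close>, which is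
    \<open>e\<close> times \<open>A\<close>; the factor \<open>1 / sqrt e\<close> undoes this
    scaling.\<close>
  define r where "r = 1 / sqrt e"
  have r: "r > 0" "r * r * e = 1"
    using e by (auto simp: r_def)
  define B where "B x = r *\<^sub>R (x - Y x)" for x
  have B_comm: "Z (B x) = B (Z x)" if "bounded_linear Z" "\<And>y. Z (A y) = A (Z y)" for Z x
    using that Y_comm[OF that] by (simp add: B_def linear_diff linear_scale bounded_linear.linear)
  show ?thesis
  proof
    show "bounded_clinear B"
    proof (rule bounded_clinearI)
      show "bounded_linear B"
        unfolding B_def[abs_def]
        by (rule bounded_linear_compose[OF bounded_linear_scaleR_right
              bounded_linear_sub[OF bounded_linear_ident blinfun.bounded_linear_right]])
      show "B (a *\<^sub>C x) = a *\<^sub>C B x" for a x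
        by (rule B_comm[symmetric]) (simp_all add: bounded_linear_scaleC bounded_clinear_simps[OF A])
    qed
    show "B (B x) = A x" for x
    proof -
      have "E x + Y (Y x) = 2 *\<^sub>R Y x"
        using arg_cong[OF Y(3), of "\<lambda>Y. 2 *\<^sub>R blinfun_apply Y x"] by (simp add: blinfun.bilinear_simps)
      then have "x - 2 *\<^sub>R Y x + Y (Y x) = e *\<^sub>R A x"
        by (simp add: E algebra_simps)
      moreover have "B (B x) = (r * r) *\<^sub>R (x - 2 *\<^sub>R Y x + Y (Y x))"
        by (simp add: B_def blinfun.bilinear_simps scaleR_2 algebra_simps)
      ultimately show ?thesis
        using r by simp
    qed
    show "B x \<bullet> y = x \<bullet> B y" for x y
      by (simp add: B_def inner_diff_left inner_diff_right Y_sym)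
    show "r * (1 - q) > 0"
      using r q by simp
    show "r * (1 - q) * (norm x)\<^sup>2 \<le> B x \<bullet> x" for x
    proof -
      have "Y x \<bullet> x \<le> norm (Y x) * norm x"
        by (rule norm_cauchy_schwarz)
      also have "\<dots> \<le> (q * norm x) * norm x"
        by (intro mult_right_mono order_trans[OF norm_blinfun] Y(1)) auto
      finally have "(1 - q) * (norm x)\<^sup>2 \<le> (x - Y x) \<bullet> x"
        by (simp add: inner_diff_left power2_norm_eq_inner[symmetric] algebra_simps power2_eq_square)
      then show ?thesis
        using r by (simp add: B_def)
    qed
  qed (fact B_comm)
qed

text \<open>It is instantiated with \<open>x + cadjoint T (T x)\<close> for \<open>bk_op\<close> and
  with the weighted orbit energy for the similarity.\<close>

locale positive_definite =
  fixes A :: "'a::complex_hilbert_space \<Rightarrow> 'a" and c :: real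
  assumes A: "bounded_clinear A" and c_pos: "c > 0" and coercive: "c * (norm x)\<^sup>2 \<le> A x \<bullet> x"
    and sym: "A x \<bullet> y = x \<bullet> A y"
begin

lemma sqrt_op_properties:
  "bounded_clinear (sqrt_op A)" "sqrt_op A (sqrt_op A x) = A x" "sqrt_op A x \<bullet> y = x \<bullet> sqrt_op A y"
  "\<exists>d>0. \<forall>x. d * (norm x)\<^sup>2 \<le> sqrt_op A x \<bullet> x"
  "bounded_linear Z \<Longrightarrow> (\<And>y. Z (A y) = A (Z y)) \<Longrightarrow> Z (sqrt_op A x) = sqrt_op A (Z x)"
proof -
  obtain B d where B: "bounded_clinear B" "\<And>x. B (B x) = A x" "\<And>x y. B x \<bullet> y = x \<bullet> B y"
    "d > 0" "\<And>x. d * (norm x)\<^sup>2 \<le> B x \<bullet> x"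
    "\<And>Z x. bounded_linear Z \<Longrightarrow> (\<And>y. Z (A y) = A (Z y)) \<Longrightarrow> Z (B x) = B (Z x)"
    using sqrt_exists[OF A c_pos coercive sym] by blast
  have "sqrt_op A = B"
    unfolding sqrt_op_def
  proof (rule the_equality)
    have "cinner (B x) x \<in> \<real>\<^sub>\<ge>\<^sub>0" for x
    proof -
      have "cinner (B x) x = cnj (cinner (B x) x)"
        using cinner_symmetric[OF B(1,3), of x x] cinner_commute[of x "B x"] by simp
      then have "Im (cinner (B x) x) = 0"
        by (simp add: complex_eq_iff)
      moreover have "0 \<le> B x \<bullet> x"
        using B(4) B(5)[of x] by (meson mult_nonneg_nonneg less_imp_le order_trans zero_le_power2)
      ultimately show ?thesis
        by (simp add: complex_nonneg_Reals_iff Re_cinner)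
    qed
    then show "positive_op B \<and> B \<circ> B = A"
      using B by (auto simp: positive_op_def)
    fix C assume "positive_op C \<and> C \<circ> C = A"
    then have C: "bounded_clinear C" "\<And>x. 0 \<le> C x \<bullet> x" "\<And>x. C (C x) = A x"
      by (auto simp: positive_op_def complex_nonneg_Reals_iff Re_cinner[symmetric])
    have comm: "C (B x) = B (C x)" for x
      using C(1) by (intro B(6)) (auto simp: bounded_clinear_linear C(3)[symmetric])
    show "C = B"
    proof
      fix x
      \<comment> \<open>As \<open>B\<close> and \<open>C\<close> commute, \<open>B + C\<close> maps
        \<open>y\<close> to the difference of their squares, which is \<open>0\<close>. Coercivity
        of \<open>B\<close> and positivity of \<open>C\<close> then force
        \<open>y = 0\<close>.\<close>
      define y where "y = B x - C x"
      have "B y + C y = 0"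
        unfolding y_def by (simp add: bounded_clinear_simps[OF B(1)] bounded_clinear_simps[OF C(1)] comm B(2) C(3))
      then have "B y \<bullet> y + C y \<bullet> y = 0"
        by (metis inner_add_left inner_zero_left)
      then have "d * (norm y)\<^sup>2 \<le> 0"
        using B(5)[of y] C(2)[of y] by linarith
      then have "y = 0"
        using B(4) by (simp add: mult_le_0_iff)
      then show "C x = B x"
        by (simp add: y_def)
    qed
  qed
  then show "bounded_clinear (sqrt_op A)" "sqrt_op A (sqrt_op A x) = A x" "sqrt_op A x \<bullet> y = x \<bullet> sqrt_op A y"
    "\<exists>d>0. \<forall>x. d * (norm x)\<^sup>2 \<le> sqrt_op A x \<bullet> x"
    "bounded_linear Z \<Longrightarrow> (\<And>y. Z (A y) = A (Z y)) \<Longrightarrow> Z (sqrt_op A x) = sqrt_op A (Z x)"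
    using B by auto
qed

lemma norm_sqrt_op: "(norm (sqrt_op A x))\<^sup>2 = A x \<bullet> x"
  unfolding power2_norm_eq_inner by (metis sqrt_op_properties(2,3) inner_commute)

lemma inv_sqrt_op:
  "bij (sqrt_op A)" "bounded_clinear (inv (sqrt_op A))"
  "inv (sqrt_op A) x \<bullet> y = x \<bullet> inv (sqrt_op A) y"
proof -
  obtain d where d: "d > 0" "\<And>x. d * (norm x)\<^sup>2 \<le> sqrt_op A x \<bullet> x"
    using sqrt_op_properties(4) by blast
  have "d * norm x \<le> norm (sqrt_op A x)" for x
  proof (cases "x = 0")
    case False
    have "(d * norm x) * norm x \<le> norm (sqrt_op A x) * norm x"
      using d(2)[of x] norm_cauchy_schwarz[of "sqrt_op A x" x] by (simp add: power2_eq_square mult.assoc)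
    then show ?thesis
      using False by simp
  qed simp
  moreover have "surj (sqrt_op A)"
    using coercive_surj[OF bounded_clinear_linear d] sqrt_op_properties(1) by blast
  ultimately show "bij (sqrt_op A)" "bounded_clinear (inv (sqrt_op A))"
    using bounded_below_inverse[OF sqrt_op_properties(1) d(1)] by auto
  then show "inv (sqrt_op A) x \<bullet> y = x \<bullet> inv (sqrt_op A) y"
    by (metis bij_inv_eq_iff sqrt_op_properties(3))
qed

end

section \<open>The scaled relative graph as a numerical range\<close>

text \<open>The two signs make the set symmetric about the real axis, and up to that symmetry a
  point is determined by its modulus and real part. This disposes of \<open>arccos\<close>.\<close>

lemma SRG_iff_unit: "z \<in> SRG T \<longleftrightarrow> (\<exists>x. norm x = 1 \<and> cmod z = norm (T x) \<and> Re z = T x \<bullet> x)"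
proof -
  define e where "e s r c = complex_of_real r * exp (s * \<i> * complex_of_real (arccos (c / r)))" for s r c
  have e: "e s r c = Complex c (Re s * sqrt (r\<^sup>2 - c\<^sup>2))"
    if s: "s \<in> {1, -1}" and c: "\<bar>c\<bar> \<le> r" for s r c
  \<comment> \<open>For \<open>r = 0\<close> also \<open>c = 0\<close>, and both sides vanish
    whatever \<open>arccos\<close> gives at \<open>0 / 0\<close>.\<close>
  proof (cases "r = 0")
    case False
    then have r: "r > 0"
      using c by linarith
    have "\<bar>c / r\<bar> \<le> 1"
      using c r by simp
    then have "r * cos (arccos (c / r)) = c" "r * sin (arccos (c / r)) = r * sqrt (1 - (c / r)\<^sup>2)"
      using r by (simp_all add: cos_arccos_abs sin_arccos_abs)
    moreover have "r * sqrt (1 - (c / r)\<^sup>2) = sqrt (r\<^sup>2 - c\<^sup>2)"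
    proof -
      have "sqrt (r\<^sup>2 - c\<^sup>2) = sqrt (r\<^sup>2 * (1 - (c / r)\<^sup>2))"
        using r by (simp add: field_simps)
      then show ?thesis
        using r by (simp add: real_sqrt_mult)
    qed
    ultimately show ?thesis
      using s by (auto simp: e_def exp_Euler complex_eq_iff Re_exp Im_exp)
  qed (use c in \<open>simp add: e_def complex_eq_iff\<close>)
  have SRG: "SRG T = {e s (norm (T x)) (T x \<bullet> x) | s x. s \<in> {1, -1} \<and> norm x = 1}"
    unfolding SRG_def e_def Re_cinner by (rule Collect_cong) (metis div_by_1 mult.right_neutral)
  show ?thesis
  proof
    assume "z \<in> SRG T"
    then obtain s x where sx: "z = e s (norm (T x)) (T x \<bullet> x)" "s \<in> {1, -1}" "norm x = 1"
      by (auto simp: SRG)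
    have le: "\<bar>T x \<bullet> x\<bar> \<le> norm (T x)"
      using Cauchy_Schwarz_ineq2[of "T x" x] sx(3) by simp
    then have "(T x \<bullet> x)\<^sup>2 \<le> (norm (T x))\<^sup>2"
      using abs_le_square_iff[of "T x \<bullet> x" "norm (T x)"] by simp
    then have "cmod z = norm (T x)"
      using sx(2) unfolding sx(1) e[OF sx(2) le] cmod_def by auto
    then show "\<exists>x. norm x = 1 \<and> cmod z = norm (T x) \<and> Re z = T x \<bullet> x"
      using sx(3) by (intro exI[of _ x]) (simp add: sx(1) e[OF sx(2) le])
  next
    assume "\<exists>x. norm x = 1 \<and> cmod z = norm (T x) \<and> Re z = T x \<bullet> x"
    then obtain x where x: "norm x = 1" "cmod z = norm (T x)" "Re z = T x \<bullet> x"
      by blast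
    have le: "\<bar>T x \<bullet> x\<bar> \<le> norm (T x)"
      using Cauchy_Schwarz_ineq2[of "T x" x] x(1) by simp
    define s :: complex where "s = (if Im z \<ge> 0 then 1 else -1)"
    have s: "s \<in> {1, -1}"
      by (simp add: s_def)
    have "(norm (T x))\<^sup>2 - (T x \<bullet> x)\<^sup>2 = (Im z)\<^sup>2"
      unfolding x(2,3)[symmetric] cmod_power2 by simp
    then have "z = e s (norm (T x)) (T x \<bullet> x)"
      unfolding e[OF s le] by (auto simp: complex_eq_iff x(3) s_def)
    then show "z \<in> SRG T"
      using x(1) s by (auto simp: SRG)
  qed
qed

lemma SRG_iff:
  assumes T: "bounded_clinear T"
  shows "z \<in> SRG T \<longleftrightarrow> (\<exists>x. x \<noteq> 0 \<and> cmod z * norm x = norm (T x) \<and> Re z * (norm x)\<^sup>2 = T x \<bullet> x)"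
proof
  assume "z \<in> SRG T"
  then obtain x where "norm x = 1" "cmod z = norm (T x)" "Re z = T x \<bullet> x"
    by (auto simp: SRG_iff_unit)
  then show "\<exists>x. x \<noteq> 0 \<and> cmod z * norm x = norm (T x) \<and> Re z * (norm x)\<^sup>2 = T x \<bullet> x"
    by (intro exI[of _ x]) auto
next
  assume "\<exists>x. x \<noteq> 0 \<and> cmod z * norm x = norm (T x) \<and> Re z * (norm x)\<^sup>2 = T x \<bullet> x"
  then obtain x where x: "x \<noteq> 0" "cmod z * norm x = norm (T x)" "Re z * (norm x)\<^sup>2 = T x \<bullet> x"
    by blast
  then show "z \<in> SRG T"
    unfolding SRG_iff_unit
    by (intro exI[of _ "(1 / norm x) *\<^sub>R x"])
      (auto simp: bounded_clinear_simps[OF T] field_simps power2_eq_square)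
qed

lemma SRG_exists:
  assumes T: "bounded_clinear T" and "x \<noteq> 0"
  obtains z where "z \<in> SRG T" "cmod z * norm x = norm (T x)" "Re z * (norm x)\<^sup>2 = T x \<bullet> x" "Im z \<ge> 0"
proof -
  define r where "r = norm (T x) / norm x"
  define c where "c = T x \<bullet> x / (norm x)\<^sup>2"
  have "\<bar>c\<bar> \<le> r"
    using Cauchy_Schwarz_ineq2[of "T x" x] \<open>x \<noteq> 0\<close> by (simp add: c_def r_def field_simps power2_eq_square)
  then have "c\<^sup>2 \<le> r\<^sup>2"
    using abs_le_square_iff[of c r] by (simp add: r_def)
  then have "cmod (Complex c (sqrt (r\<^sup>2 - c\<^sup>2))) = r"
    by (simp add: cmod_def r_def)
  then have *: "cmod (Complex c (sqrt (r\<^sup>2 - c\<^sup>2))) * norm x = norm (T x)"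
    "Re (Complex c (sqrt (r\<^sup>2 - c\<^sup>2))) * (norm x)\<^sup>2 = T x \<bullet> x"
    using \<open>x \<noteq> 0\<close> by (simp_all add: r_def c_def)
  show ?thesis
    using \<open>x \<noteq> 0\<close> * \<open>c\<^sup>2 \<le> r\<^sup>2\<close>
    by (intro that[of "Complex c (sqrt (r\<^sup>2 - c\<^sup>2))"]) (auto simp: SRG_iff[OF T])
qed

lemma cnj_SRG: "z \<in> SRG T \<Longrightarrow> cnj z \<in> SRG T"
  by (simp add: SRG_iff_unit)

lemma positive_definite_graph:
  assumes T: "bounded_clinear T"
  shows "positive_definite (\<lambda>x. x + cadjoint T (T x)) 1"
proof
  show "bounded_clinear (\<lambda>x. x + cadjoint T (T x))"
    by (rule bounded_clinear_add[OF bounded_clinear_id bounded_clinear_comp[OF bounded_clinear_cadjoint[OF T] T]])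
qed (simp_all add: inner_add_left inner_add_right inner_cadjoint_left[OF T] inner_cadjoint[OF T, symmetric]
      power2_norm_eq_inner)

lemma bounded_clinear_bk_op:
  assumes T: "bounded_clinear T"
  shows "bounded_clinear (bk_op T)"
proof -
  have R: "bounded_clinear (inv (sqrt_op (\<lambda>x. x + cadjoint T (T x))))"
    by (rule positive_definite.inv_sqrt_op(2)[OF positive_definite_graph[OF T]])
  show ?thesis
    unfolding bk_op_def Let_def comp_def
    by (rule bounded_clinear_comp[OF R bounded_clinear_comp[OF bounded_clinear_shift[OF bounded_clinear_cadjoint[OF T]]
            bounded_clinear_comp[OF bounded_clinear_shift[OF T] R]]])
qed

lemma numerical_range_bk_op:
  assumes T: "bounded_clinear T"
  shows "numerical_range (bk_op T) =
    {Complex ((norm (T x))\<^sup>2 - (norm x)\<^sup>2) (- 2 * (T x \<bullet> x)) | x. (norm x)\<^sup>2 + (norm (T x))\<^sup>2 = 1}"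
proof -
  interpret positive_definite "\<lambda>x. x + cadjoint T (T x)" 1
    by (rule positive_definite_graph[OF T])
  define B where "B = sqrt_op (\<lambda>x. x + cadjoint T (T x))"
  have bij: "bij B" and R: "bounded_clinear (inv B)" "\<And>x y. inv B x \<bullet> y = x \<bullet> inv B y"
    unfolding B_def by (rule inv_sqrt_op)+
  have norm_B: "(norm (B x))\<^sup>2 = (norm x)\<^sup>2 + (norm (T x))\<^sup>2" for x
    unfolding B_def norm_sqrt_op by (simp add: inner_add_left inner_cadjoint_left[OF T] power2_norm_eq_inner)
  have "cinner (bk_op T (B x)) (B x) = Complex ((norm (T x))\<^sup>2 - (norm x)\<^sup>2) (- 2 * (T x \<bullet> x))" for x
  proof -
    have "cinner (bk_op T (B x)) (B x) = cinner (cadjoint T (T x - \<i> *\<^sub>C x) - \<i> *\<^sub>C (T x - \<i> *\<^sub>C x)) x"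
      using bij unfolding bk_op_def Let_def B_def[symmetric]
      by (simp add: cinner_symmetric[OF R] bij_is_inj inv_f_f)
    also have "\<dots> = cinner (T x) (T x) - cinner x x - \<i> * (cinner (T x) x + cnj (cinner (T x) x))"
      using cinner_commute[of x "T x"]
      by (simp add: cinner_diff_left cinner_diff_right cinner_scaleC_left cinner_scaleC_right
          cinner_cadjoint_left[OF T] algebra_simps)
    also have "\<dots> = Complex ((norm (T x))\<^sup>2 - (norm x)\<^sup>2) (- 2 * (T x \<bullet> x))"
      unfolding cinner_self complex_add_cnj Re_cinner by (simp add: complex_eq_iff)
    finally show ?thesis .
  qed
  moreover have "norm (B x) = 1 \<longleftrightarrow> (norm x)\<^sup>2 + (norm (T x))\<^sup>2 = 1" for x
    unfolding norm_B[symmetric] by (simp add: power2_eq_1_iff) (smt (verit) norm_ge_zero)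
  moreover have "numerical_range (bk_op T) = {cinner (bk_op T (B x)) (B x) | x. norm (B x) = 1}"
    unfolding numerical_range_def using bij by (metis (mono_tags, opaque_lifting) bij_pointE)
  ultimately show ?thesis
    by simp
qed

lemma numerical_range_bk_op_eq:
  assumes T: "bounded_clinear T"
  shows "numerical_range (bk_op T) = bk ` SRG T"
proof -
  have bk: "bk z = Complex ((norm (T x))\<^sup>2 - (norm x)\<^sup>2) (- 2 * (T x \<bullet> x))"
    if "cmod z * norm x = norm (T x)" "Re z * (norm x)\<^sup>2 = T x \<bullet> x" "(norm x)\<^sup>2 + (norm (T x))\<^sup>2 = 1" for z x
  proof -
    have T2: "(norm (T x))\<^sup>2 = (cmod z)\<^sup>2 * (norm x)\<^sup>2"
      by (simp add: that(1)[symmetric] power_mult_distrib)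
    have pos: "1 + (cmod z)\<^sup>2 > 0"
      by (simp add: add_pos_nonneg)
    have "(norm x)\<^sup>2 * (1 + (cmod z)\<^sup>2) = 1"
      using that(3) unfolding T2 by (simp add: algebra_simps)
    then have x2: "(norm x)\<^sup>2 = 1 / (1 + (cmod z)\<^sup>2)"
      using pos by (simp add: field_simps)
    show ?thesis
      unfolding bk_eq T2 that(2)[symmetric] x2 by (simp add: diff_divide_distrib)
  qed
  show ?thesis
    unfolding numerical_range_bk_op[OF T]
  proof (intro equalityI subsetI)
    fix w assume "w \<in> {Complex ((norm (T x))\<^sup>2 - (norm x)\<^sup>2) (- 2 * (T x \<bullet> x)) | x. (norm x)\<^sup>2 + (norm (T x))\<^sup>2 = 1}"
    then obtain x where x: "(norm x)\<^sup>2 + (norm (T x))\<^sup>2 = 1"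
      and w: "w = Complex ((norm (T x))\<^sup>2 - (norm x)\<^sup>2) (- 2 * (T x \<bullet> x))"
      by blast
    have "x \<noteq> 0"
      using x by (auto simp: bounded_clinear_simps[OF T])
    then obtain z where "z \<in> SRG T" "cmod z * norm x = norm (T x)" "Re z * (norm x)\<^sup>2 = T x \<bullet> x"
      using SRG_exists[OF T] by blast
    then show "w \<in> bk ` SRG T"
      using bk[of z x] x w by (metis imageI)
  next
    fix w assume "w \<in> bk ` SRG T"
    then obtain z x where z: "w = bk z" "x \<noteq> 0" "cmod z * norm x = norm (T x)" "Re z * (norm x)\<^sup>2 = T x \<bullet> x"
      by (auto simp: SRG_iff[OF T])
    define D where "D = (norm x)\<^sup>2 + (norm (T x))\<^sup>2"
    define k where "k = 1 / sqrt D"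
    have D: "D > 0"
      using z(2) by (simp add: D_def add_pos_nonneg)
    then have "k > 0" and k2: "k\<^sup>2 = 1 / D"
      by (simp_all add: k_def power_divide)
    have "cmod z * norm (k *\<^sub>R x) = norm (T (k *\<^sub>R x))"
      using z(3) by (simp add: bounded_clinear_simps[OF T] mult.left_commute)
    moreover have "Re z * (norm (k *\<^sub>R x))\<^sup>2 = T (k *\<^sub>R x) \<bullet> (k *\<^sub>R x)"
      by (simp add: bounded_clinear_simps[OF T] z(4)[symmetric] power_mult_distrib power2_eq_square)
    moreover have "(norm (k *\<^sub>R x))\<^sup>2 + (norm (T (k *\<^sub>R x)))\<^sup>2 = k\<^sup>2 * D"
      by (simp add: D_def bounded_clinear_simps[OF T] power_mult_distrib algebra_simps)
    then have "(norm (k *\<^sub>R x))\<^sup>2 + (norm (T (k *\<^sub>R x)))\<^sup>2 = 1"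
      using D unfolding k2 by simp
    ultimately show "w \<in> {Complex ((norm (T x))\<^sup>2 - (norm x)\<^sup>2) (- 2 * (T x \<bullet> x)) | x. (norm x)\<^sup>2 + (norm (T x))\<^sup>2 = 1}"
      using bk[of z "k *\<^sub>R x"] z(1) by (intro CollectI exI[of _ "k *\<^sub>R x"]) (simp add: z(2))
  qed
qed

text \<open>
  To realise a value between \<open>\<langle>Fx,x\<rangle>\<close> and \<open>\<langle>Fy,y\<rangle>\<close>, subtract it from \<open>F\<close> and rotate so that \<open>x\<close> and \<open>y\<close>
  give a positive and a negative real; a unimodular \<open>u\<close> then keeps the form real on the line \<open>x + t u y\<close>,
  where it has a zero.
\<close>

theorem Toeplitz_Hausdorff:
  assumes F: "bounded_clinear F"
  shows "convex (numerical_range F)"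
proof -
  define Q where "Q G x = cinner (G x) x" for G and x :: 'a
  have unit: "p \<in> numerical_range F" if "z \<noteq> 0" "Q F z = p * cinner z z" for p z
  proof -
    define k where "k = 1 / norm z"
    have "cinner (F (k *\<^sub>R z)) (k *\<^sub>R z) = complex_of_real (k\<^sup>2) * Q F z"
      unfolding scaleC_of_real[symmetric] bounded_clinear_simps[OF F] cinner_scaleC_left cinner_scaleC_right Q_def
      by (simp add: power2_eq_square)
    also have "\<dots> = p"
      using that unfolding that(2) cinner_self by (simp add: k_def power_divide)
    finally show ?thesis
      using that(1) by (auto simp: numerical_range_def k_def intro!: exI[of _ "k *\<^sub>R z"])
  qed
  have zero: "\<exists>z. z \<noteq> 0 \<and> Q G z = 0"
    if G: "bounded_clinear G" and x: "Q G x = complex_of_real a" "a > 0" and y: "Q G y = complex_of_real b" "b < 0" for G x y a b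
  proof -
    define D where "D = cinner (G y) x - cnj (cinner (G x) y)"
    \<comment> \<open>The imaginary part of the mixed terms in \<open>cross\<close> equals
      \<open>Im (u * D)\<close>, which this unimodular \<open>u\<close> makes zero.\<close>
    define u where "u = (if D = 0 then 1 else cnj D / cmod D)"
    have u: "cmod u = 1" "Im (u * D) = 0"
      by (auto simp: u_def norm_divide complex_norm_square[symmetric] mult.commute)
    define s where "s = Re (u * cinner (G y) x + cnj u * cinner (G x) y)"
    have cross: "u * cinner (G y) x + cnj u * cinner (G x) y = complex_of_real s"
      using u(2) by (simp add: s_def D_def complex_eq_iff algebra_simps)
    have uu: "u * cnj u = 1"
      using u(1) by (simp add: complex_norm_square[symmetric])
    have QG: "Q G (x + t *\<^sub>R (u *\<^sub>C y)) = complex_of_real (a + t * s + t\<^sup>2 * b)" for t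
    proof -
      have "Q G (x + t *\<^sub>R (u *\<^sub>C y)) = Q G x + t * (u * cinner (G y) x + cnj u * cinner (G x) y) + t\<^sup>2 * (u * cnj u) * Q G y"
        unfolding Q_def scaleC_of_real[symmetric] bounded_clinear_simps[OF G]
        by (simp add: cinner_add_left cinner_add_right cinner_scaleC_left cinner_scaleC_right power2_eq_square algebra_simps)
      then show ?thesis
        unfolding cross uu x y by simp
    qed
    \<comment> \<open>A root of \<open>a + t * s + t\<^sup>2 * b\<close>; the discriminant is
      nonnegative because \<open>a\<close> and \<open>b\<close> have opposite signs.\<close>
    define t where "t = (- s - sqrt (s\<^sup>2 - 4 * b * a)) / (2 * b)"
    have disc: "s\<^sup>2 - 4 * b * a \<ge> 0"
      using x(2) y(2) by (smt (verit) mult_neg_pos zero_le_power2)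
    have "2 * b * t + s = - sqrt (s\<^sup>2 - 4 * b * a)"
      using y(2) by (simp add: t_def)
    then have "(2 * b * t + s)\<^sup>2 = s\<^sup>2 - 4 * b * a"
      using disc by simp
    then have "4 * b * (a + t * s + t\<^sup>2 * b) = 0"
      by (simp add: power2_eq_square algebra_simps)
    then have "a + t * s + t\<^sup>2 * b = 0"
      using y(2) by simp
    moreover have "x + t *\<^sub>R (u *\<^sub>C y) \<noteq> 0"
    proof
      assume "x + t *\<^sub>R (u *\<^sub>C y) = 0"
      then have "x = (- complex_of_real t * u) *\<^sub>C y"
        by (simp add: scaleC_of_real[symmetric] scaleC_scaleC scaleC_minus_left eq_neg_iff_add_eq_0)
      then have "Q G x = t\<^sup>2 * (u * cnj u) * Q G y"
        unfolding Q_def by (simp add: bounded_clinear_simps[OF G] cinner_scaleC_left cinner_scaleC_right power2_eq_square)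
      then have "complex_of_real a = complex_of_real (t\<^sup>2 * b)"
        unfolding x y uu by simp
      then have "a = t\<^sup>2 * b"
        by (simp only: of_real_eq_iff)
      then show False
        using x(2) y(2) by (smt (verit) mult_nonneg_nonpos zero_le_power2)
    qed
    ultimately show ?thesis
      using QG[of t] by auto
  qed
  show ?thesis
    unfolding convex_contains_segment
  proof (intro ballI subsetI)
    fix a b p assume a: "a \<in> numerical_range F" and b: "b \<in> numerical_range F" and p: "p \<in> closed_segment a b"
    show "p \<in> numerical_range F"
    proof (cases "p = a \<or> p = b")
      case False
      then obtain t where t: "0 < t" "t < 1" and p: "p = (1 - t) *\<^sub>R a + t *\<^sub>R b"
        using p by (auto simp: in_segment) (metis add.left_neutral add.right_neutral diff_zero diff_self scaleR_one scaleR_zero_left less_eq_real_def)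
      have "a \<noteq> b"
        using False p by (auto simp: algebra_simps)
      obtain x y where x: "norm x = 1" "a = cinner (F x) x" and y: "norm y = 1" "b = cinner (F y) y"
        using a b by (auto simp: numerical_range_def)
      define G where "G = (\<lambda>z. cnj (a - b) *\<^sub>C (F z - p *\<^sub>C z))"
      have QG: "Q G z = cnj (a - b) * (Q F z - p * cinner z z)" for z
        by (simp add: G_def Q_def cinner_scaleC_left cinner_diff_left)
      have ap: "a - p = t * (a - b)" and bp: "b - p = - (1 - t) * (a - b)"
        by (simp_all add: p scaleR_conv_of_real algebra_simps)
      have "Q G x = cnj (a - b) * (a - p)" "Q G y = cnj (a - b) * (b - p)"
        unfolding QG by (simp_all add: Q_def x(1) y(1) x(2)[symmetric] y(2)[symmetric] cinner_self)
      then have "Q G x = complex_of_real (t * (cmod (a - b))\<^sup>2)" "Q G y = complex_of_real (- (1 - t) * (cmod (a - b))\<^sup>2)"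
        unfolding ap bp of_real_mult complex_norm_square by (simp_all add: mult_ac)
      moreover have "bounded_clinear G"
        unfolding G_def by (intro bounded_clinear_scaleC bounded_clinear_shift F)
      ultimately obtain z where "z \<noteq> 0" "Q G z = 0"
        using zero[of G x "t * (cmod (a - b))\<^sup>2" y "- (1 - t) * (cmod (a - b))\<^sup>2"] t \<open>a \<noteq> b\<close>
        by (auto simp: mult_less_0_iff)
      then show ?thesis
        using unit[of z p] \<open>a \<noteq> b\<close> by (simp add: QG)
    qed (use a b in auto)
  qed
qed

section \<open>Convexity of the graph in the Beltrami-Klein sense\<close>

lemma convex_bk_SRG: "bounded_clinear T \<Longrightarrow> convex (bk ` SRG T)"
  by (metis Toeplitz_Hausdorff bounded_clinear_bk_op numerical_range_bk_op_eq)

lemma bk_inv_image_bk: "bk_inv_image (bk ` K) = K \<union> cnj ` K"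
  by (auto simp: bk_inv_image_def bk_inv_bk)

lemma continuous_on_bk: "continuous_on K bk"
proof -
  have "1 + cnj z * z \<noteq> 0" for z
  proof -
    have "Re (1 + cnj z * z) = 1 + (cmod z)\<^sup>2"
      by (simp add: cmod_power2) (simp add: power2_eq_square)
    then show ?thesis
      by (metis add_pos_nonneg less_irrefl zero_complex.sel(1) zero_le_power2 zero_less_one)
  qed
  then show ?thesis
    unfolding bk_def[abs_def] by (intro continuous_intros) auto
qed

lemma compact_closure_SRG:
  assumes T: "bounded_clinear T"
  shows "compact (closure (SRG T))"
proof -
  obtain M where "M > 0" "\<And>x. norm (T x) \<le> M * norm x"
    using bounded_clinear_bound[OF T] by blast
  then have "bounded (SRG T)"
    by (intro boundedI[of _ M]) (metis SRG_iff_unit mult.right_neutral)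
  then show ?thesis
    by simp
qed

text \<open>The continuous image of the compact closure is closed, so \<open>bk\<close> commutes
  with closure here. This carries convexity over to the closed graph.\<close>

lemma bk_closure_SRG:
  assumes T: "bounded_clinear T"
  shows "bk ` closure (SRG T) = closure (bk ` SRG T)"
proof (rule antisym)
  show "bk ` closure (SRG T) \<subseteq> closure (bk ` SRG T)"
    by (rule image_closure_subset[OF continuous_on_bk]) (auto simp: closure_subset)
  have "closed (bk ` closure (SRG T))"
    by (intro compact_imp_closed compact_continuous_image continuous_on_bk compact_closure_SRG T)
  then show "closure (bk ` SRG T) \<subseteq> bk ` closure (SRG T)"
    by (intro closure_minimal image_mono closure_subset)
qed

lemma cnj_closure_SRG: "cnj ` closure (SRG T) \<subseteq> closure (SRG T)"
  by (rule image_closure_subset[OF continuous_on_cnj[OF continuous_on_id]])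
    (use closure_subset cnj_SRG in blast)+

lemma hull_bk_SRG:
  assumes "bounded_clinear T"
  shows "convex hull (bk ` SRG T) = bk ` SRG T" "convex hull (bk ` closure (SRG T)) = bk ` closure (SRG T)"
  using assms by (auto simp: hull_same bk_closure_SRG convex_bk_SRG)

text \<open>Both images under \<open>bk\<close> are already convex, and \<open>bk\<close> forgets
  exactly complex conjugation, under which both sets are invariant.\<close>

lemma co_BK_SRG:
  assumes "bounded_clinear T"
  shows "co_BK (SRG T) = SRG T" "co_BK (closure (SRG T)) = closure (SRG T)"
  using cnj_closure_SRG[of T] unfolding co_BK_def hull_bk_SRG[OF assms] bk_inv_image_bk
  by (auto simp: cnj_SRG)

lemma co_BK_mono: "K \<subseteq> L \<Longrightarrow> co_BK K \<subseteq> co_BK L"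
  unfolding co_BK_def bk_inv_image_def by (meson UN_mono hull_mono image_mono order_refl)

lemma in_co_BK: "bk z \<in> convex hull (bk ` K) \<Longrightarrow> z \<in> co_BK K"
  unfolding co_BK_def bk_inv_image_def using bk_inv_bk[of z] by auto

section \<open>Spectra\<close>

lemma not_bounded_below_iff:
  assumes A: "bounded_clinear A"
  shows "\<not> bounded_below A \<longleftrightarrow> (\<forall>c>0. \<exists>x. norm x = 1 \<and> norm (A x) < c)"
proof
  assume *: "\<not> bounded_below A"
  show "\<forall>c>0. \<exists>x. norm x = 1 \<and> norm (A x) < c"
  proof (intro allI impI)
    fix c :: real assume "c > 0"
    then obtain x where x: "norm (A x) < c * norm x"
      using * by (auto simp: bounded_below_def not_le)
    then have "x \<noteq> 0"
      by (auto simp: bounded_clinear_simps[OF A])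
    then show "\<exists>x. norm x = 1 \<and> norm (A x) < c"
      using x by (intro exI[of _ "(1 / norm x) *\<^sub>R x"]) (simp add: bounded_clinear_simps[OF A] field_simps)
  qed
next
  assume "\<forall>c>0. \<exists>x. norm x = 1 \<and> norm (A x) < c"
  then show "\<not> bounded_below A"
    unfolding bounded_below_def by (metis mult.right_neutral not_le)
qed

lemma not_in_spectrum_iff:
  assumes T: "bounded_clinear T"
  shows "z \<notin> spectrum T \<longleftrightarrow> bounded_below (\<lambda>x. T x - z *\<^sub>C x) \<and> surj (\<lambda>x. T x - z *\<^sub>C x)"
proof
  let ?A = "\<lambda>x. T x - z *\<^sub>C x"
  assume "z \<notin> spectrum T"
  then obtain R where R: "bounded_clinear R" "R \<circ> ?A = id" "?A \<circ> R = id"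
    by (auto simp: spectrum_def)
  obtain M where M: "M > 0" "\<And>x. norm (R x) \<le> M * norm x"
    using bounded_clinear_bound[OF R(1)] by blast
  have "1 / M * norm x \<le> norm (?A x)" for x
    using M(2)[of "?A x"] M(1) fun_cong[OF R(2), of x] by (simp add: field_simps)
  moreover have "surj ?A"
    using R(3) by (metis comp_surj fun.set_map image_comp surj_def surj_id comp_apply id_apply)
  ultimately show "bounded_below ?A \<and> surj ?A"
    unfolding bounded_below_def using M(1) by (meson divide_pos_pos zero_less_one)
next
  let ?A = "\<lambda>x. T x - z *\<^sub>C x"
  assume *: "bounded_below ?A \<and> surj ?A"
  then obtain c where c: "c > 0" "\<And>x. c * norm x \<le> norm (?A x)"
    by (auto simp: bounded_below_def)
  note inv = bounded_below_inverse[OF bounded_clinear_shift[OF T] c conjunct2[OF *]]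
  have "inv ?A \<circ> ?A = id" "?A \<circ> inv ?A = id"
    using inv(1) by (simp_all add: bij_is_inj inj_iff[symmetric] bij_is_surj surj_iff[symmetric])
  then show "z \<notin> spectrum T"
    unfolding spectrum_def using inv(2) by blast
qed

lemma approx_point_spectrum_subset: "approx_point_spectrum T \<subseteq> spectrum T"
  by (auto simp: approx_point_spectrum_def)

text \<open>Membership in \<open>spectrum T\<close>, which the definition demands, follows from the
  failure of a lower bound. From here on \<open>bounded_below\<close> is the working form.\<close>

lemma not_in_approx_point_spectrum_iff:
  assumes T: "bounded_clinear T"
  shows "z \<notin> approx_point_spectrum T \<longleftrightarrow> bounded_below (\<lambda>x. T x - z *\<^sub>C x)"
proof
  assume *: "z \<notin> approx_point_spectrum T"
  show "bounded_below (\<lambda>x. T x - z *\<^sub>C x)"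
  proof (rule ccontr)
    assume nb: "\<not> bounded_below (\<lambda>x. T x - z *\<^sub>C x)"
    then have "\<exists>x. norm x = 1 \<and> norm (T x - z *\<^sub>C x) < 1 / Suc n" for n :: nat
      unfolding not_bounded_below_iff[OF bounded_clinear_shift[OF T]] by simp
    then obtain X where X: "\<And>n. norm (X n) = 1" "\<And>n. norm (T (X n) - z *\<^sub>C X n) < 1 / Suc n"
      by metis
    have "(\<lambda>n. norm (T (X n) - z *\<^sub>C X n)) \<longlonglongrightarrow> 0"
      by (rule tendsto_sandwich[OF _ _ tendsto_const LIMSEQ_Suc[OF lim_1_over_n]])
        (auto intro!: always_eventually less_imp_le X(2) simp del: of_nat_Suc)
    moreover have "z \<in> spectrum T"
      using nb not_in_spectrum_iff[OF T] by blast
    ultimately show False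
      using * X(1) by (auto simp: approx_point_spectrum_def)
  qed
next
  assume "bounded_below (\<lambda>x. T x - z *\<^sub>C x)"
  then obtain c where c: "c > 0" "\<And>x. c * norm x \<le> norm (T x - z *\<^sub>C x)"
    by (auto simp: bounded_below_def)
  show "z \<notin> approx_point_spectrum T"
  proof
    assume "z \<in> approx_point_spectrum T"
    then obtain X where X: "\<And>n. norm (X n) = 1" "(\<lambda>n. norm (T (X n) - z *\<^sub>C X n)) \<longlonglongrightarrow> 0"
      by (auto simp: approx_point_spectrum_def)
    have "c \<le> 0"
      by (rule LIMSEQ_le_const[OF X(2)]) (metis X(1) c(2) mult.right_neutral)
    then show False
      using c(1) by simp
  qed
qed

lemma shift_lower_bound:
  assumes "c * norm x \<le> norm (T x - w *\<^sub>C x)"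
  shows "(c - cmod (z - w)) * norm x \<le> norm (T x - z *\<^sub>C (x :: 'a::complex_hilbert_space))"
proof -
  have "T x - w *\<^sub>C x = (T x - z *\<^sub>C x) + (z - w) *\<^sub>C x"
    by (simp add: scaleC_diff_left)
  then have "norm (T x - w *\<^sub>C x) \<le> norm (T x - z *\<^sub>C x) + cmod (z - w) * norm x"
    by (metis norm_scaleC norm_triangle_ineq)
  then show ?thesis
    using assms by (simp add: left_diff_distrib)
qed

lemma shift_lower_bound_far:
  assumes "norm (T x) \<le> M * norm x"
  shows "(cmod z - M) * norm x \<le> norm (T x - z *\<^sub>C (x :: 'a::complex_hilbert_space))"
proof -
  have "norm (z *\<^sub>C x) \<le> norm (T x - z *\<^sub>C x) + norm (T x)"
    using norm_triangle_sub[of "z *\<^sub>C x" "T x"] by (simp add: norm_minus_commute add.commute)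
  then show ?thesis
    using assms by (simp add: norm_scaleC left_diff_distrib)
qed

text \<open>Compactness handles the part of \<open>K\<close> in a disk of radius
  \<open>M + 1\<close>; farther out, \<open>cmod z - M\<close> exceeds \<open>1\<close>. The single
  \<open>c\<close> for all of \<open>K\<close> later lets one energy constant serve many
  radii.\<close>

lemma uniform_lower_bound:
  assumes T: "bounded_clinear T" and K: "closed K" "K \<inter> approx_point_spectrum T = {}"
  obtains c where "c > 0" "\<And>z x. z \<in> K \<Longrightarrow> c * norm x \<le> norm (T x - z *\<^sub>C x)"
proof -
  obtain M where M: "M > 0" "\<And>x. norm (T x) \<le> M * norm x"
    using bounded_clinear_bound[OF T] by blast
  define L where "L = K \<inter> cball 0 (M + 1)"
  have comp: "compact L"
    unfolding L_def using K(1) by (simp add: closed_Int_compact)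
  have "\<exists>c>0. \<forall>z\<in>L. \<forall>x. c * norm x \<le> norm (T x - z *\<^sub>C x)"
  proof -
    have "\<forall>w\<in>L. bounded_below (\<lambda>x. T x - w *\<^sub>C x)"
      unfolding not_in_approx_point_spectrum_iff[OF T, symmetric] using K(2) by (auto simp: L_def)
    then obtain c where c: "\<And>w. w \<in> L \<Longrightarrow> c w > 0" "\<And>w x. w \<in> L \<Longrightarrow> c w * norm x \<le> norm (T x - w *\<^sub>C x)"
      unfolding bounded_below_def by metis
    have "L \<subseteq> (\<Union>w\<in>L. ball w (c w / 2))"
      using c(1) by force
    then obtain D where D: "D \<subseteq> L" "finite D" "L \<subseteq> (\<Union>w\<in>D. ball w (c w / 2))"
      using compactE_image[OF comp, of L "\<lambda>w. ball w (c w / 2)"] by auto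
    \<comment> \<open>Inserting \<open>1\<close> keeps \<open>Min\<close> meaningful when
      \<open>D\<close> is empty.\<close>
    define e where "e = Min (insert 1 ((\<lambda>w. c w / 2) ` D))"
    have "e > 0"
      unfolding e_def using D c(1) by (subst Min_gr_iff) auto
    moreover have "e * norm x \<le> norm (T x - z *\<^sub>C x)" if "z \<in> L" for z x
    proof -
      obtain w where "w \<in> D" "z \<in> ball w (c w / 2)"
        using D(3) \<open>z \<in> L\<close> by blast
      then have w: "w \<in> D" "cmod (z - w) < c w / 2"
        by (auto simp: dist_norm norm_minus_commute)
      then have "e \<le> c w / 2"
        unfolding e_def using D by (intro Min_le) auto
      then have "e * norm x \<le> (c w - cmod (z - w)) * norm x"
        using w by (intro mult_right_mono) auto
      also have "\<dots> \<le> norm (T x - z *\<^sub>C x)"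
        using D(1) w(1) by (intro shift_lower_bound c(2)) auto
      finally show ?thesis .
    qed
    ultimately show ?thesis
      by blast
  qed
  then obtain c where c: "c > 0" "\<And>z x. z \<in> L \<Longrightarrow> c * norm x \<le> norm (T x - z *\<^sub>C x)"
    by blast
  have "min c 1 * norm x \<le> norm (T x - z *\<^sub>C x)" if "z \<in> K" for z x
  proof (cases "cmod z \<le> M + 1")
    case True
    then have "c * norm x \<le> norm (T x - z *\<^sub>C x)"
      using that c(2) by (auto simp: L_def)
    moreover have "min c 1 * norm x \<le> c * norm x"
      by (intro mult_right_mono) auto
    ultimately show ?thesis
      by linarith
  next
    case False
    have "min c 1 * norm x \<le> (cmod z - M) * norm x"
      using False by (intro mult_right_mono) auto
    also have "\<dots> \<le> norm (T x - z *\<^sub>C x)"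
      by (rule shift_lower_bound_far[OF M(2)])
    finally show ?thesis .
  qed
  then show ?thesis
    using that[of "min c 1"] c(1) by auto
qed

lemma compact_approx_point_spectrum:
  assumes T: "bounded_clinear T"
  shows "compact (approx_point_spectrum T)"
proof -
  obtain M where M: "M > 0" "\<And>x. norm (T x) \<le> M * norm x"
    using bounded_clinear_bound[OF T] by blast
  have "z \<notin> approx_point_spectrum T" if "M < cmod z" for z
  proof -
    have "\<forall>x. (cmod z - M) * norm x \<le> norm (T x - z *\<^sub>C x)"
      using shift_lower_bound_far M(2) by blast
    then show ?thesis
      unfolding not_in_approx_point_spectrum_iff[OF T] bounded_below_def
      using that by (intro exI[of _ "cmod z - M"]) simp
  qed
  then have "bounded (approx_point_spectrum T)"
    by (intro boundedI[of _ M]) (meson not_le)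
  moreover have "open (- approx_point_spectrum T)"
    unfolding open_contains_ball
  proof
    fix w assume "w \<in> - approx_point_spectrum T"
    then obtain c where c: "c > 0" "\<And>x. c * norm x \<le> norm (T x - w *\<^sub>C x)"
      using not_in_approx_point_spectrum_iff[OF T] by (auto simp: bounded_below_def)
    have "z \<notin> approx_point_spectrum T" if "cmod (z - w) < c" for z
    proof -
      have "\<forall>x. (c - cmod (z - w)) * norm x \<le> norm (T x - z *\<^sub>C x)"
        using shift_lower_bound[of c _ T w z] c(2) by blast
      then show ?thesis
        unfolding not_in_approx_point_spectrum_iff[OF T] bounded_below_def
        using that by (intro exI[of _ "c - cmod (z - w)"]) simp
    qed
    then show "\<exists>e>0. ball w e \<subseteq> - approx_point_spectrum T"
      using c(1) by (intro exI[of _ c]) (auto simp: dist_norm norm_minus_commute)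
  qed
  ultimately show ?thesis
    by (simp add: compact_eq_bounded_closed closed_def)
qed

text \<open>Multiplying by \<open>- cnj z\<close> turns the dominant term into
  \<open>(cmod z)\<^sup>2\<close> times the identity, which makes the operator coercive.\<close>

lemma surj_shift_far:
  assumes T: "bounded_clinear T" and M: "M > 0" "\<And>x. norm (T x) \<le> M * norm x" and z: "M < cmod z"
  shows "surj (\<lambda>x. T x - z *\<^sub>C x)"
proof -
  define A where "A x = (- cnj z) *\<^sub>C (T x - z *\<^sub>C x)" for x
  have "bounded_clinear A"
    unfolding A_def[abs_def] by (intro bounded_clinear_scaleC bounded_clinear_shift T)
  moreover have "z \<noteq> 0"
    using M(1) z by auto
  moreover have "(cmod z * (cmod z - M)) * (norm x)\<^sup>2 \<le> A x \<bullet> x" for x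
  proof -
    have "A x = (cmod z)\<^sup>2 *\<^sub>R x - cnj z *\<^sub>C T x"
      unfolding scaleC_of_real[symmetric] complex_norm_square
      by (simp add: A_def scaleC_diff_right scaleC_scaleC scaleC_minus_left mult.commute)
    then have "A x \<bullet> x = (cmod z)\<^sup>2 * (norm x)\<^sup>2 - (cnj z *\<^sub>C T x) \<bullet> x"
      by (simp add: inner_diff_left power2_norm_eq_inner)
    moreover have "(cnj z *\<^sub>C T x) \<bullet> x \<le> cmod z * (M * norm x) * norm x"
    proof -
      have "(cnj z *\<^sub>C T x) \<bullet> x \<le> norm (cnj z *\<^sub>C T x) * norm x"
        by (rule norm_cauchy_schwarz)
      also have "\<dots> \<le> cmod z * (M * norm x) * norm x"
        using M(2)[of x] by (simp add: norm_scaleC mult_left_mono mult_right_mono)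
      finally show ?thesis .
    qed
    ultimately show ?thesis
      by (simp add: algebra_simps power2_eq_square)
  qed
  ultimately have "surj A"
    using z by (intro coercive_surj[of A "cmod z * (cmod z - M)"]) (auto simp: bounded_clinear_linear)
  show ?thesis
    unfolding surj_def
  proof
    fix y
    obtain x where "A x = (- cnj z) *\<^sub>C y"
      using \<open>surj A\<close> by (metis surjD)
    then have "(- (1 / cnj z)) *\<^sub>C A x = (- (1 / cnj z)) *\<^sub>C ((- cnj z) *\<^sub>C y)"
      by simp
    then have "T x - z *\<^sub>C x = y"
      using \<open>z \<noteq> 0\<close> by (simp add: A_def scaleC_scaleC scaleC_one)
    then show "\<exists>x. y = T x - z *\<^sub>C x"
      by blast
  qed
qed

text \<open>With \<open>R\<close> the inverse of \<open>T - w\<close>, the product of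
  \<open>T - z\<close> and \<open>R\<close> is \<open>I - (z - w) R\<close>. It is coercive because
  \<open>R\<close> has norm at most \<open>1 / c\<close>; this takes the place of a Neumann
  series.\<close>

lemma surj_shift_near:
  assumes T: "bounded_clinear T" and c: "c > 0" "\<And>x. c * norm x \<le> norm (T x - w *\<^sub>C x)"
    and surj: "surj (\<lambda>x. T x - w *\<^sub>C x)" and z: "cmod (z - w) < c"
  shows "surj (\<lambda>x. T x - z *\<^sub>C x)"
proof -
  let ?A = "\<lambda>x. T x - w *\<^sub>C x"
  define R where "R = inv ?A"
  have R: "bounded_clinear R" "\<And>y. norm (R y) \<le> norm y / c" "\<And>y. ?A (R y) = y"
    using bounded_below_inverse[OF bounded_clinear_shift[OF T] c surj] surj_f_inv_f[OF surj]
    unfolding R_def by auto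
  define B where "B y = y - (z - w) *\<^sub>C R y" for y
  have "bounded_clinear B"
    unfolding B_def[abs_def] by (rule bounded_clinear_diff[OF bounded_clinear_id bounded_clinear_scaleC[OF R(1)]])
  moreover have "(1 - cmod (z - w) / c) * (norm y)\<^sup>2 \<le> B y \<bullet> y" for y
  proof -
    have "((z - w) *\<^sub>C R y) \<bullet> y \<le> norm ((z - w) *\<^sub>C R y) * norm y"
      by (rule norm_cauchy_schwarz)
    also have "\<dots> \<le> cmod (z - w) * (norm y / c) * norm y"
      unfolding norm_scaleC by (intro mult_left_mono mult_right_mono R(2)) auto
    finally show ?thesis
      by (simp add: B_def inner_diff_left power2_norm_eq_inner[symmetric] left_diff_distrib power2_eq_square)
  qed
  ultimately have "surj B"
    using z c(1) by (intro coercive_surj[of B "1 - cmod (z - w) / c"]) (auto simp: bounded_clinear_linear)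
  moreover have "T (R y) - z *\<^sub>C R y = B y" for y
    using R(3)[of y] by (simp add: B_def scaleC_diff_left algebra_simps)
  ultimately show ?thesis
    unfolding surj_def by metis
qed

text \<open>A uniform lower bound carries surjectivity along the segment in finitely many steps.\<close>

lemma surj_shift_segment:
  assumes T: "bounded_clinear T" and c: "c > 0"
    and below: "\<And>s x. s \<in> closed_segment w z \<Longrightarrow> c * norm x \<le> norm (T x - s *\<^sub>C x)"
    and surj: "surj (\<lambda>x. T x - w *\<^sub>C x)"
  shows "surj (\<lambda>x. T x - z *\<^sub>C x)"
proof -
  \<comment> \<open>Cutting the segment into \<open>n\<close> pieces makes each step shorter than
    \<open>c\<close>, as \<open>surj_shift_near\<close> requires.\<close>
  obtain n :: nat where n: "cmod (z - w) / c < n"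
    using reals_Archimedean2 by blast
  have n0: "n > 0"
    using n c by (metis divide_nonneg_pos less_le_not_le norm_ge_zero not_gr_zero of_nat_0)
  define p where "p k = w + (real k / real n) *\<^sub>R (z - w)" for k
  have seg: "p k \<in> closed_segment w z" if "k \<le> n" for k
    unfolding in_segment p_def using that n0
    by (intro exI[of _ "real k / real n"]) (auto simp: algebra_simps)
  have "surj (\<lambda>x. T x - p k *\<^sub>C x)" if "k \<le> n" for k
    using that
  proof (induction k)
    case (Suc k)
    have "p (Suc k) - p k = (1 / real n) *\<^sub>R (z - w)"
      by (simp add: p_def scaleR_diff_left[symmetric] diff_divide_distrib[symmetric])
    then have "cmod (p (Suc k) - p k) = cmod (z - w) / n"
      by simp
    also have "\<dots> < c"
      using n c n0 by (simp add: field_simps)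
    finally show ?case
      using Suc by (intro surj_shift_near[OF T c below[OF seg]]) auto
  qed (simp add: p_def surj)
  from this[of n] show ?thesis
    using n0 by (simp add: p_def)
qed

text \<open>This reflects that boundary points of the spectrum are approximate eigenvalues:
  surjectivity travels from the centre \<open>t\<close> along a segment on which the lower bound is
  uniform.\<close>

lemma disjoint_spectrum_disk:
  assumes T: "bounded_clinear T" and ap: "approx_point_spectrum T \<inter> cball t \<rho> = {}"
    and t: "t \<notin> spectrum T" and z: "z \<in> cball t \<rho>"
  shows "z \<notin> spectrum T"
proof -
  obtain c where c: "c > 0" "\<And>s x. s \<in> cball t \<rho> \<Longrightarrow> c * norm x \<le> norm (T x - s *\<^sub>C x)"
    using uniform_lower_bound[OF T, of "cball t \<rho>"] ap by (auto simp: Int_commute)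
  have "t \<in> cball t \<rho>"
    using z by (auto intro: order_trans[OF zero_le_dist])
  then have "closed_segment t z \<subseteq> cball t \<rho>"
    using z convex_cball by (simp add: closed_segment_subset)
  then have "surj (\<lambda>x. T x - z *\<^sub>C x)"
    using surj_shift_segment[OF T c(1), of t z] c(2) t not_in_spectrum_iff[OF T] by blast
  moreover have "bounded_below (\<lambda>x. T x - z *\<^sub>C x)"
    using not_in_approx_point_spectrum_iff[OF T, of z] ap z by blast
  ultimately show ?thesis
    using not_in_spectrum_iff[OF T] by blast
qed

text \<open>Surjectivity is brought in from far away, along the ray from \<open>t\<close> through
  \<open>z\<close>, which stays outside the disk.\<close>

lemma disjoint_spectrum_outside:
  assumes T: "bounded_clinear T" and ap: "approx_point_spectrum T \<subseteq> ball t \<rho>"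
    and z: "\<rho> < cmod (z - t)"
  shows "z \<notin> spectrum T"
proof -
  have disj: "(- ball t \<rho>) \<inter> approx_point_spectrum T = {}"
    using ap by blast
  obtain c where c: "c > 0" "\<And>s x. s \<in> - ball t \<rho> \<Longrightarrow> c * norm x \<le> norm (T x - s *\<^sub>C x)"
    using uniform_lower_bound[OF T _ disj] by auto
  obtain M where M: "M > 0" "\<And>x. norm (T x) \<le> M * norm x"
    using bounded_clinear_bound[OF T] by blast
  \<comment> \<open>Chosen so that \<open>k *\<^sub>R (z - t)\<close> has modulus
    \<open>M + 1 + cmod z\<close>; hence \<open>w\<close> has modulus at least
    \<open>M + 1\<close>.\<close>
  define k where "k = (if z = t then 0 else (M + 1 + cmod z) / cmod (z - t))"
  define w where "w = z + k *\<^sub>R (z - t)"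
  have "k \<ge> 0"
    using M(1) by (simp add: k_def)
  have far: "surj (\<lambda>x. T x - w *\<^sub>C x)" if "z \<noteq> t"
  proof (rule surj_shift_far[OF T M])
    have "cmod (k *\<^sub>R (z - t)) = M + 1 + cmod z"
      using that M(1) by (simp add: k_def)
    then show "M < cmod w"
      unfolding w_def using norm_triangle_ineq4[of "z + k *\<^sub>R (z - t)" z] by simp
  qed
  have seg: "closed_segment w z \<subseteq> - ball t \<rho>"
  proof
    fix s assume "s \<in> closed_segment w z"
    then obtain u where u: "0 \<le> u" "u \<le> 1" "s = (1 - u) *\<^sub>R w + u *\<^sub>R z"
      by (auto simp: in_segment)
    then have "s - t = (1 + (1 - u) * k) *\<^sub>R (z - t)"
      by (simp add: w_def algebra_simps)
    then have "cmod (s - t) = (1 + (1 - u) * k) * cmod (z - t)"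
      using u \<open>k \<ge> 0\<close> by (simp del: of_real_add of_real_mult)
    also have "\<dots> \<ge> 1 * cmod (z - t)"
      using u \<open>k \<ge> 0\<close> by (intro mult_right_mono) auto
    finally show "s \<in> - ball t \<rho>"
      using z by (auto simp: dist_norm norm_minus_commute)
  qed
  have "surj (\<lambda>x. T x - z *\<^sub>C x)"
  \<comment> \<open>\<open>z = t\<close> forces \<open>\<rho> < 0\<close>. The ball is then empty,
    the lower bound holds everywhere, and any point of large modulus can serve as the start.\<close>
  proof (cases "z = t")
    case True
    then have "- ball t \<rho> = UNIV"
      using z by (simp add: ball_empty)
    then have "surj (\<lambda>x. T x - complex_of_real (M + 1) *\<^sub>C x)" "\<And>s x. c * norm x \<le> norm (T x - s *\<^sub>C x)"
      using c(2) surj_shift_far[OF T M, of "complex_of_real (M + 1)"] M(1) by auto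
    then show ?thesis
      using surj_shift_segment[OF T c(1)] by blast
  next
    case False
    then show ?thesis
      using surj_shift_segment[OF T c(1) c(2) far] seg by blast
  qed
  moreover have "bounded_below (\<lambda>x. T x - z *\<^sub>C x)"
    using c z unfolding bounded_below_def
    by (intro exI[of _ c]) (auto simp: dist_norm norm_minus_commute)
  ultimately show ?thesis
    using not_in_spectrum_iff[OF T] by blast
qed

section \<open>Growth of orbits\<close>

lemma cinner_sum_left: "cinner (\<Sum>i\<in>I. f i) y = (\<Sum>i\<in>I. cinner (f i) (y :: 'a::complex_hilbert_space))"
proof (induction I rule: infinite_finite_induct)
  case empty
  show ?case
    using cinner_diff_left[of y y y] by simp
qed (use cinner_diff_left[of y y y] in \<open>simp_all add: cinner_add_left\<close>)

lemma cinner_sum_right: "cinner y (\<Sum>i\<in>I. f i) = (\<Sum>i\<in>I. cinner (y :: 'a::complex_hilbert_space) (f i))"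
  by (subst cinner_commute) (simp add: cinner_sum_left cinner_commute[symmetric])

text \<open>Parseval's identity for the discrete Fourier transform of a vector-valued sequence;
  averaging over roots of unity replaces an integral over the circle.\<close>

lemma sum_norm_roots_of_unity:
  fixes v :: "nat \<Rightarrow> 'a::complex_hilbert_space"
  assumes "m > 0"
  defines "u \<equiv> \<lambda>k. cis (2 * pi * real k / real m)"
  shows "(\<Sum>k<m. (norm (\<Sum>j<m. u k ^ j *\<^sub>C v j))\<^sup>2) = m * (\<Sum>j<m. (norm (v j))\<^sup>2)"
proof -
  have inj: "inj_on u {..<m}"
    using Complex.bij_betw_roots_unity[OF \<open>m > 0\<close>] by (simp add: bij_betw_def u_def)
  have root: "u k ^ m = 1" if "k < m" for k
    using bij_betwE[OF Complex.bij_betw_roots_unity[OF \<open>m > 0\<close>]] that by (simp add: u_def)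
  \<comment> \<open>This symmetry turns the sum over \<open>k\<close> into a geometric series in
    \<open>\<zeta>\<close>.\<close>
  have swap: "u k ^ j = u j ^ k" for j k
    by (simp add: u_def Complex.DeMoivre mult_ac)
  have unit: "u k * cnj (u k) = 1" for k
    by (simp add: complex_norm_square[symmetric] u_def)
  have orth: "(\<Sum>k<m. u k ^ j * cnj (u k ^ l)) = (if j = l then of_nat m else 0)" if "j < m" "l < m" for j l
  proof -
    define \<zeta> where "\<zeta> = u j * cnj (u l)"
    have "u k ^ j * cnj (u k ^ l) = \<zeta> ^ k" for k
      by (simp add: \<zeta>_def power_mult_distrib swap[of k j] swap[of k l])
    moreover have "(\<Sum>k<m. \<zeta> ^ k) = (if j = l then of_nat m else 0)"
    proof (cases "j = l")
      case True
      then show ?thesis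
        by (simp add: \<zeta>_def unit)
    next
      case False
      have "\<zeta> \<noteq> 1"
      proof
        assume "\<zeta> = 1"
        then have "u j * (u l * cnj (u l)) = u l"
          by (simp add: \<zeta>_def mult_ac)
        then show False
          using False inj that by (simp add: unit inj_on_eq_iff)
      qed
      moreover have "\<zeta> ^ m = 1"
        by (simp add: \<zeta>_def power_mult_distrib root that complex_cnj_power[symmetric] del: complex_cnj_power)
      ultimately show ?thesis
        using False by (simp add: geometric_sum)
    qed
    ultimately show ?thesis
      by simp
  qed
  have "complex_of_real (\<Sum>k<m. (norm (\<Sum>j<m. u k ^ j *\<^sub>C v j))\<^sup>2)
      = (\<Sum>k<m. \<Sum>j<m. \<Sum>l<m. u k ^ j * cnj (u k ^ l) * cinner (v j) (v l))"
    unfolding of_real_sum cinner_self[symmetric] cinner_sum_left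
    unfolding cinner_sum_right cinner_scaleC_left cinner_scaleC_right by (simp add: mult_ac)
  also have "\<dots> = (\<Sum>j<m. \<Sum>l<m. \<Sum>k<m. u k ^ j * cnj (u k ^ l) * cinner (v j) (v l))"
    by (rule trans[OF sum.swap], rule sum.cong[OF refl], rule sum.swap)
  also have "\<dots> = (\<Sum>j<m. \<Sum>l<m. (if j = l then of_nat m else 0) * cinner (v j) (v l))"
    unfolding sum_distrib_right[symmetric] by (intro sum.cong refl) (simp only: lessThan_iff orth)
  also have "\<dots> = complex_of_real (m * (\<Sum>j<m. (norm (v j))\<^sup>2))"
    by (simp add: if_distrib[of "\<lambda>x. x * _"] cinner_self sum_distrib_left cong: if_cong)
  finally show ?thesis
    by (simp only: of_real_eq_iff)
qed

text \<open>At least one of the \<open>m\<close> directions reaches the average computed by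
  Parseval's identity.\<close>

lemma exists_norm_sum_ge:
  fixes v :: "nat \<Rightarrow> 'a::complex_hilbert_space"
  assumes "m > 0" "r > 0"
  obtains \<mu> where "cmod \<mu> = r" "(\<Sum>j<m. (r ^ j * norm (v j))\<^sup>2) \<le> (norm (\<Sum>j<m. \<mu> ^ j *\<^sub>C v j))\<^sup>2"
proof -
  define u where "u k = cis (2 * pi * real k / real m)" for k
  define w where "w j = r ^ j *\<^sub>R v j" for j
  define s where "s = (\<Sum>j<m. (norm (w j))\<^sup>2)"
  have "(\<Sum>k<m. (norm (\<Sum>j<m. u k ^ j *\<^sub>C w j))\<^sup>2) = (\<Sum>k<m. s)"
    using sum_norm_roots_of_unity[OF \<open>m > 0\<close>, of w] by (simp add: u_def s_def)
  then have "\<not> (\<forall>k<m. (norm (\<Sum>j<m. u k ^ j *\<^sub>C w j))\<^sup>2 < s)"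
    using sum_strict_mono[of "{..<m}" "\<lambda>k. (norm (\<Sum>j<m. u k ^ j *\<^sub>C w j))\<^sup>2" "\<lambda>k. s"] \<open>m > 0\<close>
    by fastforce
  then obtain k where k: "s \<le> (norm (\<Sum>j<m. u k ^ j *\<^sub>C w j))\<^sup>2"
    by (auto simp: not_less)
  have "u k ^ j *\<^sub>C w j = (r * u k) ^ j *\<^sub>C v j" for j
    by (simp add: w_def scaleC_of_real[symmetric] scaleC_scaleC power_mult_distrib mult.commute)
  moreover have "s = (\<Sum>j<m. (r ^ j * norm (v j))\<^sup>2)"
    using \<open>r > 0\<close> by (simp add: s_def w_def)
  moreover have "cmod (r * u k) = r"
    using \<open>r > 0\<close> by (simp add: u_def norm_mult)
  ultimately show ?thesis
    using k by (intro that[of "r * u k"]) simp_all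
qed

text \<open>The operator form of factoring \<open>a ^ m - b ^ m\<close> by \<open>a - b\<close>,
  applied to \<open>x\<close>.\<close>

lemma geometric_telescope:
  fixes N :: "'a::complex_hilbert_space \<Rightarrow> 'a" and \<mu> :: complex and x :: 'a
  assumes N: "bounded_clinear N"
  defines "y \<equiv> \<lambda>m. \<Sum>i<m. \<mu> ^ i *\<^sub>C (N ^^ (m - Suc i)) x"
  shows "N (y m) - \<mu> *\<^sub>C y m = (N ^^ m) x - \<mu> ^ m *\<^sub>C x"
proof (induction m)
  case 0
  show ?case
    by (simp add: y_def bounded_clinear_simps[OF N] scaleC_zero_right scaleC_one)
next
  case (Suc m)
  have "y (Suc m) = (N ^^ m) x + \<mu> *\<^sub>C y m"
    unfolding y_def sum.lessThan_Suc_shift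
    by (simp add: scaleC_one scaleC_scaleC[symmetric]
        linear_sum[OF bounded_linear.linear[OF bounded_linear_scaleC]])
  then have "N (y (Suc m)) - \<mu> *\<^sub>C y (Suc m)
      = (N ^^ Suc m) x - \<mu> *\<^sub>C (N ^^ m) x + \<mu> *\<^sub>C (N (y m) - \<mu> *\<^sub>C y m)"
    by (simp add: bounded_clinear_simps[OF N] scaleC_add_right scaleC_diff_right)
  also have "\<dots> = (N ^^ Suc m) x - \<mu> ^ Suc m *\<^sub>C x"
    unfolding Suc.IH by (simp add: scaleC_diff_right scaleC_scaleC)
  finally show ?case .
qed

text \<open>The orbit rescaled to radius \<open>r\<close> is controlled in square sum by its two
  ends. Since \<open>C\<close> is independent of \<open>m\<close>, long stretches of comparable
  values are excluded; evaluated at \<open>(N ^^ i) x\<close>, it controls every later stretch as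
  well.\<close>

definition energy_bound :: "('a::complex_hilbert_space \<Rightarrow> 'a) \<Rightarrow> real \<Rightarrow> real \<Rightarrow> bool"
  where "energy_bound N r C \<longleftrightarrow> (\<forall>x m.
    (\<Sum>j\<le>m. (norm ((N ^^ j) x) / r ^ j)\<^sup>2) \<le> C * ((norm x)\<^sup>2 + (norm ((N ^^ m) x) / r ^ m)\<^sup>2))"

text \<open>
  The sums \<open>\<Sum>i<m. \<mu>\<^sup>i N\<^bsup>m-1-i\<^esup> x\<close> with \<open>\<bar>\<mu>\<bar> = r\<close> are controlled by both ends of the orbit,
  since \<open>N - \<mu>\<close> maps them to \<open>N\<^sup>m x - \<mu>\<^sup>m x\<close>; averaging over \<open>\<mu>\<close> yields the energy of the whole orbit.
\<close>

lemma energy_bound_circle: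
  assumes N: "bounded_clinear N" and r: "r > 0" and c: "c > 0"
    and below: "\<And>\<mu> x. cmod \<mu> = r \<Longrightarrow> c * norm x \<le> norm (N x - \<mu> *\<^sub>C x)"
    and C: "2 * r\<^sup>2 / c\<^sup>2 + 1 \<le> C"
  shows "energy_bound N r C"
  unfolding energy_bound_def
proof (intro allI)
  fix x m
  define a where "a j = (norm ((N ^^ j) x) / r ^ j)\<^sup>2" for j
  have a0: "a j \<ge> 0" for j
    by (simp add: a_def)
  have "(\<Sum>j<m. a j) \<le> 2 * r\<^sup>2 / c\<^sup>2 * (a 0 + a m)"
  proof (cases "m = 0")
    case True
    then show ?thesis
      using a0 by simp
  next
    case False
    then obtain \<mu> where \<mu>: "cmod \<mu> = r" and
      le: "(\<Sum>i<m. (r ^ i * norm ((N ^^ (m - Suc i)) x))\<^sup>2) \<le> (norm (\<Sum>i<m. \<mu> ^ i *\<^sub>C (N ^^ (m - Suc i)) x))\<^sup>2"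
      using exists_norm_sum_ge[of m r "\<lambda>i. (N ^^ (m - Suc i)) x"] r by blast
    define y where "y = (\<Sum>i<m. \<mu> ^ i *\<^sub>C (N ^^ (m - Suc i)) x)"
    have "c * norm y \<le> norm ((N ^^ m) x - \<mu> ^ m *\<^sub>C x)"
      using below[OF \<mu>, of y] geometric_telescope[OF N, where m = m and \<mu> = \<mu> and x = x] by (simp add: y_def)
    also have "\<dots> \<le> norm ((N ^^ m) x) + r ^ m * norm x"
      using norm_triangle_ineq4[of "(N ^^ m) x" "\<mu> ^ m *\<^sub>C x"] by (simp add: norm_scaleC norm_power \<mu>)
    finally have "(c * norm y)\<^sup>2 \<le> (norm ((N ^^ m) x) + r ^ m * norm x)\<^sup>2"
      using c by (intro power_mono) auto
    also have "\<dots> \<le> 2 * (norm ((N ^^ m) x))\<^sup>2 + 2 * (r ^ m * norm x)\<^sup>2"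
      using sum_squares_bound[of "norm ((N ^^ m) x)" "r ^ m * norm x"] by (simp add: power2_sum)
    also have "\<dots> = 2 * r ^ (2 * m) * (a 0 + a m)"
      using r by (simp add: a_def power_divide power_mult_distrib power_mult[symmetric] field_simps)
    finally have 1: "c\<^sup>2 * (norm y)\<^sup>2 \<le> 2 * r ^ (2 * m) * (a 0 + a m)"
      by (simp add: power_mult_distrib)
    \<comment> \<open>Read backwards, the weights \<open>r ^ i\<close> of the averaged sum
      complement the powers hidden in \<open>a\<close>, so that the factor
      \<open>r ^ (2 * m)\<close> is common to all terms.\<close>
    have "(\<Sum>j<m. a j) * r ^ (2 * m) = (\<Sum>i<m. a (m - Suc i)) * r ^ (2 * m)"
      by (simp add: sum.nat_diff_reindex)
    also have "\<dots> = r\<^sup>2 * (\<Sum>i<m. (r ^ i * norm ((N ^^ (m - Suc i)) x))\<^sup>2)"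
      unfolding sum_distrib_right sum_distrib_left
    proof (rule sum.cong)
      fix i assume "i \<in> {..<m}"
      then have "r ^ m = r ^ (m - Suc i) * r ^ i * r"
        by (simp add: power_add[symmetric] power_Suc2[symmetric] del: power_Suc)
      then have "(r ^ m)\<^sup>2 = (r ^ (m - Suc i))\<^sup>2 * (r ^ i)\<^sup>2 * r\<^sup>2"
        by (simp add: power_mult_distrib)
      moreover have "r ^ (2 * m) = (r ^ m)\<^sup>2"
        by (simp add: power_mult[symmetric] mult.commute)
      ultimately show "a (m - Suc i) * r ^ (2 * m) = r\<^sup>2 * (r ^ i * norm ((N ^^ (m - Suc i)) x))\<^sup>2"
        using r by (simp add: a_def power_divide power_mult_distrib)
    qed simp
    also have "\<dots> \<le> r\<^sup>2 * (norm y)\<^sup>2"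
      using le by (intro mult_left_mono) (auto simp: y_def)
    also have "\<dots> = r\<^sup>2 / c\<^sup>2 * (c\<^sup>2 * (norm y)\<^sup>2)"
      using c by simp
    also have "\<dots> \<le> r\<^sup>2 / c\<^sup>2 * (2 * r ^ (2 * m) * (a 0 + a m))"
      by (intro mult_left_mono 1) auto
    also have "\<dots> = 2 * r\<^sup>2 / c\<^sup>2 * (a 0 + a m) * r ^ (2 * m)"
      by simp
    finally show ?thesis
      using r by (simp only: mult_le_cancel_right) simp
  qed
  moreover have "(\<Sum>j\<le>m. a j) = (\<Sum>j<m. a j) + a m"
    by (simp add: lessThan_Suc_atMost[symmetric])
  \<comment> \<open>The summand \<open>1\<close> in the constant pays for the end term
    \<open>a m\<close>, absent from the sum over \<open>j < m\<close>.\<close>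
  moreover have "(2 * r\<^sup>2 / c\<^sup>2 + 1) * (a 0 + a m) \<le> C * (a 0 + a m)"
    using C a0 by (intro mult_right_mono) (auto simp: add_nonneg_nonneg)
  ultimately have "(\<Sum>j\<le>m. a j) \<le> C * (a 0 + a m)"
    using a0[of 0] by (simp add: distrib_right)
  then show "(\<Sum>j\<le>m. (norm ((N ^^ j) x) / r ^ j)\<^sup>2) \<le> C * ((norm x)\<^sup>2 + (norm ((N ^^ m) x) / r ^ m)\<^sup>2)"
    by (simp add: a_def)
qed

text \<open>A discrete Gronwall argument on the tails \<open>S i\<close>: minimality of
  \<open>a m\<close> turns \<open>sums\<close> into \<open>S i \<le> 2 * C * a i\<close>, so
  dropping \<open>a i\<close> shrinks the tail by the factor \<open>1 - 1 / (2 * C)\<close>.\<close>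

lemma energy_decay:
  fixes a :: "nat \<Rightarrow> real"
  assumes C: "C \<ge> 1"
    and sums: "\<And>i. i \<le> m \<Longrightarrow> (\<Sum>j=i..m. a j) \<le> C * (a i + a m)"
    and min: "\<And>i. i \<le> m \<Longrightarrow> a m \<le> a i"
  shows "a m \<le> 2 * C * (1 - 1 / (2 * C)) ^ m * a 0"
proof -
  define \<theta> where "\<theta> = 1 - 1 / (2 * C)"
  have \<theta>: "\<theta> \<ge> 0"
    using C by (simp add: \<theta>_def)
  define S where "S i = (\<Sum>j=i..m. a j)" for i
  have S_le: "S i \<le> 2 * C * a i" if "i \<le> m" for i
  proof -
    have "C * (a i + a m) \<le> C * (a i + a i)"
      using C min[OF that] by (intro mult_left_mono) auto
    then show ?thesis
      using sums[OF that] by (simp add: S_def)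
  qed
  have "S i \<le> \<theta> ^ i * S 0" if "i \<le> m" for i
    using that
  proof (induction i)
    case (Suc i)
    have "S i / (2 * C) \<le> a i"
      using S_le[of i] Suc.prems C by (simp add: field_simps)
    moreover have "S i = a i + S (Suc i)"
      unfolding S_def using Suc.prems by (simp add: sum.atLeast_Suc_atMost)
    ultimately have "S (Suc i) \<le> \<theta> * S i"
      by (simp add: \<theta>_def left_diff_distrib)
    also have "\<dots> \<le> \<theta> * (\<theta> ^ i * S 0)"
      using Suc \<theta> by (intro mult_left_mono) auto
    finally show ?case
      by simp
  qed simp
  from this[of m] have "a m \<le> \<theta> ^ m * S 0"
    by (simp add: S_def)
  also have "\<dots> \<le> \<theta> ^ m * (2 * C * a 0)"
    using \<theta> S_le[of 0] by (intro mult_left_mono) auto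
  finally show ?thesis
    by (simp add: \<theta>_def mult_ac)
qed

lemma argmin_atMost:
  fixes a :: "nat \<Rightarrow> real"
  obtains i where "i \<le> k" "\<And>j. j \<le> k \<Longrightarrow> a i \<le> a j"
  using arg_min_if_finite[of "{..k}" a] by (metis atMost_iff empty_iff finite_atMost not_le order_refl)

lemma funpow_shift: "(N ^^ j) ((N ^^ i) x) = (N ^^ (i + j)) x"
  by (simp add: funpow_add add.commute[of i j])

lemma energy_decay_orbit:
  assumes energy: "energy_bound N s C" and s: "s > 0" and C: "C \<ge> 1"
    and min: "\<And>i. i \<le> m \<Longrightarrow> norm ((N ^^ m) x) / s ^ m \<le> norm ((N ^^ i) x) / s ^ i"
  shows "(norm ((N ^^ m) x) / s ^ m)\<^sup>2 \<le> 2 * C * (1 - 1 / (2 * C)) ^ m * (norm x)\<^sup>2"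
proof -
  define a where "a j = (norm ((N ^^ j) x) / s ^ j)\<^sup>2" for j
  have "a m \<le> 2 * C * (1 - 1 / (2 * C)) ^ m * a 0"
  proof (rule energy_decay[OF C])
    fix i assume i: "i \<le> m"
    show "a m \<le> a i"
      unfolding a_def using s min[OF i] by (intro power_mono) auto
    have a_shift: "(norm ((N ^^ j) ((N ^^ i) x)) / s ^ j)\<^sup>2 = (s ^ i)\<^sup>2 * a (i + j)" for j
      using s by (simp add: a_def funpow_shift power_divide power_add power_mult_distrib field_simps)
    have "(\<Sum>j\<le>m - i. (s ^ i)\<^sup>2 * a (i + j)) \<le> C * ((s ^ i)\<^sup>2 * a (i + 0) + (s ^ i)\<^sup>2 * a (i + (m - i)))"
      using energy unfolding energy_bound_def a_shift[symmetric] by simp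
    then have "(s ^ i)\<^sup>2 * (\<Sum>j\<le>m - i. a (i + j)) \<le> (s ^ i)\<^sup>2 * (C * (a i + a m))"
      using i by (simp add: sum_distrib_left algebra_simps)
    then have "(\<Sum>j\<le>m - i. a (i + j)) \<le> C * (a i + a m)"
      using s by simp
    moreover have "(\<Sum>j=i..m. a j) = (\<Sum>j\<le>m - i. a (i + j))"
      using i sum.shift_bounds_cl_nat_ivl[of a 0 i "m - i"] by (simp add: atLeast0AtMost add.commute)
    ultimately show "(\<Sum>j=i..m. a j) \<le> C * (a i + a m)"
      by simp
  qed
  then show ?thesis
    by (simp add: a_def)
qed

text \<open>The time reversal of \<open>energy_decay_orbit\<close>: read backwards, a minimum at the
  start becomes a minimum at the end.\<close>

lemma energy_growth_orbit:
  assumes energy: "energy_bound N s C" and s: "s > 0" and C: "C \<ge> 1"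
    and min: "\<And>i. i \<le> m \<Longrightarrow> norm x \<le> norm ((N ^^ i) x) / s ^ i"
  shows "(norm x)\<^sup>2 \<le> 2 * C * (1 - 1 / (2 * C)) ^ m * (norm ((N ^^ m) x) / s ^ m)\<^sup>2"
proof -
  define a where "a j = (norm ((N ^^ (m - j)) x) / s ^ (m - j))\<^sup>2" for j
  have "a m \<le> 2 * C * (1 - 1 / (2 * C)) ^ m * a 0"
  proof (rule energy_decay[OF C])
    fix i assume i: "i \<le> m"
    show "a m \<le> a i"
      unfolding a_def using min[of "m - i"] by (intro power_mono) auto
    have "(\<Sum>j=i..m. a j) = (\<Sum>j\<le>m - i. (norm ((N ^^ j) x) / s ^ j)\<^sup>2)"
      unfolding a_def
      by (rule sum.reindex_bij_witness[of _ "\<lambda>j. m - j" "\<lambda>j. m - j"]) (use i in auto)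
    also have "\<dots> \<le> C * (a i + a m)"
      using energy unfolding energy_bound_def a_def by (simp add: add.commute)
    finally show "(\<Sum>j=i..m. a j) \<le> C * (a i + a m)" .
  qed
  then show ?thesis
    by (simp add: a_def)
qed

section \<open>Moving growth rates from one radius to another\<close>

lemma power_eventually_small:
  fixes q :: real
  assumes "0 \<le> q" "q < 1" "e > 0"
  obtains n0 where "\<And>n. n \<ge> n0 \<Longrightarrow> B * q ^ n < e"
proof -
  have "(\<lambda>n. B * q ^ n) \<longlonglongrightarrow> B * 0"
    using assms by (intro tendsto_intros LIMSEQ_realpow_zero) auto
  then have "\<forall>\<^sub>F n in sequentially. B * q ^ n < e"
    using assms(3) by (auto dest: order_tendstoD)
  then show ?thesis
    using that by (auto simp: eventually_sequentially)
qed

text \<open>Squared rescaled norms contract by \<open>1 - 1 / (2 * C)\<close> per step, while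
  comparing radii of ratio at most \<open>\<eta>\<close> costs \<open>\<eta>\<^sup>2\<close> per
  step; \<open>contract\<close> says that the contraction wins.\<close>

locale radius_step =
  fixes C \<eta> :: real
  assumes C: "C \<ge> 1" and \<eta>: "\<eta> > 1" and contract: "(1 - 1 / (2 * C)) * \<eta>\<^sup>2 < 1"
begin

lemma contract_nonneg: "(1 - 1 / (2 * C)) * \<eta>\<^sup>2 \<ge> 0"
  using C by (intro mult_nonneg_nonneg) auto

text \<open>
  An orbit whose rescaled norm is minimal at its end decays at a fixed rate, which a lower growth bound at
  a nearby radius allows only for a bounded time. Hence the minimum is attained early.
\<close>

lemma lower_growth_step:
  assumes energy: "energy_bound N s C"
    and rs: "0 < r" "r \<le> s" "s \<le> r * \<eta>"
    and K: "K > 0" "\<And>k x. K * r ^ k * norm x \<le> norm ((N ^^ k) x)"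
  obtains K' where "K' > 0" "\<And>k x. K' * s ^ k * norm x \<le> norm ((N ^^ k) x)"
proof -
  define q where "q = (1 - 1 / (2 * C)) * \<eta>\<^sup>2"
  obtain m0 where m0: "\<And>m. m \<ge> m0 \<Longrightarrow> 2 * C * q ^ m < K\<^sup>2"
    using power_eventually_small[of q "K\<^sup>2" "2 * C"] contract_nonneg contract K(1) by (auto simp: q_def)
  have s: "s > 0"
    using rs by linarith
  have orbit: "K / \<eta> ^ k * norm x \<le> norm ((N ^^ k) x) / s ^ k" for k x
  proof -
    have "s ^ k \<le> r ^ k * \<eta> ^ k"
      using rs s by (metis less_imp_le power_mono power_mult_distrib)
    then have "K * norm x * s ^ k \<le> K * norm x * (r ^ k * \<eta> ^ k)"
      using K(1) by (intro mult_left_mono) auto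
    also have "\<dots> \<le> norm ((N ^^ k) x) * \<eta> ^ k"
      using mult_right_mono[OF K(2)[of k x], of "\<eta> ^ k"] \<eta> by (simp add: mult_ac)
    finally show ?thesis
      using s \<eta> by (simp add: field_simps)
  qed
  have early: "m < m0"
    if "x \<noteq> 0" and min: "\<And>i. i \<le> m \<Longrightarrow> norm ((N ^^ m) x) / s ^ m \<le> norm ((N ^^ i) x) / s ^ i" for m x
  proof (rule ccontr)
    assume "\<not> m < m0"
    have "(K / \<eta> ^ m * norm x)\<^sup>2 \<le> (norm ((N ^^ m) x) / s ^ m)\<^sup>2"
      using K(1) \<eta> by (intro power_mono orbit) auto
    also have "\<dots> \<le> 2 * C * (1 - 1 / (2 * C)) ^ m * (norm x)\<^sup>2"
      by (rule energy_decay_orbit[OF energy s C min])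
    finally have "K\<^sup>2 / (\<eta> ^ m)\<^sup>2 * (norm x)\<^sup>2 \<le> 2 * C * (1 - 1 / (2 * C)) ^ m * (norm x)\<^sup>2"
      by (simp add: power_mult_distrib power_divide)
    then have "K\<^sup>2 / (\<eta> ^ m)\<^sup>2 \<le> 2 * C * (1 - 1 / (2 * C)) ^ m"
      by (rule mult_right_le_imp_le) (use \<open>x \<noteq> 0\<close> in simp)
    then have "K\<^sup>2 \<le> 2 * C * (1 - 1 / (2 * C)) ^ m * (\<eta> ^ m)\<^sup>2"
      using \<eta> by (simp add: pos_divide_le_eq)
    also have "\<dots> = 2 * C * q ^ m"
      by (simp add: q_def power_mult_distrib power_mult[symmetric] mult.commute)
    finally show False
      using m0[of m] \<open>\<not> m < m0\<close> by simp
  qed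
  \<comment> \<open>The rescaled orbit is smallest at some \<open>i < m0\<close>, where
    \<open>orbit\<close> has lost at most the factor \<open>\<eta> ^ m0\<close>; at \<open>k\<close>
    it is no smaller.\<close>
  have "K / \<eta> ^ m0 * s ^ k * norm x \<le> norm ((N ^^ k) x)" for k x
  proof (cases "x = 0")
    case False
    obtain i where i: "i \<le> k" "\<And>j. j \<le> k \<Longrightarrow> norm ((N ^^ i) x) / s ^ i \<le> norm ((N ^^ j) x) / s ^ j"
      using argmin_atMost[of k "\<lambda>j. norm ((N ^^ j) x) / s ^ j"] by blast
    then have "i < m0"
      using early[OF False, of i] by auto
    then have "K / \<eta> ^ m0 * norm x \<le> K / \<eta> ^ i * norm x"
      using K(1) \<eta> by (intro mult_right_mono divide_left_mono power_increasing) auto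
    also have "\<dots> \<le> norm ((N ^^ k) x) / s ^ k"
      using orbit[of i x] i(2)[of k] by simp
    finally show ?thesis
      using s by (simp add: pos_le_divide_eq mult_ac)
  qed simp
  then show ?thesis
    using that[of "K / \<eta> ^ m0"] K(1) \<eta> by simp
qed

text \<open>The mirror image: an orbit whose rescaled norm is minimal at its start grows at a fixed
  rate, which the upper bound at \<open>r\<close> allows only for a bounded time. So the minimum
  over \<open>0..k\<close> is attained fewer than \<open>m0\<close> steps before \<open>k\<close>,
  and up to there it is bounded by its initial value.\<close>

lemma upper_growth_step:
  assumes N: "bounded_clinear N" and energy: "energy_bound N s C"
    and rs: "0 < s" "s \<le> r" "r \<le> s * \<eta>"
    and K: "K > 0" "\<And>k x. norm ((N ^^ k) x) \<le> K * r ^ k * norm x"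
  obtains K' where "K' > 0" "\<And>k x. norm ((N ^^ k) x) \<le> K' * s ^ k * norm x"
proof -
  define q where "q = (1 - 1 / (2 * C)) * \<eta>\<^sup>2"
  obtain m0 where m0: "\<And>m. m \<ge> m0 \<Longrightarrow> 2 * C * K\<^sup>2 * q ^ m < 1"
    using power_eventually_small[of q 1 "2 * C * K\<^sup>2"] contract_nonneg contract by (auto simp: q_def)
  have orbit: "norm ((N ^^ k) x) / s ^ k \<le> K * \<eta> ^ k * norm x" for k x
  proof -
    have "r ^ k \<le> s ^ k * \<eta> ^ k"
      using rs by (metis less_imp_le power_mono power_mult_distrib order_trans)
    then have "K * norm x * r ^ k \<le> K * norm x * (s ^ k * \<eta> ^ k)"
      using K(1) by (intro mult_left_mono) auto
    then have "norm ((N ^^ k) x) \<le> K * norm x * (s ^ k * \<eta> ^ k)"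
      using K(2)[of k x] by (simp add: mult_ac)
    then show ?thesis
      using rs(1) by (simp add: field_simps)
  qed
  have late: "m < m0"
    if "x \<noteq> 0" and min: "\<And>i. i \<le> m \<Longrightarrow> norm x \<le> norm ((N ^^ i) x) / s ^ i" for m x
  proof (rule ccontr)
    assume "\<not> m < m0"
    have "(norm x)\<^sup>2 \<le> 2 * C * (1 - 1 / (2 * C)) ^ m * (norm ((N ^^ m) x) / s ^ m)\<^sup>2"
      by (rule energy_growth_orbit[OF energy rs(1) C min])
    also have "\<dots> \<le> 2 * C * (1 - 1 / (2 * C)) ^ m * (K * \<eta> ^ m * norm x)\<^sup>2"
      using C rs(1) by (intro mult_left_mono power_mono orbit) auto
    also have "\<dots> = 2 * C * K\<^sup>2 * q ^ m * (norm x)\<^sup>2"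
    proof -
      have "(\<eta> ^ m)\<^sup>2 = (\<eta>\<^sup>2) ^ m"
        by (simp add: power_mult[symmetric] mult.commute)
      then show ?thesis
        by (simp add: q_def power_mult_distrib)
    qed
    finally have "1 \<le> 2 * C * K\<^sup>2 * q ^ m"
      using \<open>x \<noteq> 0\<close> by simp
    then show False
      using m0[of m] \<open>\<not> m < m0\<close> by simp
  qed
  have "norm ((N ^^ k) x) \<le> K * \<eta> ^ m0 * s ^ k * norm x" for k x
  proof -
    obtain i where i: "i \<le> k" "\<And>j. j \<le> k \<Longrightarrow> norm ((N ^^ i) x) / s ^ i \<le> norm ((N ^^ j) x) / s ^ j"
      using argmin_atMost[of k "\<lambda>j. norm ((N ^^ j) x) / s ^ j"] by blast
    define y where "y = (N ^^ i) x"
    have k: "(N ^^ k) x = (N ^^ (k - i)) y"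
      using i(1) by (simp add: y_def funpow_shift)
    have y_le: "norm y \<le> s ^ i * norm x"
      using i(2)[of 0] rs(1) by (simp add: y_def field_simps)
    show ?thesis
    proof (cases "y = 0")
      case True
      then show ?thesis
        using K(1) \<eta> rs(1) by (simp add: k bounded_clinear_simps[OF bounded_clinear_funpow[OF N]])
    next
      case False
      have "norm y \<le> norm ((N ^^ j) y) / s ^ j" if "j \<le> k - i" for j
        using i(2)[of "i + j"] that i(1) rs(1)
        by (simp add: y_def funpow_shift power_add field_simps)
      then have "k - i < m0"
        using late[OF False] by blast
      then have "K * \<eta> ^ (k - i) * norm y \<le> K * \<eta> ^ m0 * (s ^ i * norm x)"
        using K(1) \<eta> y_le by (intro mult_mono mult_left_mono power_increasing) auto
      then have "norm ((N ^^ k) x) / s ^ (k - i) \<le> K * \<eta> ^ m0 * (s ^ i * norm x)"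
        using orbit[of "k - i" y] by (simp add: k)
      then have "norm ((N ^^ k) x) \<le> K * \<eta> ^ m0 * (s ^ i * norm x) * s ^ (k - i)"
        using rs(1) by (simp add: pos_divide_le_eq)
      moreover have "s ^ i * s ^ (k - i) = s ^ k"
        using i(1) by (simp add: power_add[symmetric])
      ultimately show ?thesis
        by (simp add: mult_ac)
    qed
  qed
  then show ?thesis
    using that[of "K * \<eta> ^ m0"] K(1) \<eta> by simp
qed

end

lemma radius_step_exists:
  assumes "C \<ge> (1 :: real)"
  obtains \<eta> where "radius_step C \<eta>"
proof -
  define \<theta> where "\<theta> = 1 - 1 / (2 * C)"
  have \<theta>: "0 < \<theta>" "\<theta> < 1"
    using assms by (auto simp: \<theta>_def field_simps)
  \<comment> \<open>The inverse fourth root leaves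
    \<open>\<theta> * \<eta>\<^sup>2 = sqrt \<theta>\<close>, still below \<open>1\<close>.\<close>
  define \<eta> where "\<eta> = 1 / sqrt (sqrt \<theta>)"
  have "\<eta> > 1"
    using \<theta> by (simp add: \<eta>_def)
  moreover have "\<theta> * \<eta>\<^sup>2 = sqrt \<theta>"
    using \<theta> by (simp add: \<eta>_def power_divide real_div_sqrt)
  ultimately have "radius_step C \<eta>"
    using \<theta> assms by unfold_locales (simp_all add: \<theta>_def)
  then show ?thesis
    by (rule that)
qed

text \<open>Continuation in the radius: the bound at \<open>\<mu> = 0\<close> gives the rate
  \<open>min c \<rho>\<close>, and each step multiplies the radius by \<open>\<eta>\<close>, capped
  at \<open>\<rho>\<close>. As \<open>c\<close> is uniform on the disk, \<open>C\<close> and hence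
  \<open>\<eta>\<close> stay fixed.\<close>

lemma lower_growth:
  assumes N: "bounded_clinear N" and c: "c > 0" and \<rho>: "\<rho> > 0"
    and below: "\<And>\<mu> x. cmod \<mu> \<le> \<rho> \<Longrightarrow> c * norm x \<le> norm (N x - \<mu> *\<^sub>C x)"
  obtains K where "K > 0" "\<And>k x. K * \<rho> ^ k * norm x \<le> norm ((N ^^ k) x)"
proof -
  define C where "C = 2 * \<rho>\<^sup>2 / c\<^sup>2 + 1"
  have "C \<ge> 1"
    by (simp add: C_def)
  then obtain \<eta> where "radius_step C \<eta>"
    using radius_step_exists by blast
  then interpret radius_step C \<eta> .
  have energy: "energy_bound N s C" if "0 < s" "s \<le> \<rho>" for s
  proof (rule energy_bound_circle[OF N that(1) c])
    show "2 * s\<^sup>2 / c\<^sup>2 + 1 \<le> C"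
      unfolding C_def using that by (intro add_right_mono divide_right_mono mult_left_mono power_mono) auto
  qed (use below that in auto)
  define r0 where "r0 = min c \<rho>"
  have r0: "r0 > 0" "r0 \<le> \<rho>"
    using c \<rho> by (auto simp: r0_def)
  have "\<exists>K>0. \<forall>k x. K * min \<rho> (r0 * \<eta> ^ n) ^ k * norm x \<le> norm ((N ^^ k) x)" for n
  proof (induction n)
    case 0
    have "r0 ^ k * norm x \<le> norm ((N ^^ k) x)" for k x
    proof (induction k)
      case (Suc k)
      have "r0 ^ Suc k * norm x \<le> r0 * norm ((N ^^ k) x)"
        using mult_left_mono[OF Suc] r0 by (simp add: mult_ac)
      also have "\<dots> \<le> c * norm ((N ^^ k) x)"
        by (intro mult_right_mono) (auto simp: r0_def)
      also have "\<dots> \<le> norm ((N ^^ Suc k) x)"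
        using below[of 0 "(N ^^ k) x"] \<rho> by (simp add: scaleC_zero_left)
      finally show ?case .
    qed simp
    then show ?case
      using r0 by (intro exI[of _ 1]) (simp add: min_absorb2)
  next
    case (Suc n)
    define r s where "r = min \<rho> (r0 * \<eta> ^ n)" and "s = min \<rho> (r0 * \<eta> ^ Suc n)"
    have "0 < r" "r \<le> s" "s \<le> r * \<eta>"
    proof -
      show "0 < r"
        using r0 \<rho> \<eta> by (simp add: r_def)
      have "r0 * \<eta> ^ n \<le> r0 * \<eta> ^ Suc n"
        using r0 \<eta> by (intro mult_left_mono power_increasing) auto
      then show "r \<le> s"
        by (auto simp: r_def s_def)
      have "\<rho> \<le> \<rho> * \<eta>"
        using \<rho> \<eta> by simp
      moreover have "s \<le> \<rho>" "s \<le> r0 * \<eta> ^ n * \<eta>"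
        by (auto simp: s_def min_le_iff_disj mult_ac)
      ultimately show "s \<le> r * \<eta>"
        by (auto simp: r_def min_def)
    qed
    moreover have "energy_bound N s C"
      using \<open>0 < r\<close> \<open>r \<le> s\<close> by (intro energy) (auto simp: s_def)
    ultimately show ?case
      using Suc.IH lower_growth_step[of N s r] unfolding r_def[symmetric] s_def[symmetric] by metis
  qed
  moreover obtain n where "\<rho> / r0 < \<eta> ^ n"
    using real_arch_pow[OF \<eta>] by blast
  then have "min \<rho> (r0 * \<eta> ^ n) = \<rho>"
    using r0 by (simp add: field_simps min_def)
  ultimately show ?thesis
    using that by metis
qed

text \<open>The continuation now runs inwards, starting at a radius \<open>R\<close> no smaller than
  the norm bound \<open>M\<close> of \<open>N\<close>; \<open>C\<close> is computed at
  \<open>R\<close>, the largest radius met.\<close>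

lemma upper_growth:
  assumes N: "bounded_clinear N" and c: "c > 0" and \<rho>: "\<rho> > 0"
    and below: "\<And>\<mu> x. \<rho> \<le> cmod \<mu> \<Longrightarrow> c * norm x \<le> norm (N x - \<mu> *\<^sub>C x)"
  obtains K where "K > 0" "\<And>k x. norm ((N ^^ k) x) \<le> K * \<rho> ^ k * norm x"
proof -
  obtain M where M: "M > 0" "\<And>x. norm (N x) \<le> M * norm x"
    using bounded_clinear_bound[OF N] by blast
  define R where "R = max \<rho> M"
  define C where "C = 2 * R\<^sup>2 / c\<^sup>2 + 1"
  have R: "R > 0" "\<rho> \<le> R"
    using \<rho> by (auto simp: R_def)
  have "C \<ge> 1"
    by (simp add: C_def)
  then obtain \<eta> where "radius_step C \<eta>"
    using radius_step_exists by blast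
  then interpret radius_step C \<eta> .
  have energy: "energy_bound N s C" if "\<rho> \<le> s" "s \<le> R" for s
  proof (rule energy_bound_circle[OF N _ c])
    show "2 * s\<^sup>2 / c\<^sup>2 + 1 \<le> C"
      unfolding C_def using that \<rho> by (intro add_right_mono divide_right_mono mult_left_mono power_mono) auto
  qed (use below that \<rho> in auto)
  have "\<exists>K>0. \<forall>k x. norm ((N ^^ k) x) \<le> K * max \<rho> (R / \<eta> ^ n) ^ k * norm x" for n
  proof (induction n)
    case 0
    have "norm ((N ^^ k) x) \<le> R ^ k * norm x" for k x
    proof (induction k)
      case (Suc k)
      have "norm ((N ^^ Suc k) x) \<le> M * norm ((N ^^ k) x)"
        by (simp add: M(2))
      also have "\<dots> \<le> R * (R ^ k * norm x)"
        using R Suc by (intro mult_mono) (auto simp: R_def)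
      finally show ?case
        by (simp add: mult_ac)
    qed simp
    then show ?case
      using R by (intro exI[of _ 1]) (simp add: max_absorb2)
  next
    case (Suc n)
    define r s where "r = max \<rho> (R / \<eta> ^ n)" and "s = max \<rho> (R / \<eta> ^ Suc n)"
    have "R / \<eta> ^ Suc n \<le> R / \<eta> ^ n"
      using R \<eta> by (intro divide_left_mono power_increasing) auto
    moreover have "R / \<eta> ^ Suc n \<le> R / 1"
      using R \<eta> one_le_power[of \<eta> "Suc n"] by (intro divide_left_mono) auto
    ultimately have "0 < s" "s \<le> r" "\<rho> \<le> s" "s \<le> R"
      using \<rho> R by (auto simp: r_def s_def)
    moreover have "r \<le> s * \<eta>"
    proof -
      have "\<rho> * 1 \<le> s * \<eta>"
        using \<eta> \<open>\<rho> \<le> s\<close> \<rho> by (intro mult_mono) auto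
      moreover have "R / \<eta> ^ n \<le> s * \<eta>"
      proof -
        have "R / \<eta> ^ n = R / \<eta> ^ Suc n * \<eta>"
          using \<eta> by simp
        also have "\<dots> \<le> s * \<eta>"
          using \<eta> by (intro mult_right_mono) (auto simp: s_def)
        finally show ?thesis .
      qed
      ultimately show ?thesis
        by (simp add: r_def)
    qed
    ultimately show ?case
      using Suc.IH upper_growth_step[OF N energy, of s r] unfolding r_def[symmetric] s_def[symmetric] by metis
  qed
  moreover obtain n where "R / \<rho> < \<eta> ^ n"
    using real_arch_pow[OF \<eta>] by blast
  then have "max \<rho> (R / \<eta> ^ n) = \<rho>"
    using \<rho> \<eta> by (simp add: field_simps max_def)
  ultimately show ?thesis
    using that by metis
qed

text \<open>The uniform bound survives, halved, on the larger disk of radius \<open>\<rho>'\<close>.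
  Growth at rate \<open>\<rho>'\<close> then beats the constant \<open>K\<close> once
  \<open>n\<close> is large.\<close>

lemma power_lower_bound:
  assumes T: "bounded_clinear T" and \<rho>: "\<rho> > 0"
    and ap: "approx_point_spectrum T \<inter> cball 0 \<rho> = {}"
  obtains n where "n > 0" "\<And>x. \<rho> ^ n * norm x \<le> norm ((T ^^ n) x)"
proof -
  obtain c where c: "c > 0" "\<And>z x. z \<in> cball 0 \<rho> \<Longrightarrow> c * norm x \<le> norm (T x - z *\<^sub>C x)"
    using uniform_lower_bound[OF T, of "cball 0 \<rho>"] ap by (auto simp: Int_commute)
  define \<rho>' where "\<rho>' = \<rho> + c / 2"
  have "c / 2 * norm x \<le> norm (T x - \<mu> *\<^sub>C x)" if \<mu>: "cmod \<mu> \<le> \<rho>'" for \<mu> x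
  proof -
    \<comment> \<open>\<open>w\<close> is the radial projection of \<open>\<mu>\<close> to the disk
      of radius \<open>\<rho>\<close>.\<close>
    obtain w where w: "cmod w \<le> \<rho>" "cmod (\<mu> - w) \<le> c / 2"
    proof (cases "cmod \<mu> \<le> \<rho>")
      case False
      then have "\<mu> \<noteq> 0"
        using \<rho> by (metis less_imp_le norm_zero)
      have "\<mu> - (\<rho> / cmod \<mu>) *\<^sub>R \<mu> = (1 - \<rho> / cmod \<mu>) *\<^sub>R \<mu>"
        by (simp add: scaleR_diff_left)
      then have "cmod (\<mu> - (\<rho> / cmod \<mu>) *\<^sub>R \<mu>) = \<bar>1 - \<rho> / cmod \<mu>\<bar> * cmod \<mu>"
        by (simp del: scaleR_conv_of_real)
      also have "\<dots> = cmod \<mu> - \<rho>"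
        using False \<rho> \<open>\<mu> \<noteq> 0\<close> by (simp add: abs_if field_simps)
      finally have "cmod (\<mu> - (\<rho> / cmod \<mu>) *\<^sub>R \<mu>) = cmod \<mu> - \<rho>" .
      then show ?thesis
        using False \<open>\<mu> \<noteq> 0\<close> \<rho> \<mu> by (intro that[of "(\<rho> / cmod \<mu>) *\<^sub>R \<mu>"]) (auto simp: \<rho>'_def)
    qed (use that[of \<mu>] c(1) in simp)
    have "c / 2 * norm x \<le> (c - cmod (\<mu> - w)) * norm x"
      using w(2) by (intro mult_right_mono) auto
    also have "\<dots> \<le> norm (T x - \<mu> *\<^sub>C x)"
      using w(1) by (intro shift_lower_bound c(2)) simp
    finally show ?thesis .
  qed
  moreover have "\<rho>' > \<rho>"
    using c(1) by (simp add: \<rho>'_def)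
  ultimately obtain K where K: "K > 0" "\<And>k x. K * \<rho>' ^ k * norm x \<le> norm ((T ^^ k) x)"
    using lower_growth[OF T, of "c / 2" \<rho>'] c(1) \<rho> by auto
  \<comment> \<open>The \<open>1\<close> in \<open>max\<close> excludes \<open>n = 0\<close>, for
    which the energy in \<open>orbit_similarity\<close> would be an empty sum.\<close>
  obtain n where n: "max 1 (1 / K) < (\<rho>' / \<rho>) ^ n"
    using real_arch_pow[of "\<rho>' / \<rho>" "max 1 (1 / K)"] \<open>\<rho>' > \<rho>\<close> \<rho>
    by (auto simp del: max_less_iff_conj)
  then have "n > 0"
    by (cases n) auto
  moreover have "\<rho> ^ n * norm x \<le> norm ((T ^^ n) x)" for x
  proof -
    have "1 \<le> K * (\<rho>' / \<rho>) ^ n"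
      using n K(1) by (simp add: pos_divide_less_eq mult.commute)
    then have "\<rho> ^ n \<le> K * \<rho>' ^ n"
      using \<rho> by (simp add: power_divide pos_le_divide_eq)
    then have "\<rho> ^ n * norm x \<le> K * \<rho>' ^ n * norm x"
      by (intro mult_right_mono) auto
    then show ?thesis
      using K(2)[of n x] by linarith
  qed
  ultimately show ?thesis
    using that by blast
qed

lemma power_upper_bound:
  assumes T: "bounded_clinear T" and \<rho>: "\<rho> > 0"
    and ap: "approx_point_spectrum T \<subseteq> ball 0 \<rho>"
  obtains n where "n > 0" "\<And>x. norm ((T ^^ n) x) \<le> \<rho> ^ n * norm x"
proof -
  have disj: "- ball 0 \<rho> \<inter> approx_point_spectrum T = {}"
    using ap by blast
  obtain c where c: "c > 0" "\<And>z x. z \<in> - ball 0 \<rho> \<Longrightarrow> c * norm x \<le> norm (T x - z *\<^sub>C x)"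
    using uniform_lower_bound[OF T _ disj] by auto
  \<comment> \<open>The alternative \<open>\<rho> / 2\<close> keeps the smaller radius positive when
    \<open>c\<close> is large.\<close>
  define \<rho>' where "\<rho>' = max (\<rho> / 2) (\<rho> - c / 2)"
  have \<rho>': "0 < \<rho>'" "\<rho>' < \<rho>"
    using \<rho> c(1) by (auto simp: \<rho>'_def)
  have "c / 2 * norm x \<le> norm (T x - \<mu> *\<^sub>C x)" if \<mu>: "\<rho>' \<le> cmod \<mu>" for \<mu> x
  proof -
    obtain w where w: "\<rho> \<le> cmod w" "cmod (\<mu> - w) \<le> c / 2"
    proof (cases "\<rho> \<le> cmod \<mu>")
      case False
      have "\<mu> \<noteq> 0"
        using \<mu> \<rho>' by auto
      have "\<mu> - (\<rho> / cmod \<mu>) *\<^sub>R \<mu> = (1 - \<rho> / cmod \<mu>) *\<^sub>R \<mu>"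
        by (simp add: scaleR_diff_left)
      then have "cmod (\<mu> - (\<rho> / cmod \<mu>) *\<^sub>R \<mu>) = \<bar>1 - \<rho> / cmod \<mu>\<bar> * cmod \<mu>"
        by (simp del: scaleR_conv_of_real)
      also have "\<dots> = \<rho> - cmod \<mu>"
        using False \<rho> \<open>\<mu> \<noteq> 0\<close> by (simp add: abs_if field_simps)
      finally have "cmod (\<mu> - (\<rho> / cmod \<mu>) *\<^sub>R \<mu>) = \<rho> - cmod \<mu>" .
      then show ?thesis
        using \<open>\<mu> \<noteq> 0\<close> \<rho> \<mu> by (intro that[of "(\<rho> / cmod \<mu>) *\<^sub>R \<mu>"]) (auto simp: \<rho>'_def)
    qed (use that[of \<mu>] c(1) in simp)
    have "c / 2 * norm x \<le> (c - cmod (\<mu> - w)) * norm x"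
      using w(2) by (intro mult_right_mono) auto
    also have "\<dots> \<le> norm (T x - \<mu> *\<^sub>C x)"
      using w(1) by (intro shift_lower_bound c(2)) simp
    finally show ?thesis .
  qed
  then obtain K where K: "K > 0" "\<And>k x. norm ((T ^^ k) x) \<le> K * \<rho>' ^ k * norm x"
    using upper_growth[OF T, of "c / 2" \<rho>'] c(1) \<rho>'(1) by auto
  obtain n where n: "max 1 K < (\<rho> / \<rho>') ^ n"
    using real_arch_pow[of "\<rho> / \<rho>'" "max 1 K"] \<rho>' by (auto simp del: max_less_iff_conj)
  then have "n > 0"
    by (cases n) auto
  moreover have "norm ((T ^^ n) x) \<le> \<rho> ^ n * norm x" for x
  proof -
    have "K * \<rho>' ^ n \<le> \<rho> ^ n"
      using n \<rho>' by (simp add: power_divide pos_less_divide_eq)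
    then have "K * \<rho>' ^ n * norm x \<le> \<rho> ^ n * norm x"
      by (intro mult_right_mono) auto
    then show ?thesis
      using K(2)[of n x] by linarith
  qed
  ultimately show ?thesis
    using that by blast
qed

section \<open>Separation by disks centred on the real axis\<close>

text \<open>
  Under \<open>bk\<close>, lines in the plane correspond to circles centred on the real axis and to vertical lines.
  The separating line can be moved slightly, so that the latter are not needed.
\<close>

lemma separating_disk:
  assumes K: "compact K" and p: "bk p \<notin> convex hull (bk ` K)"
  obtains (inside) t \<rho> where "\<rho> > 0" "cmod (p - complex_of_real t) < \<rho>"
      "\<And>z. z \<in> K \<Longrightarrow> \<rho> < cmod (z - complex_of_real t)"
    | (outside) t \<rho> where "\<rho> > 0" "\<rho> < cmod (p - complex_of_real t)"
      "\<And>z. z \<in> K \<Longrightarrow> cmod (z - complex_of_real t) < \<rho>"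
\<comment> \<open>In the zero space \<open>K\<close> can be empty. Below, a point of
  \<open>K\<close> is what makes \<open>R\<close> positive in the outside case.\<close>
proof (cases "K = {}")
  case True
  then show ?thesis
    using inside[of "cmod p + 1" 0] by (simp add: add_nonneg_pos)
next
  case False
  have "compact (convex hull (bk ` K))"
    by (intro compact_convex_hull compact_continuous_image continuous_on_bk K)
  then obtain a b where ab: "a \<bullet> bk p < b" "\<And>x. x \<in> convex hull (bk ` K) \<Longrightarrow> b < a \<bullet> x"
    using separating_hyperplane_closed_point[OF convex_convex_hull compact_imp_closed p] by metis
  \<comment> \<open>As \<open>a \<bullet> 1 = Re a\<close>, the case \<open>b = Re a\<close> is that
    of a line through the point \<open>1\<close> omitted by \<open>bk\<close>, which would
    correspond to a vertical line.\<close>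
  define b' where "b' = (if b = Re a then (a \<bullet> bk p + b) / 2 else b)"
  have b': "a \<bullet> bk p < b'" "b' \<noteq> Re a" "b' \<le> b"
    using ab(1) by (auto simp: b'_def)
  have K_gt: "b' < a \<bullet> bk z" if "z \<in> K" for z
    using ab(2)[of "bk z"] hull_subset[of "bk ` K" convex] that b'(3) by fastforce
  define \<alpha> where "\<alpha> = Re a - b'"
  define t where "t = Im a / \<alpha>"
  define R where "R = t\<^sup>2 + (Re a + b') / \<alpha>"
  have \<alpha>: "\<alpha> \<noteq> 0"
    using b'(2) by (simp add: \<alpha>_def)
  have pos: "1 + (cmod z)\<^sup>2 > 0" for z
    by (simp add: add_pos_nonneg)
  \<comment> \<open>Clearing the denominator turns the affine functional into the equation of a
    circle with centre \<open>t\<close> and squared radius \<open>R\<close>; the sign of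
    \<open>\<alpha>\<close> decides which side contains \<open>p\<close>.\<close>
  have form: "(a \<bullet> bk z - b') * (1 + (cmod z)\<^sup>2) = \<alpha> * ((cmod (z - complex_of_real t))\<^sup>2 - R)" for z
  proof -
    have "a \<bullet> bk z = (Re a * ((cmod z)\<^sup>2 - 1) - 2 * Im a * Re z) / (1 + (cmod z)\<^sup>2)"
      unfolding bk_eq inner_complex_def by (simp add: diff_divide_distrib add_divide_distrib algebra_simps)
    then have "(a \<bullet> bk z) * (1 + (cmod z)\<^sup>2) = Re a * ((cmod z)\<^sup>2 - 1) - 2 * Im a * Re z"
      using pos[of z] by simp
    then have "(a \<bullet> bk z - b') * (1 + (cmod z)\<^sup>2) = \<alpha> * (cmod z)\<^sup>2 - 2 * Im a * Re z - (Re a + b')"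
      by (simp add: \<alpha>_def algebra_simps)
    also have "Im a = \<alpha> * t"
      using \<alpha> by (simp add: t_def)
    also have "Re a + b' = \<alpha> * R - \<alpha> * t\<^sup>2"
      unfolding R_def distrib_left using \<alpha> by simp
    also have "\<alpha> * (cmod z)\<^sup>2 - 2 * (\<alpha> * t) * Re z - (\<alpha> * R - \<alpha> * t\<^sup>2)
        = \<alpha> * ((cmod z)\<^sup>2 - 2 * t * Re z + t\<^sup>2 - R)"
      by (simp add: algebra_simps)
    also have "(cmod z)\<^sup>2 - 2 * t * Re z + t\<^sup>2 = (cmod (z - complex_of_real t))\<^sup>2"
      by (simp add: cmod_power2 power2_diff)
    finally show ?thesis .
  qed
  have p_neg: "\<alpha> * ((cmod (p - complex_of_real t))\<^sup>2 - R) < 0"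
    using b'(1) pos[of p] unfolding form[symmetric] by (simp add: mult_neg_pos)
  have K_pos: "\<alpha> * ((cmod (z - complex_of_real t))\<^sup>2 - R) > 0" if "z \<in> K" for z
    using K_gt[OF that] pos[of z] unfolding form[symmetric] by simp
  show ?thesis
  proof (cases "\<alpha> > 0")
    case True
    then have "(cmod (p - complex_of_real t))\<^sup>2 < R" "\<And>z. z \<in> K \<Longrightarrow> R < (cmod (z - complex_of_real t))\<^sup>2"
      using p_neg K_pos by (auto simp: mult_less_0_iff zero_less_mult_iff)
    moreover from this(1) have "R > 0"
      by (meson le_less_trans zero_le_power2)
    ultimately show ?thesis
      by (intro inside[of "sqrt R" t]) (auto intro: real_less_rsqrt real_less_lsqrt)
  next
    case False
    then have *: "R < (cmod (p - complex_of_real t))\<^sup>2" "\<And>z. z \<in> K \<Longrightarrow> (cmod (z - complex_of_real t))\<^sup>2 < R"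
      using p_neg K_pos by (auto simp: mult_less_0_iff zero_less_mult_iff)
    moreover have "R > 0"
      using *(2) \<open>K \<noteq> {}\<close> by (meson ex_in_conv le_less_trans zero_le_power2)
    ultimately show ?thesis
      by (intro outside[of "sqrt R" t]) (auto intro: real_less_rsqrt real_less_lsqrt)
  qed
qed

section \<open>Norm inequalities that describe the closed graph\<close>

lemma norm_shift_SRG:
  assumes "cmod z = norm (T x)" "Re z = T x \<bullet> x" "norm x = 1"
  shows "norm (T x - complex_of_real t *\<^sub>C x) = cmod (z - complex_of_real t)"
proof -
  have "(norm (T x - complex_of_real t *\<^sub>C x))\<^sup>2 = (norm (T x))\<^sup>2 - 2 * t * (T x \<bullet> x) + t\<^sup>2 * (norm x)\<^sup>2"
    unfolding scaleC_of_real power2_norm_eq_inner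
    by (simp add: inner_diff_left inner_diff_right inner_commute power2_eq_square)
  also have "\<dots> = (cmod z)\<^sup>2 - 2 * t * Re z + t\<^sup>2"
    using assms by simp
  also have "\<dots> = (cmod (z - complex_of_real t))\<^sup>2"
    by (simp add: cmod_power2 power2_diff)
  finally show ?thesis
    by simp
qed

lemma closure_SRG_ge:
  assumes "\<And>x. \<rho> * norm x \<le> norm (T x - complex_of_real t *\<^sub>C x)" "z \<in> closure (SRG T)"
  shows "\<rho> \<le> cmod (z - complex_of_real t)"
proof -
  have "SRG T \<subseteq> {z. \<rho> \<le> cmod (z - complex_of_real t)}"
  proof
    fix z assume "z \<in> SRG T"
    then obtain x where "norm x = 1" "cmod z = norm (T x)" "Re z = T x \<bullet> x"
      by (auto simp: SRG_iff_unit)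
    then show "z \<in> {z. \<rho> \<le> cmod (z - complex_of_real t)}"
      using assms(1)[of x] norm_shift_SRG[of z T x t] by simp
  qed
  moreover have "closed {z. \<rho> \<le> cmod (z - complex_of_real t)}"
    by (intro closed_Collect_le continuous_intros)
  ultimately show ?thesis
    using assms(2) closure_minimal by blast
qed

lemma closure_SRG_le:
  assumes "\<And>x. norm (T x - complex_of_real t *\<^sub>C x) \<le> \<rho> * norm x" "z \<in> closure (SRG T)"
  shows "cmod (z - complex_of_real t) \<le> \<rho>"
proof -
  have "SRG T \<subseteq> {z. cmod (z - complex_of_real t) \<le> \<rho>}"
  proof
    fix z assume "z \<in> SRG T"
    then obtain x where "norm x = 1" "cmod z = norm (T x)" "Re z = T x \<bullet> x"
      by (auto simp: SRG_iff_unit)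
    then show "z \<in> {z. cmod (z - complex_of_real t) \<le> \<rho>}"
      using assms(1)[of x] norm_shift_SRG[of z T x t] by simp
  qed
  moreover have "closed {z. cmod (z - complex_of_real t) \<le> \<rho>}"
    by (intro closed_Collect_le continuous_intros)
  ultimately show ?thesis
    using assms(2) closure_minimal by blast
qed

lemma norm_shift_SRG_exists:
  assumes T: "bounded_clinear T" and "x \<noteq> 0"
  obtains z where "z \<in> SRG T" "norm (T x - complex_of_real t *\<^sub>C x) = cmod (z - complex_of_real t) * norm x"
proof -
  obtain z where z: "z \<in> SRG T" "cmod z * norm x = norm (T x)" "Re z * (norm x)\<^sup>2 = T x \<bullet> x"
    using SRG_exists[OF assms] by blast
  define u where "u = (1 / norm x) *\<^sub>R x"
  have u: "norm u = 1" "cmod z = norm (T u)" "Re z = T u \<bullet> u"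
    using \<open>x \<noteq> 0\<close> z(2,3)
    by (simp_all add: u_def bounded_clinear_simps[OF T] field_simps power2_eq_square)
  have "T x - complex_of_real t *\<^sub>C x = norm x *\<^sub>R (T u - complex_of_real t *\<^sub>C u)"
    using \<open>x \<noteq> 0\<close> by (simp add: u_def bounded_clinear_simps[OF T] scaleC_of_real scaleR_diff_right)
  then show ?thesis
    using that z(1) norm_shift_SRG[of z T u t, OF u(2,3,1)] by simp
qed

text \<open>A converse to \<open>closure_SRG_ge\<close> and \<open>closure_SRG_le\<close>: as the
  closed graph is its own \<open>co_BK\<close>, a separating circle exists for every excluded
  point.\<close>

lemma not_in_closure_SRG:
  assumes T: "bounded_clinear T" and p: "p \<notin> closure (SRG T)"
  obtains (inside) t \<rho> where "\<rho> > 0" "cmod (p - complex_of_real t) < \<rho>"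
      "\<And>x. \<rho> * norm x \<le> norm (T x - complex_of_real t *\<^sub>C x)"
    | (outside) t \<rho> where "\<rho> > 0" "\<rho> < cmod (p - complex_of_real t)"
      "\<And>x. norm (T x - complex_of_real t *\<^sub>C x) \<le> \<rho> * norm x"
proof -
  have "bk p \<notin> convex hull (bk ` closure (SRG T))"
    using p in_co_BK[of p "closure (SRG T)"] co_BK_SRG(2)[OF T] by blast
  with compact_closure_SRG[OF T] show ?thesis
  proof (cases rule: separating_disk)
    case (inside t \<rho>)
    have "\<rho> * norm x \<le> norm (T x - complex_of_real t *\<^sub>C x)" for x
    proof (cases "x = 0")
      case False
      then obtain z where z: "z \<in> SRG T" "norm (T x - complex_of_real t *\<^sub>C x) = cmod (z - complex_of_real t) * norm x"
        using norm_shift_SRG_exists[OF T] by blast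
      have "\<rho> < cmod (z - complex_of_real t)"
        using z(1) inside(3) closure_subset by blast
      then show ?thesis
        by (simp add: z(2) mult_right_mono)
    qed simp
    then show ?thesis
      using that(1) inside(1,2) by blast
  next
    case (outside t \<rho>)
    have "norm (T x - complex_of_real t *\<^sub>C x) \<le> \<rho> * norm x" for x
    proof (cases "x = 0")
      case False
      then obtain z where z: "z \<in> SRG T" "norm (T x - complex_of_real t *\<^sub>C x) = cmod (z - complex_of_real t) * norm x"
        using norm_shift_SRG_exists[OF T] by blast
      have "cmod (z - complex_of_real t) < \<rho>"
        using z(1) outside(3) closure_subset by blast
      then show ?thesis
        by (simp add: z(2) mult_right_mono)
    qed (simp add: bounded_clinear_simps[OF T] scaleC_zero_right)
    then show ?thesis
      using that(2) outside(1,2) by blast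
  qed
qed

text \<open>For a point off the closed graph, the gap between \<open>\<rho>\<close> and its distance
  from \<open>t\<close> is a lower bound for \<open>T - z\<close>.\<close>

lemma approx_point_spectrum_subset_closure_SRG:
  assumes T: "bounded_clinear T"
  shows "approx_point_spectrum T \<subseteq> closure (SRG T)"
proof
  fix z assume z: "z \<in> approx_point_spectrum T"
  show "z \<in> closure (SRG T)"
  proof (rule ccontr)
    assume "z \<notin> closure (SRG T)"
    with T have "bounded_below (\<lambda>x. T x - z *\<^sub>C x)"
    proof (cases rule: not_in_closure_SRG)
      case (inside t \<rho>)
      have "(\<rho> - cmod (z - complex_of_real t)) * norm x \<le> norm (T x - z *\<^sub>C x)" for x
        by (rule shift_lower_bound[OF inside(3)])
      then show ?thesis
        unfolding bounded_below_def using inside(2) by (intro exI[of _ "\<rho> - cmod (z - complex_of_real t)"]) simp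
    next
      case (outside t \<rho>)
      have "(cmod (z - complex_of_real t) - \<rho>) * norm x \<le> norm (T x - z *\<^sub>C x)" for x
        using shift_lower_bound_far[of "\<lambda>x. T x - complex_of_real t *\<^sub>C x" x \<rho> "z - complex_of_real t", OF outside(3)] by (simp add: scaleC_diff_left)
      then show ?thesis
        unfolding bounded_below_def using outside(2) by (intro exI[of _ "cmod (z - complex_of_real t) - \<rho>"]) simp
    qed
    then show False
      using z not_in_approx_point_spectrum_iff[OF T] by blast
  qed
qed

lemma co_BK_approx_point_spectrum_subset:
  assumes "bounded_clinear T"
  shows "co_BK (approx_point_spectrum T) \<subseteq> closure (SRG T)"
  using co_BK_mono[OF approx_point_spectrum_subset_closure_SRG[OF assms]] co_BK_SRG(2)[OF assms] by blast

section \<open>Similarity\<close>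

text \<open>
  With \<open>\<parallel>S x\<parallel>\<^sup>2 = \<Sum>k<n. \<rho>\<^bsup>-2k\<^esup> \<parallel>N\<^sup>k x\<parallel>\<^sup>2\<close>, the sum for \<open>N x\<close> is a shifted and rescaled copy of the sum
  for \<open>x\<close>, so that only the two end terms of the orbit remain.
\<close>

lemma orbit_similarity:
  assumes N: "bounded_clinear N" and \<rho>: "\<rho> > 0" and n: "n > 0"
  obtains S where "bij S" "bounded_clinear S" "bounded_clinear (inv S)"
    "\<And>x. (norm (S (N x)))\<^sup>2 = \<rho>\<^sup>2 * ((norm (S x))\<^sup>2 - (norm x)\<^sup>2 + (norm ((N ^^ n) x) / \<rho> ^ n)\<^sup>2)"
    "\<And>Z x. bounded_clinear Z \<Longrightarrow> (\<And>y. N (Z y) = Z (N y)) \<Longrightarrow> (\<And>y. N (cadjoint Z y) = cadjoint Z (N y))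
      \<Longrightarrow> Z (S x) = S (Z x)"
proof -
  define Q where "Q = (\<lambda>x. \<Sum>k<n. ((1 / \<rho> ^ k)\<^sup>2) *\<^sub>R cadjoint (N ^^ k) ((N ^^ k) x))"
  note Nk = bounded_clinear_funpow[OF N]
  have Q: "bounded_clinear Q"
    unfolding Q_def
    by (intro bounded_clinear_sum bounded_clinear_scaleR bounded_clinear_comp[OF bounded_clinear_cadjoint[OF Nk] Nk])
  have Q_form: "Q x \<bullet> y = (\<Sum>k<n. (1 / \<rho> ^ k)\<^sup>2 * ((N ^^ k) x \<bullet> (N ^^ k) y))" for x y
    by (simp add: Q_def inner_sum_left inner_cadjoint_left[OF Nk])
  have Q_self: "Q x \<bullet> x = (\<Sum>k<n. (norm ((N ^^ k) x) / \<rho> ^ k)\<^sup>2)" for x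
    unfolding Q_form by (simp add: power_divide power2_norm_eq_inner)
  interpret positive_definite Q 1
  proof
    show "Q x \<bullet> y = x \<bullet> Q y" for x y
      unfolding inner_commute[of x] Q_form by (simp add: inner_commute)
    \<comment> \<open>The term \<open>k = 0\<close>, present since \<open>n > 0\<close>, already
      contributes the identity.\<close>
    show "1 * (norm x)\<^sup>2 \<le> Q x \<bullet> x" for x
      unfolding Q_self using member_le_sum[of 0 "{..<n}" "\<lambda>k. (norm ((N ^^ k) x) / \<rho> ^ k)\<^sup>2"] n by simp
  qed (use Q in simp_all)
  have "(norm (sqrt_op Q (N x)))\<^sup>2 = \<rho>\<^sup>2 * ((norm (sqrt_op Q x))\<^sup>2 - (norm x)\<^sup>2 + (norm ((N ^^ n) x) / \<rho> ^ n)\<^sup>2)" for x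
  proof -
    define a where "a k = (norm ((N ^^ k) x) / \<rho> ^ k)\<^sup>2" for k
    have "(norm ((N ^^ k) (N x)) / \<rho> ^ k)\<^sup>2 = \<rho>\<^sup>2 * a (Suc k)" for k
      using \<rho> funpow_swap1[of N k x] by (simp add: a_def power_divide power_mult_distrib)
    then have "(norm (sqrt_op Q (N x)))\<^sup>2 = \<rho>\<^sup>2 * (\<Sum>k<n. a (Suc k))"
      unfolding norm_sqrt_op Q_self by (simp add: sum_distrib_left)
    also have "(\<Sum>k<n. a (Suc k)) = (\<Sum>k<n. a k) - a 0 + a n"
      using sum.lessThan_Suc_shift[of a n] by (simp add: algebra_simps)
    finally show ?thesis
      unfolding norm_sqrt_op Q_self by (simp add: a_def)
  qed
  moreover have "Z (sqrt_op Q x) = sqrt_op Q (Z x)"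
    if Z: "bounded_clinear Z" and comm: "\<And>y. N (Z y) = Z (N y)" "\<And>y. N (cadjoint Z y) = cadjoint Z (N y)" for Z x
  proof (rule sqrt_op_properties(5)[OF bounded_clinear_linear[OF Z]])
    fix y
    have pow: "(N ^^ k) (Z y) = Z ((N ^^ k) y)" "(N ^^ k) (cadjoint Z y) = cadjoint Z ((N ^^ k) y)" for k y
      by (induction k) (simp_all add: comm)
    \<comment> \<open>Passing to adjoints in the commutation of \<open>cadjoint Z\<close> with
      \<open>N ^^ k\<close>; this is where the second commutation hypothesis enters.\<close>
    have "Z (cadjoint (N ^^ k) y) = cadjoint (N ^^ k) (Z y)" for k y
      by (rule inner_eqI)
        (metis inner_cadjoint[OF Nk] inner_cadjoint_left[OF Z] pow(2))
    then show "Z (Q y) = Q (Z y)"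
      unfolding Q_def
      by (simp add: linear_sum[OF bounded_linear.linear[OF bounded_clinear_linear[OF Z]]]
          bounded_clinear_simps[OF Z] pow(1))
  qed
  ultimately show ?thesis
    using that[of "sqrt_op Q"] inv_sqrt_op(1,2) sqrt_op_properties(1) by blast
qed

lemma approx_point_spectrum_shift:
  assumes T: "bounded_clinear T"
  shows "z \<in> approx_point_spectrum (\<lambda>x. T x - w *\<^sub>C x) \<longleftrightarrow> z + w \<in> approx_point_spectrum T"
  using not_in_approx_point_spectrum_iff[OF T, of "z + w"]
    not_in_approx_point_spectrum_iff[OF bounded_clinear_shift[OF T], of z w]
  by (simp add: scaleC_add_left diff_diff_eq add.commute) blast

text \<open>For normal \<open>T\<close>, both \<open>T\<close> and \<open>cadjoint T\<close> commute
  with \<open>N\<close>. With \<open>Z = T\<close> in \<open>orbit_similarity\<close>, the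
  similarity that separates \<open>p\<close> leaves \<open>T\<close> unchanged, so \<open>p\<close>
  is off the closed graph of \<open>T\<close> itself.\<close>

lemma separating_similarity:
  assumes T: "bounded_clinear T" and p: "bk p \<notin> convex hull (bk ` approx_point_spectrum T)"
  obtains S where "bij S" "bounded_clinear S" "bounded_clinear (inv S)"
    "p \<notin> closure (SRG (S \<circ> T \<circ> inv S))"
    "T \<circ> cadjoint T = cadjoint T \<circ> T \<Longrightarrow> S \<circ> T \<circ> inv S = T"
proof -
  have comm: "T (T y) - complex_of_real t *\<^sub>C T y = T (T y - complex_of_real t *\<^sub>C y)"
    "T (cadjoint T y) - complex_of_real t *\<^sub>C cadjoint T y = cadjoint T (T y - complex_of_real t *\<^sub>C y)"
    if "T \<circ> cadjoint T = cadjoint T \<circ> T" for t y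
    using fun_cong[OF that, of y]
    by (simp_all add: bounded_clinear_simps[OF T] bounded_clinear_simps[OF bounded_clinear_cadjoint[OF T]])
  from compact_approx_point_spectrum[OF T] p show ?thesis
  proof (cases rule: separating_disk)
    case (inside t \<rho>)
    define N where "N = (\<lambda>x. T x - complex_of_real t *\<^sub>C x)"
    have N: "bounded_clinear N"
      unfolding N_def by (rule bounded_clinear_shift[OF T])
    have "approx_point_spectrum N \<inter> cball 0 \<rho> = {}"
      using inside(3) unfolding N_def by (force simp: approx_point_spectrum_shift[OF T])
    then obtain n where n: "n > 0" "\<And>x. \<rho> ^ n * norm x \<le> norm ((N ^^ n) x)"
      using power_lower_bound[OF N inside(1)] by blast
    obtain S where S: "bij S" "bounded_clinear S" "bounded_clinear (inv S)"
      "\<And>x. (norm (S (N x)))\<^sup>2 = \<rho>\<^sup>2 * ((norm (S x))\<^sup>2 - (norm x)\<^sup>2 + (norm ((N ^^ n) x) / \<rho> ^ n)\<^sup>2)"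
      "\<And>Z x. bounded_clinear Z \<Longrightarrow> (\<And>y. N (Z y) = Z (N y)) \<Longrightarrow> (\<And>y. N (cadjoint Z y) = cadjoint Z (N y))
        \<Longrightarrow> Z (S x) = S (Z x)"
      using orbit_similarity[OF N inside(1) n(1)] by blast
    have "\<rho> * norm y \<le> norm ((S \<circ> T \<circ> inv S) y - complex_of_real t *\<^sub>C y)" for y
    proof -
      define x where "x = inv S y"
      have y: "y = S x"
        using S(1) by (simp add: x_def surj_f_inv_f bij_is_surj)
      \<comment> \<open>The two end terms of the orbit thus have a nonnegative balance, so
        \<open>N\<close> expands by \<open>\<rho>\<close> in the norm given by
        \<open>S\<close>.\<close>
      have "norm x \<le> norm ((N ^^ n) x) / \<rho> ^ n"
        using n(2)[of x] inside(1) by (simp add: pos_le_divide_eq mult.commute)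
      then have "(norm x)\<^sup>2 \<le> (norm ((N ^^ n) x) / \<rho> ^ n)\<^sup>2"
        by (intro power_mono) auto
      then have "\<rho>\<^sup>2 * (norm (S x))\<^sup>2 \<le> (norm (S (N x)))\<^sup>2"
        unfolding S(4) by (intro mult_left_mono) auto
      then have "(\<rho> * norm (S x))\<^sup>2 \<le> (norm (S (N x)))\<^sup>2"
        by (simp add: power_mult_distrib)
      then have "\<rho> * norm (S x) \<le> norm (S (N x))"
        by (rule power2_le_imp_le) simp
      moreover have "S (N x) = (S \<circ> T \<circ> inv S) y - complex_of_real t *\<^sub>C y"
        by (simp add: N_def bounded_clinear_simps[OF S(2)] x_def[symmetric] y[symmetric])
      ultimately show ?thesis
        by (simp add: y)
    qed
    then have "p \<notin> closure (SRG (S \<circ> T \<circ> inv S))"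
      using closure_SRG_ge[of \<rho> "S \<circ> T \<circ> inv S" t p] inside(2) by auto
    moreover have "S \<circ> T \<circ> inv S = T" if "T \<circ> cadjoint T = cadjoint T \<circ> T"
    proof
      fix y
      have "T (S (inv S y)) = S (T (inv S y))"
        by (rule S(5)[OF T]) (simp_all only: N_def comm[OF that])
      then show "(S \<circ> T \<circ> inv S) y = T y"
        using S(1) by (simp add: surj_f_inv_f bij_is_surj)
    qed
    ultimately show ?thesis
      using that S(1-3) by blast
  next
    case (outside t \<rho>)
    define N where "N = (\<lambda>x. T x - complex_of_real t *\<^sub>C x)"
    have N: "bounded_clinear N"
      unfolding N_def by (rule bounded_clinear_shift[OF T])
    have "approx_point_spectrum N \<subseteq> ball 0 \<rho>"
      using outside(3) unfolding N_def by (force simp: approx_point_spectrum_shift[OF T])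
    then obtain n where n: "n > 0" "\<And>x. norm ((N ^^ n) x) \<le> \<rho> ^ n * norm x"
      using power_upper_bound[OF N outside(1)] by blast
    obtain S where S: "bij S" "bounded_clinear S" "bounded_clinear (inv S)"
      "\<And>x. (norm (S (N x)))\<^sup>2 = \<rho>\<^sup>2 * ((norm (S x))\<^sup>2 - (norm x)\<^sup>2 + (norm ((N ^^ n) x) / \<rho> ^ n)\<^sup>2)"
      "\<And>Z x. bounded_clinear Z \<Longrightarrow> (\<And>y. N (Z y) = Z (N y)) \<Longrightarrow> (\<And>y. N (cadjoint Z y) = cadjoint Z (N y))
        \<Longrightarrow> Z (S x) = S (Z x)"
      using orbit_similarity[OF N outside(1) n(1)] by blast
    have "norm ((S \<circ> T \<circ> inv S) y - complex_of_real t *\<^sub>C y) \<le> \<rho> * norm y" for y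
    proof -
      define x where "x = inv S y"
      have y: "y = S x"
        using S(1) by (simp add: x_def surj_f_inv_f bij_is_surj)
      have "norm ((N ^^ n) x) / \<rho> ^ n \<le> norm x"
        using n(2)[of x] outside(1) by (simp add: pos_divide_le_eq mult.commute)
      then have "(norm ((N ^^ n) x) / \<rho> ^ n)\<^sup>2 \<le> (norm x)\<^sup>2"
        using outside(1) by (intro power_mono) auto
      then have "(norm (S (N x)))\<^sup>2 \<le> \<rho>\<^sup>2 * (norm (S x))\<^sup>2"
        unfolding S(4) by (intro mult_left_mono) auto
      then have "(norm (S (N x)))\<^sup>2 \<le> (\<rho> * norm (S x))\<^sup>2"
        by (simp add: power_mult_distrib)
      then have "norm (S (N x)) \<le> \<rho> * norm (S x)"
        by (rule power2_le_imp_le) (use outside(1) in simp)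
      moreover have "S (N x) = (S \<circ> T \<circ> inv S) y - complex_of_real t *\<^sub>C y"
        by (simp add: N_def bounded_clinear_simps[OF S(2)] x_def[symmetric] y[symmetric])
      ultimately show ?thesis
        by (simp add: y)
    qed
    then have "p \<notin> closure (SRG (S \<circ> T \<circ> inv S))"
      using closure_SRG_le[of "S \<circ> T \<circ> inv S" t \<rho> p] outside(2) by auto
    moreover have "S \<circ> T \<circ> inv S = T" if "T \<circ> cadjoint T = cadjoint T \<circ> T"
    proof
      fix y
      have "T (S (inv S y)) = S (T (inv S y))"
        by (rule S(5)[OF T]) (simp_all only: N_def comm[OF that])
      then show "(S \<circ> T \<circ> inv S) y = T y"
        using S(1) by (simp add: surj_f_inv_f bij_is_surj)
    qed
    ultimately show ?thesis
      using that S(1-3) by blast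
  qed
qed

section \<open>Intersection over similarities and the normal case\<close>

lemma bounded_clinear_similar:
  assumes "bounded_clinear T" "bounded_clinear S" "bounded_clinear (inv S)"
  shows "bounded_clinear (S \<circ> T \<circ> inv S)"
  using bounded_clinear_comp[OF bounded_clinear_comp[OF assms(2,1)] assms(3)] by (simp add: comp_def)

lemma approx_point_spectrum_similar:
  assumes T: "bounded_clinear T" and S: "bij S" "bounded_clinear S" "bounded_clinear (inv S)"
  shows "approx_point_spectrum T \<subseteq> approx_point_spectrum (S \<circ> T \<circ> inv S)"
proof
  fix z assume z: "z \<in> approx_point_spectrum T"
  show "z \<in> approx_point_spectrum (S \<circ> T \<circ> inv S)"
  proof (rule ccontr)
    assume "z \<notin> approx_point_spectrum (S \<circ> T \<circ> inv S)"
    then obtain c where c: "c > 0" "\<And>y. c * norm y \<le> norm ((S \<circ> T \<circ> inv S) y - z *\<^sub>C y)"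
      unfolding not_in_approx_point_spectrum_iff[OF bounded_clinear_similar[OF T S(2,3)]] bounded_below_def by blast
    obtain L where L: "L > 0" "\<And>x. norm (S x) \<le> L * norm x"
      using bounded_clinear_bound[OF S(2)] by blast
    obtain M where M: "M > 0" "\<And>x. norm (inv S x) \<le> M * norm x"
      using bounded_clinear_bound[OF S(3)] by blast
    have inv: "inv S (S x) = x" for x
      using S(1) by (simp add: bij_is_inj)
    have "c / (L * M) * norm x \<le> norm (T x - z *\<^sub>C x)" for x
    proof -
      have "c * norm x \<le> c * (M * norm (S x))"
        using M(2)[of "S x"] c(1) by (simp add: inv)
      also have "\<dots> = M * (c * norm (S x))"
        by simp
      also have "\<dots> \<le> M * norm (S (T x - z *\<^sub>C x))"
        using c(2)[of "S x"] M(1) by (simp add: inv bounded_clinear_simps[OF S(2)])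
      also have "\<dots> \<le> M * (L * norm (T x - z *\<^sub>C x))"
        using M(1) L(2) by (intro mult_left_mono) auto
      finally show ?thesis
        using L(1) M(1) by (simp add: field_simps)
    qed
    then have "bounded_below (\<lambda>x. T x - z *\<^sub>C x)"
      unfolding bounded_below_def using c(1) L(1) M(1) by (intro exI[of _ "c / (L * M)"]) simp
    then show False
      using z not_in_approx_point_spectrum_iff[OF T] by blast
  qed
qed

lemma Inter_closure_SRG:
  assumes T: "bounded_clinear T"
  shows "\<Inter> {closure (SRG (S \<circ> T \<circ> inv S)) | S. bij S \<and> bounded_clinear S \<and> bounded_clinear (inv S)}
    = co_BK (approx_point_spectrum T)"
proof (intro equalityI subsetI InterI)
  fix p assume p: "p \<in> \<Inter> {closure (SRG (S \<circ> T \<circ> inv S)) | S. bij S \<and> bounded_clinear S \<and> bounded_clinear (inv S)}"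
  show "p \<in> co_BK (approx_point_spectrum T)"
  proof (rule in_co_BK, rule ccontr)
    assume "bk p \<notin> convex hull (bk ` approx_point_spectrum T)"
    then obtain S where "bij S" "bounded_clinear S" "bounded_clinear (inv S)" "p \<notin> closure (SRG (S \<circ> T \<circ> inv S))"
      using separating_similarity[OF T] by blast
    then show False
      using p by blast
  qed
next
  fix p X assume p: "p \<in> co_BK (approx_point_spectrum T)"
    and "X \<in> {closure (SRG (S \<circ> T \<circ> inv S)) | S. bij S \<and> bounded_clinear S \<and> bounded_clinear (inv S)}"
  then obtain S where S: "bij S" "bounded_clinear S" "bounded_clinear (inv S)" "X = closure (SRG (S \<circ> T \<circ> inv S))"
    by blast
  then show "p \<in> X"
    using p co_BK_mono[OF approx_point_spectrum_similar[OF T S(1-3)]]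
      co_BK_approx_point_spectrum_subset[OF bounded_clinear_similar[OF T S(2,3)]] by blast
qed

lemma closure_SRG_normal:
  assumes T: "bounded_clinear T" and normal: "T \<circ> cadjoint T = cadjoint T \<circ> T"
  shows "closure (SRG T) = co_BK (approx_point_spectrum T)"
proof
  show "closure (SRG T) \<subseteq> co_BK (approx_point_spectrum T)"
  proof
    fix p assume p: "p \<in> closure (SRG T)"
    show "p \<in> co_BK (approx_point_spectrum T)"
    proof (rule in_co_BK, rule ccontr)
      assume "bk p \<notin> convex hull (bk ` approx_point_spectrum T)"
      then obtain S where "p \<notin> closure (SRG (S \<circ> T \<circ> inv S))" "S \<circ> T \<circ> inv S = T"
        using separating_similarity[OF T] normal by metis
      then show False
        using p by simp
    qed
  qed
qed (rule co_BK_approx_point_spectrum_subset[OF T])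

section \<open>The real spectrum and the adjoint\<close>

text \<open>The hypothesis on real points serves disks around \<open>p\<close>: it keeps their
  centre off the spectrum. When \<open>p\<close> lies outside the disk, surjectivity far away plays
  that part.\<close>

lemma bk_spectrum_in_hull:
  assumes T: "bounded_clinear T" and real: "spectrum T \<inter> \<real> \<subseteq> approx_point_spectrum T" and p: "p \<in> spectrum T"
  shows "bk p \<in> convex hull (bk ` approx_point_spectrum T)"
proof (rule ccontr)
  assume "bk p \<notin> convex hull (bk ` approx_point_spectrum T)"
  with compact_approx_point_spectrum[OF T] show False
  proof (cases rule: separating_disk)
    case (inside t \<rho>)
    have disj: "approx_point_spectrum T \<inter> cball (complex_of_real t) \<rho> = {}"
      using inside(3) by (force simp: dist_norm norm_minus_commute)
    moreover have "complex_of_real t \<in> cball (complex_of_real t) \<rho>"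
      using inside(1) by simp
    ultimately have "complex_of_real t \<notin> spectrum T"
      using real Reals_of_real[of t] by blast
    then show False
      using disjoint_spectrum_disk[OF T disj] p inside(2) by (auto simp: dist_norm norm_minus_commute)
  next
    case (outside t \<rho>)
    have "approx_point_spectrum T \<subseteq> ball (complex_of_real t) \<rho>"
      using outside(3) by (auto simp: dist_norm norm_minus_commute)
    then show False
      using disjoint_spectrum_outside[OF T _ outside(2)] p by blast
  qed
qed

text \<open>At a real point the excluding disk can be centred at the point itself, so a lower bound
  for \<open>T - r\<close> suffices.\<close>

lemma not_in_closure_SRG_real:
  assumes T: "bounded_clinear T" and "r \<notin> approx_point_spectrum T" "r \<in> \<real>"
  shows "r \<notin> closure (SRG T)"
proof
  assume "r \<in> closure (SRG T)"
  obtain t where t: "r = complex_of_real t"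
    using \<open>r \<in> \<real>\<close> by (auto elim: Reals_cases)
  obtain c where c: "c > 0" "\<And>x. c * norm x \<le> norm (T x - complex_of_real t *\<^sub>C x)"
    using assms(2) not_in_approx_point_spectrum_iff[OF T] by (auto simp: t bounded_below_def)
  then show False
    using closure_SRG_ge[OF c(2) \<open>r \<in> closure (SRG T)\<close>] by (simp add: t)
qed

text \<open>For \<open>y\<close> outside the range, solve the normal equation
  \<open>cadjoint A (A x) = cadjoint A y\<close>, possible by coercivity; the residual
  \<open>y - A x\<close> is the kernel vector.\<close>

lemma not_surj_cadjoint_kernel:
  assumes A: "bounded_clinear A" and "bounded_below A" "\<not> surj A"
  obtains w where "w \<noteq> 0" "cadjoint A w = 0"
proof -
  obtain c where c: "c > 0" "\<And>x. c * norm x \<le> norm (A x)"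
    using assms(2) by (auto simp: bounded_below_def)
  note A' = bounded_clinear_cadjoint[OF A]
  have "c\<^sup>2 * (norm x)\<^sup>2 \<le> cadjoint A (A x) \<bullet> x" for x
    using power_mono[OF c(2)[of x], of 2] c(1)
    by (simp add: inner_cadjoint_left[OF A] power2_norm_eq_inner[symmetric] power_mult_distrib)
  then have "surj (\<lambda>x. cadjoint A (A x))"
    using c(1) by (intro coercive_surj[OF bounded_clinear_linear[OF bounded_clinear_comp[OF A' A]], of "c\<^sup>2"]) auto
  obtain y where y: "y \<notin> range A"
    using assms(3) by blast
  obtain x where x: "cadjoint A (A x) = cadjoint A y"
    using \<open>surj (\<lambda>x. cadjoint A (A x))\<close> by (metis surjD)
  have "y - A x \<noteq> 0"
    using y by auto
  moreover have "cadjoint A (y - A x) = 0"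
    by (simp add: bounded_clinear_simps[OF A'] x)
  ultimately show ?thesis
    using that by blast
qed

text \<open>Such an \<open>r\<close> is residual for \<open>T\<close>, hence an eigenvalue of
  \<open>cadjoint T\<close>, because \<open>cnj r = r\<close>.\<close>

lemma spectrum_real_in_SRG_cadjoint:
  assumes T: "bounded_clinear T" and r: "r \<in> spectrum T" "r \<notin> approx_point_spectrum T" "r \<in> \<real>"
  shows "r \<in> SRG (cadjoint T)"
proof -
  obtain w where "w \<noteq> 0" and w: "cadjoint (\<lambda>x. T x - r *\<^sub>C x) w = 0"
    using not_surj_cadjoint_kernel[OF bounded_clinear_shift[OF T]] r(1,2)
      not_in_spectrum_iff[OF T] not_in_approx_point_spectrum_iff[OF T] by metis
  obtain t where t: "r = complex_of_real t"
    using r(3) by (auto elim: Reals_cases)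
  have "cadjoint T w = t *\<^sub>R w"
    using w unfolding cadjoint_shift[OF T] by (simp add: t scaleC_of_real)
  then show ?thesis
    unfolding SRG_iff[OF bounded_clinear_cadjoint[OF T]]
    using \<open>w \<noteq> 0\<close> by (intro exI[of _ w]) (simp add: t power2_norm_eq_inner)
qed

text \<open>Surjectivity is essential: the unilateral shift is isometric, yet its adjoint has a
  kernel. With \<open>y = A x\<close>, the claim is Cauchy-Schwarz for
  \<open>x \<bullet> cadjoint A y\<close>.\<close>

lemma norm_cadjoint_ge:
  assumes A: "bounded_clinear A" and "surj A" and \<rho>: "\<rho> > 0" and below: "\<And>x. \<rho> * norm x \<le> norm (A x)"
  shows "\<rho> * norm y \<le> norm (cadjoint A y)"
proof (cases "y = 0")
  case False
  obtain x where x: "y = A x"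
    using \<open>surj A\<close> by (metis surjD)
  have "(norm y)\<^sup>2 = x \<bullet> cadjoint A y"
    by (metis inner_cadjoint[OF A] power2_norm_eq_inner x)
  also have "\<dots> \<le> norm x * norm (cadjoint A y)"
    by (rule norm_cauchy_schwarz)
  finally have "\<rho> * (norm y)\<^sup>2 \<le> (\<rho> * norm x) * norm (cadjoint A y)"
    using \<rho> by (simp add: mult.assoc)
  also have "\<dots> \<le> norm y * norm (cadjoint A y)"
    unfolding x by (intro mult_right_mono below) auto
  finally have "norm y * (\<rho> * norm y) \<le> norm y * norm (cadjoint A y)"
    by (simp add: power2_eq_square mult_ac)
  then show ?thesis
    using False by simp
qed (use \<rho> in simp)

lemma norm_cadjoint_le:
  assumes A: "bounded_clinear A" and \<rho>: "\<rho> > 0" and bound: "\<And>x. norm (A x) \<le> \<rho> * norm x"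
  shows "norm (cadjoint A y) \<le> \<rho> * norm y"
proof (cases "cadjoint A y = 0")
  case False
  have "(norm (cadjoint A y))\<^sup>2 = A (cadjoint A y) \<bullet> y"
    by (metis inner_cadjoint[OF A] power2_norm_eq_inner)
  also have "\<dots> \<le> norm (A (cadjoint A y)) * norm y"
    by (rule norm_cauchy_schwarz)
  also have "\<dots> \<le> \<rho> * norm (cadjoint A y) * norm y"
    by (intro mult_right_mono bound) auto
  finally have "norm (cadjoint A y) * norm (cadjoint A y) \<le> norm (cadjoint A y) * (\<rho> * norm y)"
    by (simp add: power2_eq_square mult_ac)
  then show ?thesis
    using False by simp
qed (use \<rho> in simp)

text \<open>Since \<open>t\<close> is real, bounds for \<open>T - t\<close> turn into bounds for
  \<open>cadjoint T - t\<close>. Upper bounds always transfer; a lower bound keeps \<open>t\<close>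
  off the approximate point spectrum, and the hypothesis then supplies the surjectivity that it
  requires.\<close>

lemma closure_SRG_cadjoint_subset:
  assumes T: "bounded_clinear T" and real: "spectrum T \<inter> \<real> \<subseteq> approx_point_spectrum T"
  shows "closure (SRG (cadjoint T)) \<subseteq> closure (SRG T)"
proof
  fix z assume z: "z \<in> closure (SRG (cadjoint T))"
  have shift: "cadjoint (\<lambda>x. T x - complex_of_real t *\<^sub>C x) = (\<lambda>x. cadjoint T x - complex_of_real t *\<^sub>C x)" for t
    by (simp add: cadjoint_shift[OF T])
  show "z \<in> closure (SRG T)"
  proof (rule ccontr)
    assume "z \<notin> closure (SRG T)"
    with T show False
    proof (cases rule: not_in_closure_SRG)
      case (inside t \<rho>)
      have "complex_of_real t \<notin> approx_point_spectrum T"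
        using inside(1,3) not_in_approx_point_spectrum_iff[OF T] by (auto simp: bounded_below_def)
      then have "complex_of_real t \<notin> spectrum T"
        using real Reals_of_real[of t] by blast
      then have "surj (\<lambda>x. T x - complex_of_real t *\<^sub>C x)"
        using not_in_spectrum_iff[OF T] by blast
      then have "\<rho> * norm y \<le> norm (cadjoint T y - complex_of_real t *\<^sub>C y)" for y
        using norm_cadjoint_ge[OF bounded_clinear_shift[OF T] _ inside(1,3), of y] by (simp add: shift)
      then show False
        using closure_SRG_ge[of \<rho> "cadjoint T" t z] z inside(2) by auto
    next
      case (outside t \<rho>)
      have "norm (cadjoint T y - complex_of_real t *\<^sub>C y) \<le> \<rho> * norm y" for y
        using norm_cadjoint_le[OF bounded_clinear_shift[OF T] outside(1,3), of y] by (simp add: shift)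
      then show False
        using closure_SRG_le[of "cadjoint T" t \<rho> z] z outside(2) by auto
    qed
  qed
qed

theorem theorem1:
  fixes T :: "'a::complex_hilbert_space \<Rightarrow> 'a"
  assumes T: "bounded_clinear T"
  shows "SRG T = bk_inv_image (numerical_range (bk_op T))
    \<and> SRG T = co_BK (SRG T)
    \<and> (T \<circ> cadjoint T = cadjoint T \<circ> T \<longrightarrow>
         closure (SRG T) = co_BK (approx_point_spectrum T))
    \<and> approx_point_spectrum T \<subseteq> closure (SRG T)
    \<and> \<Inter> {closure (SRG (S \<circ> T \<circ> inv S)) | S.
            bij S \<and> bounded_clinear S \<and> bounded_clinear (inv S)}
        = co_BK (approx_point_spectrum T)
    \<and> (spectrum T \<subseteq> closure (SRG T) \<longleftrightarrow>
         \<Inter> {closure (SRG (S \<circ> T \<circ> inv S)) | S.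
            bij S \<and> bounded_clinear S \<and> bounded_clinear (inv S)}
           = co_BK (spectrum T))
    \<and> (spectrum T \<subseteq> closure (SRG T) \<longleftrightarrow>
         closure (SRG (cadjoint T)) \<subseteq> closure (SRG T))
    \<and> (spectrum T \<subseteq> closure (SRG T) \<longleftrightarrow>
         spectrum T \<inter> \<real> \<subseteq> approx_point_spectrum T)"
proof -
  have srg: "SRG T = bk_inv_image (numerical_range (bk_op T))"
    unfolding numerical_range_bk_op_eq[OF T] bk_inv_image_bk using cnj_SRG by blast
  \<comment> \<open>All the equivalences are routed through the condition on real spectral
    points.\<close>
  have spectrum_real: "spectrum T \<inter> \<real> \<subseteq> approx_point_spectrum T" if "spectrum T \<subseteq> closure (SRG T)"
    using that not_in_closure_SRG_real[OF T] by blast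
  have hull: "co_BK (spectrum T) = co_BK (approx_point_spectrum T)"
    if "spectrum T \<inter> \<real> \<subseteq> approx_point_spectrum T"
  proof -
    have "bk ` spectrum T \<subseteq> convex hull (bk ` approx_point_spectrum T)"
      using bk_spectrum_in_hull[OF T that] by blast
    then have "convex hull (bk ` spectrum T) \<subseteq> convex hull (bk ` approx_point_spectrum T)"
      by (rule hull_minimal) simp
    then show ?thesis
      using co_BK_mono[OF approx_point_spectrum_subset[of T]] by (auto simp: co_BK_def bk_inv_image_def)
  qed
  \<comment> \<open>With \<open>approx_co_BK\<close> this closes the cycle: if the intersection
    equals \<open>co_BK (spectrum T)\<close>, then \<open>spectrum T\<close> lies in
    \<open>co_BK (approx_point_spectrum T)\<close>, hence in the closed graph.\<close>
  have spectrum_co_BK: "spectrum T \<subseteq> co_BK (spectrum T)"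
    by (auto intro!: in_co_BK hull_inc)
  have approx_co_BK: "co_BK (approx_point_spectrum T) \<subseteq> closure (SRG T)"
    by (rule co_BK_approx_point_spectrum_subset[OF T])
  \<comment> \<open>A real spectral point off the approximate point spectrum would lie in the graph
    of \<open>cadjoint T\<close> but not in the closed graph of \<open>T\<close>.\<close>
  have "spectrum T \<inter> \<real> \<subseteq> approx_point_spectrum T" if "closure (SRG (cadjoint T)) \<subseteq> closure (SRG T)"
    using that spectrum_real_in_SRG_cadjoint[OF T] not_in_closure_SRG_real[OF T] closure_subset by blast
  then show ?thesis
    using srg co_BK_SRG(1)[OF T] closure_SRG_normal[OF T] approx_point_spectrum_subset_closure_SRG[OF T]
      Inter_closure_SRG[OF T] spectrum_real hull spectrum_co_BK approx_co_BK closure_SRG_cadjoint_subset[OF T]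
    by (metis (no_types, lifting) subset_trans)
qed

end
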